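(* Let $A\in(0,1)$ be irrational and let $p_0/q_0$, $p_1/q_1$ (both in $(0,1)$) be two successive terms in the approximating sequence associated to $A$. For $i=0,1$ write $R_i=R_{p_i/q_i}$, $\gamma_i=\gamma_{p_i/q_i}$, and let $TH_i$, $BH_i$ be the top and bottom horizontal lines of capacity $2$ with respect to $p_i/q_i$. Then there is a vertical translation $\Upsilon$ of the plane such that $\Upsilon(R_0)$ is contained in the part of $R_1$ below the horizontal midline of $R_1$, and $\Upsilon(\gamma_0)\subset\gamma_1$. Moreover, either $\Upsilon(BH_0)=BH_1$ or $\Upsilon(TH_0)=BH_1$.
   Context: Plaid model. An even rational parameter is a rational $p/q\in(0,1)$ in lowest terms with $pq$ even. Put $\omega=p+q$, $P=2p/\omega$, $Q=2q/\omega$. Consider four families of lines: $\mathcal H$ (horizontal lines with integer $y$-coordinate), $\mathcal V$ (vertical lines with integer $x$-coordinate), $\mathcal P$ (slope $-P$, integer $y$-intercept), $\mathcal Q$ (slope $-Q$, integer $y$-intercept). Define functions with values in $\mathbb{R}/2\mathbb{Z}$, represented in $[-1,1)$: $F_H=2Py$, $F_V=2Px$, $F_P=Py+P^2x+1$, $F_Q=Py+PQx+1$. The function $F_C$ is constant on each line $L$ of the family $\mathcal C$. The capacity of a line $L$ in $\mathcal H$ or $\mathcal V$ is $|\omega F_C(L)|$, and its sign is the sign of $F_C(L)$. If $z$ is on an $\mathcal A$ line ($A\in\{H,V\}$) and on a $\mathcal B$ line ($B\in\{P,Q\}$), then $z$ is light (for these lines) if $|F_B(z)|<|F_A(z)|$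 and $F_A(z)F_B(z)>0$. The unit segments are the edges of the unit squares $[a,a+1]\times[b,b+1]$, $a,b\in\mathbb{Z}$. A unit segment contained in an $\mathcal A$ line is good if it contains exactly one point which is light with respect to that $\mathcal A$ line and some $\mathcal P$ or $\mathcal Q$ line, where a light point at the midpoint of a horizontal unit segment is counted twice. It is known that each unit square has $0$ or $2$ good edges. In each unit square with two good edges draw the segments joining the center of the square to the centers of its good edges. The resulting embedded closed polygons are the plaid polygons. The first block is $[0,\omega]^2$; every plaid polygon meeting it lies in it. The big polygon $\Gamma_{p/q}$ is the plaid polygon in the first block containing the point $(1/2,y)$, where $L=\{y=\mathrm{const}\}$ is the $\mathcal H$ line of capacity $2$ and positive sign which intersects the first block (this polygon is known to be symmetric in the horizontal midline of the first block). $R_{p/q}$ is the rectangle bounded by the bottom, left and top of the first block, and by whichever $\mathcal V$ line of positive capacity at most $4$ in the first block is closest to the left edge. Put $\gamma_{p/q}=\Gamma_{p/q}\cap R_{p/q}$. There are two horizontal lines of capacity $2$ meeting the first block; the upper one is $TH$, the lower one $BH$. Number theory. $0/1$ is also counted as an even rational here (with $\omega=1$). The tune $\tau$ of $p/q\in(0,1)$ is the unique integer in $(0,\omega/2)$ with $2p\tau\equiv\pm1 \bmod \omega$. The integer $\kappa\ge 0$ is determined by $\frac{\kappa}{2\kappa+1}\le\frac{\tau}{\omega}<\frac{\kappa+1}{2(\kappa+1)+1}$. The even predecessor of $p/q$ is the unique even rational $p'/q'$ with $|pq'-p'q|=1$ and $p'+q'<p+q$. The core predecessor of $p/q$ is $\widehat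 p/\widehat q$ with $\widehat p=p-2\kappa p'$, $\widehat q=q-2\kappa q'$. The predecessor $p^*/q^*$ of $p/q$, written $p^*/q^*\prec p/q$, is: $0/1$ if $p=1$; $p'/q'$ if $p\ge2$ and $\kappa=0$; $\widehat p/\widehat q$ if $p\ge2$ and $\kappa\ge1$. The predecessor sequence of $A$ is a sequence $\{p_k/q_k\}_{k\ge0}$ with $p_0/q_0=0/1$, $p_k/q_k\prec p_{k+1}/q_{k+1}$ for all $k$, and $p_k/q_k\to A$. With $\tau_k,\omega_k$ the quantities for $p_k/q_k$, the term $p_k/q_k$ is called weak if $\tau_{k+1}<\omega_{k+1}/4$, strong if $\tau_{k+1}\in(\omega_{k+1}/4,\omega_{k+1}/3)$, core if $\tau_{k+1}>\omega_{k+1}/3$. The approximating sequence of $A$ is the subsequence consisting of the terms $p_k/q_k$ of the predecessor sequence that are core, or that are strong and such that $p_{k-1}/q_{k-1}$ is not core. *)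

theory Defs
  imports "HOL-Analysis.Analysis" "HOL-Number_Theory.Cong"
begin

section \<open>The plaid model\<close>

text \<open>
  A rational \<open>p/q\<close> in lowest terms is represented by the two integers \<open>p\<close>, \<open>q\<close>, and the plane by
  \<open>real \<times> real\<close>. The definitions of this section are meant for parameters satisfying
  \<open>even_param p q\<close>.
\<close>

definition even_param :: "int \<Rightarrow> int \<Rightarrow> bool" where
  "even_param p q \<longleftrightarrow> 0 < p \<and> p < q \<and> coprime p q \<and> even (p * q)"

definition omega :: "int \<Rightarrow> int \<Rightarrow> int" where
  "omega p q = p + q"

definition slopeP :: "int \<Rightarrow> int \<Rightarrow> real" where
  "slopeP p q = 2 * of_int p / of_int (omega p q)"

definition slopeQ :: "int \<Rightarrow> int \<Rightarrow> real" where
  "slopeQ p q = 2 * of_int q / of_int (omega p q)"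

text \<open>The representative in \<open>[-1,1)\<close> of the class of \<open>t\<close> in \<open>\<real>/2\<int>\<close>.\<close>

definition rep2 :: "real \<Rightarrow> real" where
  "rep2 t = t - 2 * of_int \<lfloor>(t + 1) / 2\<rfloor>"

datatype family = FH | FV | FP | FQ

text \<open>The \<open>n\<close>-th line of a family: \<open>n\<close> is the \<open>x\<close>-coordinate for \<open>FV\<close>, the \<open>y\<close>-intercept otherwise.\<close>

fun line :: "int \<Rightarrow> int \<Rightarrow> family \<Rightarrow> int \<Rightarrow> (real \<times> real) set" where
  "line p q FH n = {(x, y). y = of_int n}"
| "line p q FV n = {(x, y). x = of_int n}"
| "line p q FP n = {(x, y). y = - slopeP p q * x + of_int n}"
| "line p q FQ n = {(x, y). y = - slopeQ p q * x + of_int n}"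

fun F :: "int \<Rightarrow> int \<Rightarrow> family \<Rightarrow> real \<times> real \<Rightarrow> real" where
  "F p q FH (x, y) = rep2 (2 * slopeP p q * y)"
| "F p q FV (x, y) = rep2 (2 * slopeP p q * x)"
| "F p q FP (x, y) = rep2 (slopeP p q * y + (slopeP p q)\<^sup>2 * x + 1)"
| "F p q FQ (x, y) = rep2 (slopeP p q * y + slopeP p q * slopeQ p q * x + 1)"

text \<open>The constant value of \<open>F p q C\<close> on the \<open>n\<close>-th line of the family \<open>C\<close>.\<close>

definition line_value :: "int \<Rightarrow> int \<Rightarrow> family \<Rightarrow> int \<Rightarrow> real" where
  "line_value p q C n = (THE c. \<forall>z \<in> line p q C n. F p q C z = c)"

definition capacity :: "int \<Rightarrow> int \<Rightarrow> family \<Rightarrow> int \<Rightarrow> real" where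
  "capacity p q C n = \<bar>of_int (omega p q) * line_value p q C n\<bar>"

text \<open>\<open>z\<close>, lying on an \<open>A\<close> line, is light with respect to it and some line of family \<open>FP\<close> or \<open>FQ\<close>.\<close>

definition light :: "int \<Rightarrow> int \<Rightarrow> family \<Rightarrow> real \<times> real \<Rightarrow> bool" where
  "light p q A z \<longleftrightarrow>
     (\<exists>B \<in> {FP, FQ}. (\<exists>n. z \<in> line p q B n) \<and>
        \<bar>F p q B z\<bar> < \<bar>F p q A z\<bar> \<and> F p q A z * F p q B z > 0)"

text \<open>Unit segments, given by their lower or left endpoint.\<close>

datatype unit_segment = Hor int int | Ver int int

fun seg_family :: "unit_segment \<Rightarrow> family" where
  "seg_family (Hor a b) = FH"
| "seg_family (Ver a b) = FV"

fun seg_points :: "unit_segment \<Rightarrow> (real \<times> real) set" where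
  "seg_points (Hor a b) = closed_segment (of_int a, of_int b) (of_int a + 1, of_int b)"
| "seg_points (Ver a b) = closed_segment (of_int a, of_int b) (of_int a, of_int b + 1)"

fun seg_center :: "unit_segment \<Rightarrow> real \<times> real" where
  "seg_center (Hor a b) = (of_int a + 1/2, of_int b)"
| "seg_center (Ver a b) = (of_int a, of_int b + 1/2)"

text \<open>
  Light points are counted as points (also if they lie on several lines of families \<open>FP\<close> and \<open>FQ\<close>),
  except that the midpoint of a horizontal segment has weight 2. The set summed over is finite,
  because \<open>FP\<close> and \<open>FQ\<close> lines are transverse to the unit segments.
\<close>

definition light_count :: "int \<Rightarrow> int \<Rightarrow> unit_segment \<Rightarrow> nat" where
  "light_count p q e =
     (\<Sum>z \<in> {z \<in> seg_points e. light p q (seg_family e) z}.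
        if seg_family e = FH \<and> z = seg_center e then 2 else 1)"

definition good :: "int \<Rightarrow> int \<Rightarrow> unit_segment \<Rightarrow> bool" where
  "good p q e \<longleftrightarrow> light_count p q e = 1"

definition square_edges :: "int \<Rightarrow> int \<Rightarrow> unit_segment set" where
  "square_edges a b = {Hor a b, Hor a (b + 1), Ver a b, Ver (a + 1) b}"

definition good_edges :: "int \<Rightarrow> int \<Rightarrow> int \<Rightarrow> int \<Rightarrow> unit_segment set" where
  "good_edges p q a b = {e \<in> square_edges a b. good p q e}"

definition square_arcs :: "int \<Rightarrow> int \<Rightarrow> int \<Rightarrow> int \<Rightarrow> (real \<times> real) set" where
  "square_arcs p q a b =
     (if card (good_edges p q a b) = 2
      then \<Union>e \<in> good_edges p q a b.
             closed_segment (of_int a + 1/2, of_int b + 1/2) (seg_center e)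
      else {})"

definition plaid_set :: "int \<Rightarrow> int \<Rightarrow> (real \<times> real) set" where
  "plaid_set p q = (\<Union>a. \<Union>b. square_arcs p q a b)"

text \<open>
  Distinct plaid polygons are embedded and disjoint, hence the plaid polygon through a point of
  \<open>plaid_set p q\<close> is the connected component of that point.
\<close>

definition plaid_polygon :: "int \<Rightarrow> int \<Rightarrow> real \<times> real \<Rightarrow> (real \<times> real) set" where
  "plaid_polygon p q z = connected_component_set (plaid_set p q) z"

definition first_block :: "int \<Rightarrow> int \<Rightarrow> (real \<times> real) set" where
  "first_block p q = {0..of_int (omega p q)} \<times> {0..of_int (omega p q)}"

definition meets_block :: "int \<Rightarrow> int \<Rightarrow> family \<Rightarrow> int \<Rightarrow> bool" where
  "meets_block p q C n \<longleftrightarrow> line p q C n \<inter> first_block p q \<noteq> {}"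

definition big_height :: "int \<Rightarrow> int \<Rightarrow> int" where
  "big_height p q =
     (THE n. meets_block p q FH n \<and> capacity p q FH n = 2 \<and> line_value p q FH n > 0)"

definition big_polygon :: "int \<Rightarrow> int \<Rightarrow> (real \<times> real) set" where
  "big_polygon p q = plaid_polygon p q (1/2, of_int (big_height p q))"

definition rect_width :: "int \<Rightarrow> int \<Rightarrow> int" where
  "rect_width p q =
     Min {n. meets_block p q FV n \<and> 0 < capacity p q FV n \<and> capacity p q FV n \<le> 4}"

definition rect :: "int \<Rightarrow> int \<Rightarrow> (real \<times> real) set" where
  "rect p q = {0..of_int (rect_width p q)} \<times> {0..of_int (omega p q)}"

definition gamma_arc :: "int \<Rightarrow> int \<Rightarrow> (real \<times> real) set" where
  "gamma_arc p q = big_polygon p q \<inter> rect p q"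

text \<open>The part of \<open>rect p q\<close> below its horizontal midline.\<close>

definition rect_lower :: "int \<Rightarrow> int \<Rightarrow> (real \<times> real) set" where
  "rect_lower p q = {z \<in> rect p q. snd z < of_int (omega p q) / 2}"

definition top_line :: "int \<Rightarrow> int \<Rightarrow> (real \<times> real) set" where
  "top_line p q = line p q FH (Max {n. meets_block p q FH n \<and> capacity p q FH n = 2})"

definition bottom_line :: "int \<Rightarrow> int \<Rightarrow> (real \<times> real) set" where
  "bottom_line p q = line p q FH (Min {n. meets_block p q FH n \<and> capacity p q FH n = 2})"

definition vtrans :: "real \<Rightarrow> real \<times> real \<Rightarrow> real \<times> real" where
  "vtrans t z = (fst z, snd z + t)"


section \<open>Predecessor and approximating sequences\<close>

definition even_rational :: "int \<Rightarrow> int \<Rightarrow> bool" where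
  "even_rational p q \<longleftrightarrow> even_param p q \<or> (p = 0 \<and> q = 1)"

definition tune :: "int \<Rightarrow> int \<Rightarrow> int" where
  "tune p q = (THE t. 0 < t \<and> 2 * t < omega p q \<and>
     ([2 * p * t = 1] (mod omega p q) \<or> [2 * p * t = -1] (mod omega p q)))"

definition kappa :: "int \<Rightarrow> int \<Rightarrow> nat" where
  "kappa p q = (THE k.
     real k / (2 * real k + 1) \<le> of_int (tune p q) / of_int (omega p q) \<and>
     of_int (tune p q) / of_int (omega p q) < (real k + 1) / (2 * (real k + 1) + 1))"

definition even_predecessor :: "int \<Rightarrow> int \<Rightarrow> int \<times> int" where
  "even_predecessor p q =
     (THE (p', q'). even_rational p' q' \<and> \<bar>p * q' - p' * q\<bar> = 1 \<and> p' + q' < p + q)"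

definition core_predecessor :: "int \<Rightarrow> int \<Rightarrow> int \<times> int" where
  "core_predecessor p q =
     (case even_predecessor p q of (p', q') \<Rightarrow>
        (p - 2 * int (kappa p q) * p', q - 2 * int (kappa p q) * q'))"

definition predecessor :: "int \<Rightarrow> int \<Rightarrow> int \<times> int" where
  "predecessor p q =
     (if p = 1 then (0, 1)
      else if kappa p q = 0 then even_predecessor p q
      else core_predecessor p q)"

definition predecessor_sequence :: "real \<Rightarrow> (nat \<Rightarrow> int) \<Rightarrow> (nat \<Rightarrow> int) \<Rightarrow> bool" where
  "predecessor_sequence A p q \<longleftrightarrow>
     p 0 = 0 \<and> q 0 = 1 \<and>
     (\<forall>k. even_param (p (Suc k)) (q (Suc k)) \<and>
          (p k, q k) = predecessor (p (Suc k)) (q (Suc k))) \<and>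
     (\<lambda>k. of_int (p k) / of_int (q k)) \<longlonglongrightarrow> A"

definition strong_term :: "(nat \<Rightarrow> int) \<Rightarrow> (nat \<Rightarrow> int) \<Rightarrow> nat \<Rightarrow> bool" where
  "strong_term p q k \<longleftrightarrow>
     real_of_int (tune (p (Suc k)) (q (Suc k))) \<in>
       {of_int (omega (p (Suc k)) (q (Suc k))) / 4 <..< of_int (omega (p (Suc k)) (q (Suc k))) / 3}"

definition core_term :: "(nat \<Rightarrow> int) \<Rightarrow> (nat \<Rightarrow> int) \<Rightarrow> nat \<Rightarrow> bool" where
  "core_term p q k \<longleftrightarrow>
     real_of_int (tune (p (Suc k)) (q (Suc k))) > of_int (omega (p (Suc k)) (q (Suc k))) / 3"

text \<open>
  The indices of the terms retained in the approximating sequence. For \<open>k = 0\<close> there is no previous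
  term, and the condition on it is void.
\<close>

definition approx_index :: "(nat \<Rightarrow> int) \<Rightarrow> (nat \<Rightarrow> int) \<Rightarrow> nat \<Rightarrow> bool" where
  "approx_index p q k \<longleftrightarrow>
     core_term p q k \<or> (strong_term p q k \<and> \<not> (k > 0 \<and> core_term p q (k - 1)))"

definition successive_approx :: "(nat \<Rightarrow> int) \<Rightarrow> (nat \<Rightarrow> int) \<Rightarrow> nat \<Rightarrow> nat \<Rightarrow> bool" where
  "successive_approx p q k m \<longleftrightarrow>
     k < m \<and> approx_index p q k \<and> approx_index p q m \<and>
     (\<forall>j. k < j \<and> j < m \<longrightarrow> \<not> approx_index p q j)"

end

theory Submission
  imports Defs
begin

text \<open>
  Write \<open>w = p + q\<close> and let \<open>rnd m\<close> be the integer nearest to \<open>p m / w\<close>. A unit segment in the left half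
  of the block meets exactly two lines of slopes \<open>- P\<close> and \<open>- Q\<close>, of indices \<open>m\<close> and \<open>m'\<close> say, and it is good iff the two
  masses are separated on the circle by \<open>0\<close> and the capacity of its line \<open>n\<close>, that is iff
  \<open>rnd m + rnd (2 n - m) \<noteq> rnd m' + rnd (2 n - m')\<close>. Two consequences follow. First, in the left half of
  the block every square has \<open>0\<close> or \<open>2\<close> good edges; since a line of capacity 2 has only two
  special intersections, a parity count on the strip between the left edge and the line \<open>x = \<tau>\<close> shows
  that the big polygon meets the strip in one connected piece containing both points of
  abscissa \<open>1/2\<close> on the lines of capacity 2. Second, two parameters have the same picture, up to a
  vertical shift by \<open>s\<close>, wherever \<open>rnd\<close> at \<open>m + s\<close> and \<open>rnd\<close> at \<open>m\<close> differ by a constant and the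
  floors of \<open>P n\<close> agree. A non-core predecessor step allows \<open>s = 0\<close>, and a core step allows
  the centring shift \<open>s = \<kappa> w'\<close>. A term of the approximating sequence satisfies \<open>3 \<tau> \<le> w\<close>, so its
  rectangle is exactly such a strip, and between two successive terms there is at most one core step,
  the first one.
\<close>

section \<open>Nearest integers and the parity of a square\<close>

text \<open>Capacities and masses of corresponding lines differ from one parameter to another, so
  lightness cannot be compared directly. What survives a change of parameter is integer data. The
  masses of the lines of index \<open>m\<close> and \<open>2 * n - m\<close> add up to a fixed class
  modulo \<open>2 * w\<close>; lightness is the carry in this addition, up to a complement depending
  only on \<open>n\<close>, and the carry is read off from two nearest integers. Thereby the sign of
  the line drops out of goodness. Oddness of \<open>w\<close> is essential: it excludes ties and
  leaves one unit of slack at either end of a residue range, and this slack lets Farey neighbours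
  agree on a window of length \<open>w0 + w1\<close>. The second obstacle is that a plaid polygon is
  a global component, while parameters are compared only locally. Hence the object that is copied is
  a connected subset of the strip: its translate is connected and contains a point already known to
  lie on the larger polygon. The strip ends at \<open>x = t\<close> because that line has capacity
  2, so its exits can be counted.\<close>

definition rnd :: "int \<Rightarrow> int \<Rightarrow> int \<Rightarrow> int" where
  "rnd p w m = (2 * p * m + w) div (2 * w)"

definition flr :: "int \<Rightarrow> int \<Rightarrow> int \<Rightarrow> int" where
  "flr p w a = 2 * p * a div w"

definition pair_sum :: "int \<Rightarrow> int \<Rightarrow> int \<Rightarrow> int \<Rightarrow> int" where
  "pair_sum p w n m = rnd p w m + rnd p w (2 * n - m)"

text \<open>On the line \<open>y = n\<close> the slanted lines of index \<open>n + j\<close> cross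
  at \<open>j / P\<close> and \<open>j / Q\<close>. Since \<open>Q = 2 - P\<close>, a unit segment
  meets two Q lines if the floor of \<open>P a\<close> stays constant, and one line of each family
  if it jumps.\<close>

definition hor_good :: "int \<Rightarrow> int \<Rightarrow> int \<Rightarrow> int \<Rightarrow> bool" where
  "hor_good p w a n \<longleftrightarrow>
     (if flr p w (a + 1) = flr p w a
      then pair_sum p w n (n + 2 * a - flr p w a) \<noteq> pair_sum p w n (n + 2 * a - flr p w a + 1)
      else pair_sum p w n (n + flr p w a + 1) \<noteq> pair_sum p w n (n + 2 * a - flr p w a))"

text \<open>The two indices are those of the P line and the Q line crossing the segment; the second
  follows from the first because \<open>Q = 2 - P\<close>.\<close>

definition ver_good :: "int \<Rightarrow> int \<Rightarrow> int \<Rightarrow> int \<Rightarrow> bool" where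
  "ver_good p w n b \<longleftrightarrow>
     pair_sum p w n (b + flr p w n + 1) \<noteq> pair_sum p w n (b + 2 * n - flr p w n)"

locale plaid =
  fixes p w :: int
  assumes p_pos: "0 < p" and p_less: "2 * p < w" and w_odd: "odd w" and cop: "coprime p w"
begin

text \<open>This is \<open>w\<close> times the value of \<open>F\<close> on the slanted lines of
  index \<open>m\<close>, represented between 0 and \<open>2 * w\<close> instead of between
  \<open>- w\<close> and \<open>w\<close>.\<close>

definition res :: "int \<Rightarrow> int" where
  "res m = 2 * p * m + w - 2 * w * rnd p w m"

lemma w_pos: "0 < w" using p_pos p_less by linarith

lemma res_odd: "odd (res m)"
  using w_odd by (simp add: res_def)

lemma res_bounds: "1 \<le> res m" "res m \<le> 2 * w - 1"
proof -
  have "res m = (2 * p * m + w) mod (2 * w)"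
    by (simp add: res_def rnd_def minus_div_mult_eq_mod[symmetric] mult.commute)
  then have "0 \<le> res m" "res m < 2 * w" using w_pos by auto
  moreover have "res m \<noteq> 0" using res_odd[of m] by auto
  ultimately show "1 \<le> res m" "res m \<le> 2 * w - 1" by auto
qed

text \<open>The expression is odd, so a range one unit wider at both ends than
  \<open>[0, 2 * w)\<close> still determines the quotient. The comparison of two parameters lives on
  this extra unit.\<close>

lemma rndI:
  assumes "- 1 < 2 * p * m + w - 2 * w * g" "2 * p * m + w - 2 * w * g < 2 * w + 1"
  shows "rnd p w m = g"
proof -
  have "odd (2 * p * m + w - 2 * w * g)" using w_odd by simp
  then have "2 * p * m + w - 2 * w * g \<noteq> 0" "2 * p * m + w - 2 * w * g \<noteq> 2 * w" by (metis even_zero, metis dvd_triv_left)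
  then have "0 \<le> 2 * p * m + w - 2 * w * g" "2 * p * m + w - 2 * w * g < 2 * w" using assms by auto
  moreover have "2 * p * m + w = 2 * w * g + (2 * p * m + w - 2 * w * g)" by simp
  ultimately show ?thesis unfolding rnd_def by (metis int_div_pos_eq)
qed

text \<open>Rounding is an odd function because \<open>p * m / w\<close> is never a half-integer,
  \<open>w\<close> being odd.\<close>

lemma rnd_minus: "rnd p w (- m) = - rnd p w m"
  by (rule rndI) (use res_bounds[of m] in \<open>auto simp: res_def\<close>)

lemma rnd_period: "rnd p w (m + w * k) = rnd p w m + p * k"
  by (rule rndI) (use res_bounds[of m] in \<open>auto simp: res_def algebra_simps\<close>)

lemma rnd_add:
  assumes "2 * p * k = 2 * w * f + s" "0 \<le> s" "s < 2 * w"
  obtains "rnd p w (m + k) = rnd p w m + f" "res (m + k) = res m + s"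
  | "rnd p w (m + k) = rnd p w m + f + 1" "res (m + k) = res m + s - 2 * w"
proof (cases "res m + s < 2 * w")
  case True
  have "rnd p w (m + k) = rnd p w m + f"
    by (rule rndI) (use assms True res_bounds[of m] in \<open>auto simp: res_def algebra_simps\<close>)
  then show ?thesis using assms(1) by (intro that(1)) (auto simp: res_def algebra_simps)
next
  case False
  have "rnd p w (m + k) = rnd p w m + f + 1"
    by (rule rndI) (use assms False res_bounds[of m] in \<open>auto simp: res_def algebra_simps\<close>)
  then show ?thesis using assms(1) by (intro that(2)) (auto simp: res_def algebra_simps)
qed

lemma rnd_Suc:
  "rnd p w (m + 1) = rnd p w m \<and> res (m + 1) = res m + 2 * p \<or>
   rnd p w (m + 1) = rnd p w m + 1 \<and> res (m + 1) = res m + 2 * p - 2 * w"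
  using rnd_add[of 1 0 "2 * p" m] p_pos p_less by auto

definition rem :: "int \<Rightarrow> int" where
  "rem a = 2 * p * a - w * flr p w a"

lemma rem_bounds: "0 \<le> rem a" "rem a < w"
proof -
  have "rem a = (2 * p * a) mod w"
    by (simp add: rem_def flr_def minus_div_mult_eq_mod[symmetric] mult.commute)
  then show "0 \<le> rem a" "rem a < w" using w_pos by auto
qed

lemma flrI:
  assumes "0 \<le> 2 * p * a - w * f" "2 * p * a - w * f < w"
  shows "flr p w a = f"
proof -
  have "2 * p * a = w * f + (2 * p * a - w * f)" by simp
  then show ?thesis unfolding flr_def using assms by (metis int_div_pos_eq)
qed

lemma rnd_add_even:
  "rnd p w (m + 2 * a) = rnd p w m + flr p w a \<and> res (m + 2 * a) = res m + 2 * rem a \<or>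
   rnd p w (m + 2 * a) = rnd p w m + flr p w a + 1 \<and> res (m + 2 * a) = res m + 2 * rem a - 2 * w"
  using rnd_add[of "2 * a" "flr p w a" "2 * rem a" m] rem_bounds[of a]
  by (auto simp: rem_def algebra_simps)

lemma flr_Suc:
  "flr p w (a + 1) = flr p w a \<and> rem (a + 1) = rem a + 2 * p \<or>
   flr p w (a + 1) = flr p w a + 1 \<and> rem (a + 1) = rem a + 2 * p - w"
proof (cases "rem a + 2 * p < w")
  case True
  have "flr p w (a + 1) = flr p w a"
    by (rule flrI) (use True rem_bounds[of a] p_pos in \<open>auto simp: rem_def algebra_simps\<close>)
  then show ?thesis by (auto simp: rem_def algebra_simps)
next
  case False
  have "flr p w (a + 1) = flr p w a + 1"
    by (rule flrI) (use False rem_bounds[of a] p_less in \<open>auto simp: rem_def algebra_simps\<close>)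
  then show ?thesis by (auto simp: rem_def algebra_simps)
qed

section \<open>Pair sums, and the parity of the good edges of a square\<close>

lemma pair_sum_alt: "pair_sum p w n m = rnd p w m - rnd p w (m - 2 * n)"
  using rnd_minus[of "m - 2 * n"] by (simp add: pair_sum_def)

text \<open>The two masses have a sum fixed modulo \<open>2 * w\<close>, so the pair sum records
  which multiple of \<open>2 * w\<close> was lost in adding them.\<close>

lemma pair_sum_res: "res m + res (2 * n - m) = 4 * p * n + 2 * w - 2 * w * pair_sum p w n m"
  by (simp add: res_def pair_sum_def algebra_simps)

text \<open>Two sums of residues are congruent modulo \<open>2 * w\<close> and both lie in
  \<open>[2, 4 * w - 2]\<close>, so they differ by less than \<open>4 * w\<close>.\<close>

lemma pair_sum_close: "\<bar>pair_sum p w n m - pair_sum p w n m'\<bar> \<le> 1"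
proof -
  have "2 * w * (pair_sum p w n m - pair_sum p w n m') < 2 * w * 2"
    "2 * w * (- 2) < 2 * w * (pair_sum p w n m - pair_sum p w n m')"
    using pair_sum_res[of m n] pair_sum_res[of m' n] res_bounds[of m] res_bounds[of "2 * n - m"]
      res_bounds[of m'] res_bounds[of "2 * n - m'"] by (auto simp: algebra_simps)
  moreover have "0 < 2 * w" using w_pos by simp
  ultimately show ?thesis by (simp only: mult_less_cancel_left_pos)
qed

text \<open>The comparisons are the edges of the 4-cycle \<open>d\<close>, \<open>e\<close>,
  \<open>d1\<close>, \<open>e'\<close>. Signed differences around a cycle add up to 0, and here each
  is -1, 0 or 1, so the number of nonzero ones is even; only 4 remains to be excluded.\<close>

lemma zero_or_two_of_four:
  fixes d d1 e e' :: int
  assumes "\<bar>d - e\<bar> \<le> 1" "\<bar>d - e'\<bar> \<le> 1" "\<bar>d1 - e\<bar> \<le> 1" "\<bar>d1 - e'\<bar> \<le> 1"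
    and "\<not> (d \<noteq> e \<and> d \<noteq> e' \<and> d1 \<noteq> e \<and> d1 \<noteq> e')"
  shows "(of_bool (d \<noteq> e) + of_bool (d \<noteq> e') + of_bool (d1 \<noteq> e) + of_bool (d1 \<noteq> e') :: nat) \<in> {0, 2}"
proof -
  have "d - e \<in> {-1, 0, 1}" "d - e' \<in> {-1, 0, 1}" "d1 - e \<in> {-1, 0, 1}" "d1 - e' \<in> {-1, 0, 1}"
    using assms by auto
  then show ?thesis using assms(5)
    by (cases "d = e"; cases "d = e'"; cases "d1 = e"; cases "d1 = e'") auto
qed

text \<open>The fourth comparison is the sum of the other three, so the number of disagreements is
  even. Three disagreements among the first three would distribute three ones over two sums that are
  at most 1 each.\<close>

lemma zero_or_two_of_bits:
  assumes "of_bool D + of_bool J + of_bool J' \<le> (1::int)" "of_bool C + of_bool I + of_bool I' \<le> (1::int)"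
  shows "(of_bool (of_bool I \<noteq> (of_bool J :: int)) + of_bool (of_bool I' \<noteq> (of_bool J' :: int))
    + of_bool (of_bool D \<noteq> (of_bool C :: int))
    + of_bool (of_bool D + of_bool J + of_bool J' \<noteq> (of_bool C + of_bool I + of_bool I' :: int)) :: nat) \<in> {0, 2}"
  using assms by (cases D; cases C; cases I; cases I'; cases J; cases J'; simp)

text \<open>If the floor jumps, the left and bottom edges meet the same two lines, of index
  \<open>X\<close> and \<open>Y\<close>, and the right and top edges those of index
  \<open>X + 1\<close> and \<open>Y + 1\<close>. Written with differences of nearest integers, the
  four edges form the 4-cycle of \<open>zero_or_two_of_four\<close>.\<close>

lemma square_even_split:
  assumes f: "flr p w (a + 1) = flr p w a + 1"
  shows "(of_bool (hor_good p w a b) + of_bool (hor_good p w a (b + 1))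
        + of_bool (ver_good p w a b) + of_bool (ver_good p w (a + 1) b) :: nat) \<in> {0, 2}"
proof -
  define X Y where "X = b + flr p w a + 1" and "Y = b + 2 * a - flr p w a"
  define x x1 y y1 where "x = rnd p w X" and "x1 = rnd p w (X + 1)" and "y = rnd p w Y" and "y1 = rnd p w (Y + 1)"
  define u u' v v' where "u = rnd p w (X - 2 * a)" and "u' = rnd p w (X - 2 * a - 1)"
    and "v = rnd p w (Y - 2 * a)" and "v' = rnd p w (Y - 2 * a - 1)"
  have L: "ver_good p w a b \<longleftrightarrow> x - y \<noteq> u - v"
    unfolding ver_good_def pair_sum_alt x_def y_def u_def v_def X_def Y_def
    by (simp add: algebra_simps)
  have R: "ver_good p w (a + 1) b \<longleftrightarrow> x1 - y1 \<noteq> u' - v'"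
    unfolding ver_good_def pair_sum_alt x1_def y1_def u'_def v'_def X_def Y_def f
    by (simp add: algebra_simps)
  have B: "hor_good p w a b \<longleftrightarrow> x - y \<noteq> u' - v'"
    unfolding hor_good_def pair_sum_def x_def y_def u'_def v'_def X_def Y_def f
    by (simp add: algebra_simps)
  have T: "hor_good p w a (b + 1) \<longleftrightarrow> x1 - y1 \<noteq> u - v"
    unfolding hor_good_def pair_sum_def x1_def y1_def u_def v_def X_def Y_def f
    by (simp add: algebra_simps)
  note rx = rnd_Suc[of X, folded x_def x1_def]
    and ry = rnd_Suc[of Y, folded y_def y1_def]
    and ru = rnd_Suc[of "X - 2 * a - 1", simplified, folded u_def u'_def]
    and rv = rnd_Suc[of "Y - 2 * a - 1", simplified, folded v_def v'_def]
    and rxu = rnd_add_even[of "X - 2 * a" a, simplified, folded x_def u_def]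
    and ryv = rnd_add_even[of "Y - 2 * a" a, simplified, folded y_def v_def]
  have "X - 2 * a - 1 + 2 * (a + 1) = X + 1" "Y - 2 * a - 1 + 2 * (a + 1) = Y + 1" by simp_all
  then have xu': "x1 = u' + flr p w a + 1 \<or> x1 = u' + flr p w a + 2"
    and yv': "y1 = v' + flr p w a + 1 \<or> y1 = v' + flr p w a + 2"
    using rnd_add_even[of "X - 2 * a - 1" "a + 1"] rnd_add_even[of "Y - 2 * a - 1" "a + 1"]
    unfolding x1_def u'_def y1_def v'_def f by auto
  have A: "x1 = x \<or> x1 = x + 1" "y1 = y \<or> y1 = y + 1" "u = u' \<or> u = u' + 1" "v = v' \<or> v = v' + 1"
    "x = u + flr p w a \<or> x = u + flr p w a + 1" "y = v + flr p w a \<or> y = v + flr p w a + 1"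
    using rx ry ru rv rxu ryv by blast+
  have bx: "1 \<le> res X" "res X \<le> 2 * w - 1" "1 \<le> res Y" "res Y \<le> 2 * w - 1"
     "1 \<le> res (X - 2 * a)" "res (X - 2 * a) \<le> 2 * w - 1" "1 \<le> res (Y - 2 * a)" "res (Y - 2 * a) \<le> 2 * w - 1"
     "1 \<le> res (X + 1)" "res (X + 1) \<le> 2 * w - 1" "1 \<le> res (Y + 1)" "res (Y + 1) \<le> 2 * w - 1"
     "1 \<le> res (X - 2 * a - 1)" "res (X - 2 * a - 1) \<le> 2 * w - 1"
     "1 \<le> res (Y - 2 * a - 1)" "res (Y - 2 * a - 1) \<le> 2 * w - 1" by (rule res_bounds)+
  have close: "\<bar>(x - y) - (u - v)\<bar> \<le> 1" "\<bar>(x1 - y1) - (u' - v')\<bar> \<le> 1"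
    using pair_sum_close[of a X Y] pair_sum_close[of "a + 1" "X + 1" "Y + 1"]
    unfolding pair_sum_alt x_def y_def x1_def y1_def u_def v_def u'_def v'_def
    by (simp_all add: algebra_simps)
  have arg: "2 * b - X = Y - 2 * a - 1" "2 * b - Y = X - 2 * a - 1"
    "2 * (b + 1) - (X + 1) = Y - 2 * a" "2 * (b + 1) - (Y + 1) = X - 2 * a"
    by (simp_all add: X_def Y_def)
  have close': "\<bar>(x - y) - (u' - v')\<bar> \<le> 1" "\<bar>(x1 - y1) - (u - v)\<bar> \<le> 1"
    using pair_sum_close[of b X Y, unfolded pair_sum_def arg]
      pair_sum_close[of "b + 1" "X + 1" "Y + 1", unfolded pair_sum_def arg]
    unfolding x_def y_def x1_def y1_def u_def v_def u'_def v'_def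
    by linarith+
  have no4: "\<not> (x - y \<noteq> u - v \<and> x - y \<noteq> u' - v' \<and> x1 - y1 \<noteq> u - v \<and> x1 - y1 \<noteq> u' - v')"
  proof
    assume h: "x - y \<noteq> u - v \<and> x - y \<noteq> u' - v' \<and> x1 - y1 \<noteq> u - v \<and> x1 - y1 \<noteq> u' - v'"
    have d: "(x - y) - (u - v) \<in> {-1, 1}" "(x - y) - (u' - v') \<in> {-1, 1}"
        "(x1 - y1) - (u - v) \<in> {-1, 1}"
      using h close(1) close' by auto
    have s: "x1 - x \<in> {0, 1}" "y1 - y \<in> {0, 1}" "u - u' \<in> {0, 1}" "v - v' \<in> {0, 1}"
        "x - u - flr p w a \<in> {0, 1}" "y - v - flr p w a \<in> {0, 1}"
        "x1 - u' - flr p w a \<in> {1, 2}" "y1 - v' - flr p w a \<in> {1, 2}"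
      using A(1) apply auto[1]
      using A(2) apply auto[1]
      using A(3) apply auto[1]
      using A(4) apply auto[1]
      using A(5) apply auto[1]
      using A(6) apply auto[1]
      using xu' apply auto[1]
      using yv' apply auto[1]
      done
    have e: "x1 - x = y1 - y" using d(1,3) s(1,2) by auto
    have e': "u - u' = v - v'" using d(1,2) s(3,4) by auto
    have e'': "x1 - x + (u - u') = 1" using d(1) s(5-8) e e' by auto
    have "x1 = x \<and> y1 = y \<and> u = u' + 1 \<and> v = v' + 1 \<or> x1 = x + 1 \<and> y1 = y + 1 \<and> u = u' \<and> v = v'"
      using e e' e'' s(1) by auto
    moreover have "x = u + flr p w a \<and> y = v + flr p w a + 1 \<or> x = u + flr p w a + 1 \<and> y = v + flr p w a"
      using d(1) s(5,6) by auto
    ultimately consider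
      "x1 = x" "y1 = y" "u = u' + 1" "v = v' + 1" "x = u + flr p w a" "y = v + flr p w a + 1"
    | "x1 = x" "y1 = y" "u = u' + 1" "v = v' + 1" "x = u + flr p w a + 1" "y = v + flr p w a"
    | "x1 = x + 1" "y1 = y + 1" "u = u'" "v = v'" "x = u + flr p w a" "y = v + flr p w a + 1"
    | "x1 = x + 1" "y1 = y + 1" "u = u'" "v = v'" "x = u + flr p w a + 1" "y = v + flr p w a"
      by blast
    \<comment> \<open>In each case one of the two chains of residues, through \<open>X\<close> and
      through \<open>Y\<close>, gives \<open>rem a < w - p\<close> and the other
      \<open>rem a > w - p\<close>.\<close>
    then show False using bx rx ry ru rv rxu ryv by cases (simp_all; linarith)+
  qed
  have "(of_bool (x - y \<noteq> u - v) + of_bool (x - y \<noteq> u' - v') + of_bool (x1 - y1 \<noteq> u - v)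
      + of_bool (x1 - y1 \<noteq> u' - v') :: nat) \<in> {0, 2}"
    by (rule zero_or_two_of_four[OF close(1) close'(1) close'(2) close(2) no4])
  then show ?thesis unfolding L R B T by (simp add: algebra_simps)
qed

text \<open>Here the vertical edges share the P line of index \<open>X\<close>, while three
  consecutive Q lines occur: \<open>Y\<close> and \<open>Y + 1\<close> on the bottom,
  \<open>Y + 1\<close> and \<open>Y + 2\<close> on the top, \<open>Y\<close> on the left and
  \<open>Y + 2\<close> on the right. The edges no longer form a 4-cycle, and carries are compared
  instead.\<close>

lemma square_even_same:
  assumes f: "flr p w (a + 1) = flr p w a"
  shows "(of_bool (hor_good p w a b) + of_bool (hor_good p w a (b + 1))
        + of_bool (ver_good p w a b) + of_bool (ver_good p w (a + 1) b) :: nat) \<in> {0, 2}"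
proof -
  define X Y where "X = b + flr p w a + 1" and "Y = b + 2 * a - flr p w a"
  define x y0 y1 y2 where "x = rnd p w X" and "y0 = rnd p w Y" and "y1 = rnd p w (Y + 1)" and "y2 = rnd p w (Y + 2)"
  define h0 h1 h2 k where "h0 = rnd p w (X - 2 * a)" and "h1 = rnd p w (X - 2 * a - 1)"
    and "h2 = rnd p w (X - 2 * a - 2)" and "k = rnd p w (Y - 2 * a)"
  have L: "ver_good p w a b \<longleftrightarrow> x - h0 \<noteq> y0 - k"
    unfolding ver_good_def pair_sum_alt x_def y0_def h0_def k_def X_def Y_def
    by (simp add: algebra_simps)
  have R: "ver_good p w (a + 1) b \<longleftrightarrow> x - h2 \<noteq> y2 - k"
    unfolding ver_good_def pair_sum_alt x_def y2_def h2_def k_def X_def Y_def f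
    by (simp add: algebra_simps)
  have B: "hor_good p w a b \<longleftrightarrow> y0 + h1 \<noteq> y1 + h2"
    unfolding hor_good_def pair_sum_def y0_def y1_def h1_def h2_def X_def Y_def f
    by (simp add: algebra_simps)
  have T: "hor_good p w a (b + 1) \<longleftrightarrow> y1 + h0 \<noteq> y2 + h1"
    unfolding hor_good_def pair_sum_def y1_def y2_def h0_def h1_def X_def Y_def f
    by (simp add: algebra_simps)
  have "X - 2 * a - 2 + 2 * (a + 1) = X" "Y - 2 * a + 2 * (a + 1) = Y + 2" by simp_all
  then have A: "x = h0 + flr p w a \<or> x = h0 + flr p w a + 1" "y0 = k + flr p w a \<or> y0 = k + flr p w a + 1"
    "x = h2 + flr p w a \<or> x = h2 + flr p w a + 1" "y2 = k + flr p w a \<or> y2 = k + flr p w a + 1"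
    using rnd_add_even[of "X - 2 * a" a] rnd_add_even[of "Y - 2 * a" a]
      rnd_add_even[of "X - 2 * a - 2" "a + 1"] rnd_add_even[of "Y - 2 * a" "a + 1"]
    unfolding x_def h0_def h2_def y0_def y2_def k_def f by auto
  have ry: "y1 = y0 \<and> res (Y + 1) = res Y + 2 * p \<or> y1 = y0 + 1 \<and> res (Y + 1) = res Y + 2 * p - 2 * w"
    using rnd_Suc[of Y] unfolding y1_def y0_def .
  have "Y + 1 + 1 = Y + 2" by simp
  then have ry': "y2 = y1 \<and> res (Y + 2) = res (Y + 1) + 2 * p \<or> y2 = y1 + 1 \<and> res (Y + 2) = res (Y + 1) + 2 * p - 2 * w"
    using rnd_Suc[of "Y + 1"] unfolding y1_def y2_def by metis
  have "X - 2 * a - 2 + 1 = X - 2 * a - 1" by simp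
  then have rh: "h1 = h2 \<and> res (X - 2 * a - 1) = res (X - 2 * a - 2) + 2 * p \<or> h1 = h2 + 1 \<and> res (X - 2 * a - 1) = res (X - 2 * a - 2) + 2 * p - 2 * w"
    using rnd_Suc[of "X - 2 * a - 2"] unfolding h1_def h2_def by metis
  have rh': "h0 = h1 \<and> res (X - 2 * a) = res (X - 2 * a - 1) + 2 * p \<or> h0 = h1 + 1 \<and> res (X - 2 * a) = res (X - 2 * a - 1) + 2 * p - 2 * w"
    using rnd_Suc[of "X - 2 * a - 1"] unfolding h0_def h1_def by simp
  have J: "y1 = y0 \<or> y1 = y0 + 1" "y2 = y1 \<or> y2 = y1 + 1" "h1 = h2 \<or> h1 = h2 + 1" "h0 = h1 \<or> h0 = h1 + 1"
    using ry ry' rh rh' by auto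
  \<comment> \<open>\<open>d\<close> and \<open>c\<close> are the carries of a step of length
    \<open>2 * a\<close> ending at \<open>X\<close> and at \<open>Y\<close>. The step of length
    \<open>2 * (a + 1)\<close> has the same floor, so its carries \<open>d + j + j'\<close> and
    \<open>c + i + i'\<close> are bits as well.\<close>
  define d where "d = x - h0 - flr p w a"
  define c where "c = y0 - k - flr p w a"
  have dc: "d = 0 \<or> d = 1" "c = 0 \<or> c = 1" "d + (h0 - h2) = 0 \<or> d + (h0 - h2) = 1" "c + (y2 - y0) = 0 \<or> c + (y2 - y0) = 1"
    unfolding d_def c_def using A by linarith+
  define i i' j j' where "i = y1 - y0" and "i' = y2 - y1" and "j = h1 - h2" and "j' = h0 - h1"
  have L': "ver_good p w a b \<longleftrightarrow> d \<noteq> c" and R': "ver_good p w (a + 1) b \<longleftrightarrow> d + j + j' \<noteq> c + i + i'"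
    and B': "hor_good p w a b \<longleftrightarrow> i \<noteq> j" and T': "hor_good p w a (b + 1) \<longleftrightarrow> i' \<noteq> j'"
    unfolding L R B T d_def c_def i_def i'_def j_def j'_def by auto
  have bits: "i = 0 \<or> i = 1" "i' = 0 \<or> i' = 1" "j = 0 \<or> j = 1" "j' = 0 \<or> j' = 1"
    unfolding i_def i'_def j_def j'_def using J by linarith+
  have "j + j' = h0 - h2" "i + i' = y2 - y0" by (simp_all add: i_def i'_def j_def j'_def)
  then have ends: "d + j + j' \<le> 1" "c + i + i' \<le> 1"
    using dc(3,4) by linarith+
  have bit: "\<exists>b. z = of_bool b" if "z = 0 \<or> z = 1" for z :: int
    using that by (metis of_bool_eq(1) of_bool_eq(2))
  obtain D where D: "d = of_bool D" using bit[OF dc(1)] by blast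
  obtain C where C: "c = of_bool C" using bit[OF dc(2)] by blast
  obtain I where I: "i = of_bool I" using bit[OF bits(1)] by blast
  obtain I' where I': "i' = of_bool I'" using bit[OF bits(2)] by blast
  obtain J where J: "j = of_bool J" using bit[OF bits(3)] by blast
  obtain J' where J': "j' = of_bool J'" using bit[OF bits(4)] by blast
  show ?thesis
    using zero_or_two_of_bits[OF ends[unfolded D C I I' J J']] unfolding L' R' B' T' D C I I' J J' .
qed

lemma square_even:
  "(of_bool (hor_good p w a b) + of_bool (hor_good p w a (b + 1))
        + of_bool (ver_good p w a b) + of_bool (ver_good p w (a + 1) b) :: nat) \<in> {0, 2}"
  using flr_Suc[of a] square_even_split square_even_same by metis

end

section \<open>Light points\<close>

lemma even_param_plaid:
  assumes "even_param p q"
  shows "plaid p (omega p q)"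
proof
  show "0 < p" "2 * p < omega p q" using assms by (auto simp: even_param_def omega_def)
  have "coprime p q" "even (p * q)" using assms by (auto simp: even_param_def)
  then show "odd (omega p q)" by (auto simp: omega_def)
  show "coprime p (omega p q)" using \<open>coprime p q\<close>
    unfolding omega_def coprime_iff_gcd_eq_1 by simp
qed

text \<open>The numerator over \<open>w\<close> of the representative in \<open>[-1, 1)\<close>,
  which keeps all values of \<open>F\<close> in the integers.\<close>

definition crep :: "int \<Rightarrow> int \<Rightarrow> int" where
  "crep w a = a - 2 * w * ((a + w) div (2 * w))"

lemma rep2_of_int:
  assumes "0 < w"
  shows "rep2 (of_int a / of_int w) = of_int (crep w a) / of_int w"
proof -
  have "(of_int a / of_int w + 1) / 2 = (of_int (a + w) / of_int (2 * w) :: real)"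
    using assms by (simp add: field_simps)
  then have "\<lfloor>(of_int a / of_int w + 1 :: real) / 2\<rfloor> = (a + w) div (2 * w)"
    by (simp only: floor_divide_of_int_eq)
  then show ?thesis using assms by (simp add: rep2_def crep_def field_simps)
qed

definition lit :: "int \<Rightarrow> int \<Rightarrow> int \<Rightarrow> int \<Rightarrow> bool" where
  "lit p w n m \<longleftrightarrow>
     \<bar>crep w (2 * p * m + w)\<bar> < \<bar>crep w (4 * p * n)\<bar> \<and> 0 < crep w (4 * p * n) * crep w (2 * p * m + w)"

lemma crepI:
  assumes "0 < w" "- w \<le> c" "c < w" "a = c + 2 * w * k"
  shows "crep w a = c"
proof -
  have "a + w = 2 * w * k + (c + w)" using assms by simp
  then have "(a + w) div (2 * w) = k" using assms by (intro int_div_pos_eq) auto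
  then show ?thesis using assms by (simp add: crep_def)
qed

context plaid
begin

text \<open>On the circle of length \<open>2 * w\<close> a mass is light for the value
  \<open>A\<close> below \<open>w\<close> iff it lies between 0 and \<open>A\<close>, and for
  \<open>A\<close> above \<open>w\<close> iff it lies between \<open>A\<close> and
  \<open>2 * w\<close>. For fixed \<open>n\<close> lightness is thus \<open>res m < A\<close> or its
  negation, and a comparison of two lines does not see which. \<open>A\<close> is even while
  \<open>res m\<close> and \<open>w\<close> are odd, so no boundary case arises.\<close>

lemma lit_pair_sum:
  "lit p w n m \<noteq> lit p w n m' \<longleftrightarrow> pair_sum p w n m \<noteq> pair_sum p w n m'"
proof -
  define g where "g = (4 * p * n) div (2 * w)"
  define A where "A = (4 * p * n) mod (2 * w)"
  have cA: "4 * p * n = A + 2 * w * g" unfolding A_def g_def by (rule mod_mult_div_eq[symmetric])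
  have bA: "0 \<le> A" "A < 2 * w" using w_pos by (auto simp: A_def)
  have "A = 2 * (2 * p * n - w * g)" using cA by simp
  then have "even A" by simp
  then have Aw: "A \<noteq> w" using w_odd by auto
  have rA: "res m \<noteq> A" for m using res_odd[of m] \<open>even A\<close> by auto
  have S: "pair_sum p w n m = g + of_bool (res m < A)" for m
  proof -
    have eq: "res m + res (2 * n - m) = A + 2 * w * (g + 1 - pair_sum p w n m)"
      using pair_sum_res[of m n] cA by (simp add: algebra_simps)
    have "2 * w * (- 1) < 2 * w * (g + 1 - pair_sum p w n m)" "2 * w * (g + 1 - pair_sum p w n m) < 2 * w * 2"
      using eq bA res_bounds[of m] res_bounds[of "2 * n - m"] by linarith+
    moreover have "0 < 2 * w" using w_pos by simp
    ultimately have "- 1 < g + 1 - pair_sum p w n m" "g + 1 - pair_sum p w n m < 2"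
      by (simp_all only: mult_less_cancel_left_pos)
    then consider "pair_sum p w n m = g + 1" | "pair_sum p w n m = g" by linarith
    then show ?thesis
    proof cases
      case 1
      then have "res m < A" using eq res_bounds[of "2 * n - m"] by simp
      then show ?thesis using 1 by simp
    next
      case 2
      then have "\<not> res m < A" using eq res_bounds[of "2 * n - m"] by simp
      then show ?thesis using 2 by simp
    qed
  qed
  have L: "lit p w n m \<longleftrightarrow> (res m < A) \<noteq> (w < A)" for m
  proof -
    have m: "2 * p * m + w = res m + 2 * w * rnd p w m" by (simp add: res_def)
    have c: "crep w (4 * p * n) = (if w < A then A - 2 * w else A)"
      by (rule crepI[of _ _ _ "if w < A then g + 1 else g"]) (use w_pos cA bA Aw in \<open>simp_all add: algebra_simps\<close>)
    have d: "crep w (2 * p * m + w) = (if w \<le> res m then res m - 2 * w else res m)"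
      by (rule crepI[of _ _ _ "if w \<le> res m then rnd p w m + 1 else rnd p w m"])
        (use w_pos m res_bounds[of m] in \<open>simp_all add: algebra_simps\<close>)
    have sgn: "0 < x * y \<longleftrightarrow> 0 < x \<and> 0 < y \<or> x < 0 \<and> y < 0" for x y :: int
      by (auto simp: zero_less_mult_iff)
    consider "w < A" "w \<le> res m" | "w < A" "res m < w" | "A < w" "w \<le> res m" | "A < w" "res m < w"
      using Aw by linarith
    then show ?thesis
    proof cases
      case 1
      then show ?thesis unfolding lit_def c d sgn using bA rA[of m] res_bounds(2)[of m] by simp linarith
    next
      case 2
      then show ?thesis unfolding lit_def c d sgn using bA rA[of m] res_bounds(1)[of m] by simp
    next
      case 3
      then show ?thesis unfolding lit_def c d sgn using bA rA[of m] res_bounds[of m] by simp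
    next
      case 4
      then show ?thesis unfolding lit_def c d sgn using bA rA[of m] res_bounds[of m] by auto
    qed
  qed
  show ?thesis unfolding L S by auto
qed

lemma crep_zero: "crep w (4 * p * 0) = 0"
  by (rule crepI[of _ _ _ 0]) (use w_pos in auto)

lemma not_lit_zero: "\<not> lit p w 0 m"
  using crep_zero by (simp add: lit_def)

lemma dvd_2p: "w dvd 2 * p * a \<Longrightarrow> w dvd a"
proof -
  assume "w dvd 2 * p * a"
  moreover have "coprime w (2 * p)"
    unfolding coprime_mult_right_iff using cop w_odd by (simp add: coprime_commute)
  ultimately show "w dvd a" using coprime_dvd_mult_right_iff[of w "2 * p" a] by blast
qed

text \<open>\<open>P a\<close> is not an integer for \<open>0 < a < w\<close>: slanted lines cross
  the vertical line \<open>x = a\<close> away from lattice points.\<close>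

lemma rem_pos:
  assumes "0 < a" "a < w"
  shows "0 < rem a"
proof (rule ccontr)
  assume "\<not> 0 < rem a"
  then have "rem a = 0" using rem_bounds(1)[of a] by simp
  then have "2 * p * a = w * flr p w a" by (simp add: rem_def)
  then have "w dvd 2 * p * a" by (rule dvdI)
  then have "w dvd a" by (rule dvd_2p)
  then show False using assms zdvd_not_zless by blast
qed

lemma flr_0: "flr p w 0 = 0" by (simp add: flr_def)

lemma flr_less:
  assumes "0 < a"
  shows "0 \<le> flr p w a" "flr p w a < a"
proof -
  have "0 \<le> 2 * p * a" using assms p_pos by simp
  then show "0 \<le> flr p w a" using w_pos unfolding flr_def by (simp only: pos_imp_zdiv_nonneg_iff)
  have "w * flr p w a \<le> 2 * p * a" using rem_bounds(1)[of a] by (simp add: rem_def)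
  also have "\<dots> < w * a" using p_less assms by (rule mult_strict_right_mono)
  finally show "flr p w a < a" using w_pos by (simp only: mult_less_cancel_left_pos)
qed

end

section \<open>From light points to nearest integers\<close>

locale plaid_param =
  fixes p q w :: int
  assumes even_param: "even_param p q" and w_def: "w = omega p q"
begin

sublocale plaid p w
  using even_param_plaid[OF even_param] by (simp add: w_def)

lemma q_eq: "q = w - p" by (simp add: w_def omega_def)

lemma q_pos: "0 < q" "p < q" using even_param by (auto simp: even_param_def)

lemma F_FP:
  assumes "(x, y) \<in> line p q FP m"
  shows "F p q FP (x, y) = of_int (crep w (2 * p * m + w)) / of_int w"
proof -
  have "slopeP p q * y + (slopeP p q)\<^sup>2 * x + 1 = slopeP p q * of_int m + 1"
  proof -
    have "y = - slopeP p q * x + of_int m" using assms by simp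
    show ?thesis unfolding \<open>y = _\<close> by (simp add: power2_eq_square algebra_simps)
  qed
  also have "\<dots> = of_int (2 * p * m + w) / of_int w"
    using w_pos by (simp add: slopeP_def w_def[symmetric] field_simps)
  finally have "slopeP p q * y + (slopeP p q)\<^sup>2 * x + 1 = of_int (2 * p * m + w) / of_int w" .
  then show ?thesis by (simp only: F.simps rep2_of_int[OF w_pos])
qed

text \<open>The value depends on the index alone and not on the family, which is why one predicate
  \<open>lit\<close> serves P lines and Q lines.\<close>

lemma F_FQ:
  assumes "(x, y) \<in> line p q FQ m"
  shows "F p q FQ (x, y) = of_int (crep w (2 * p * m + w)) / of_int w"
proof -
  have "slopeP p q * y + slopeP p q * slopeQ p q * x + 1 = slopeP p q * of_int m + 1"
  proof -
    have "y = - slopeQ p q * x + of_int m" using assms by simp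
    show ?thesis unfolding \<open>y = _\<close> by (simp add: algebra_simps)
  qed
  also have "\<dots> = of_int (2 * p * m + w) / of_int w"
    using w_pos by (simp add: slopeP_def w_def[symmetric] field_simps)
  finally have "slopeP p q * y + slopeP p q * slopeQ p q * x + 1 = of_int (2 * p * m + w) / of_int w" .
  then show ?thesis by (simp only: F.simps rep2_of_int[OF w_pos])
qed

lemma F_FH: "F p q FH (x, of_int n) = of_int (crep w (4 * p * n)) / of_int w"
  using rep2_of_int[OF w_pos, of "4 * p * n"] by (simp add: slopeP_def w_def[symmetric])

lemma F_FV: "F p q FV (of_int n, y) = of_int (crep w (4 * p * n)) / of_int w"
  using rep2_of_int[OF w_pos, of "4 * p * n"] by (simp add: slopeP_def w_def[symmetric])

lemma light_iff:
  assumes "F p q A (x, y) = of_int (crep w (4 * p * n)) / of_int w"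
  shows "light p q A (x, y) \<longleftrightarrow>
    (\<exists>m. ((x, y) \<in> line p q FP m \<or> (x, y) \<in> line p q FQ m) \<and> lit p w n m)"
proof -
  have *: "\<bar>F p q B (x, y)\<bar> < \<bar>F p q A (x, y)\<bar> \<and> F p q A (x, y) * F p q B (x, y) > 0 \<longleftrightarrow> lit p w n m"
    if "F p q B (x, y) = of_int (crep w (2 * p * m + w)) / of_int w" for B m
  proof -
    have w: "(0::real) < of_int w" using w_pos by simp
    have "(0::real) < of_int c / of_int w * (of_int d / of_int w) \<longleftrightarrow> 0 < c * d" for c d :: int
      using w by (simp add: zero_less_mult_iff zero_less_divide_iff)
    moreover have "\<bar>of_int d / of_int w :: real\<bar> < \<bar>of_int c / of_int w\<bar> \<longleftrightarrow> \<bar>d\<bar> < \<bar>c\<bar>" for c d :: int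
      using w by (simp add: abs_divide divide_less_cancel flip: of_int_abs)
    ultimately show ?thesis unfolding that assms lit_def by blast
  qed
  show ?thesis unfolding light_def using *[OF F_FP] *[OF F_FQ] by blast
qed

lemma FP_iff: "(x, y) \<in> line p q FP m \<longleftrightarrow> 2 * of_int p * x = of_int w * (of_int m - y)"
  using w_pos by (auto simp: slopeP_def w_def[symmetric] field_simps)

lemma FQ_iff: "(x, y) \<in> line p q FQ m \<longleftrightarrow> 2 * of_int q * x = of_int w * (of_int m - y)"
  using w_pos by (auto simp: slopeQ_def w_def[symmetric] field_simps)

lemma seg_Hor: "(x, y) \<in> seg_points (Hor a b) \<longleftrightarrow> of_int a \<le> x \<and> x \<le> of_int a + 1 \<and> y = of_int b"
proof
  assume "(x, y) \<in> seg_points (Hor a b)"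
  then show "of_int a \<le> x \<and> x \<le> of_int a + 1 \<and> y = of_int b"
    by (auto simp: closed_segment_def algebra_simps)
next
  assume "of_int a \<le> x \<and> x \<le> of_int a + 1 \<and> y = of_int b"
  then have "\<exists>u. (x, y) = (1 - u) *\<^sub>R (of_int a, of_int b) + u *\<^sub>R (of_int a + 1, of_int b) \<and> 0 \<le> u \<and> u \<le> 1"
    by (intro exI[of _ "x - of_int a"]) (auto simp: algebra_simps)
  then show "(x, y) \<in> seg_points (Hor a b)" by (auto simp: closed_segment_def)
qed

lemma seg_Ver: "(x, y) \<in> seg_points (Ver a b) \<longleftrightarrow> of_int b \<le> y \<and> y \<le> of_int b + 1 \<and> x = of_int a"
proof
  assume "(x, y) \<in> seg_points (Ver a b)"
  then show "of_int b \<le> y \<and> y \<le> of_int b + 1 \<and> x = of_int a"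
    by (auto simp: closed_segment_def algebra_simps)
next
  assume "of_int b \<le> y \<and> y \<le> of_int b + 1 \<and> x = of_int a"
  then have "\<exists>u. (x, y) = (1 - u) *\<^sub>R (of_int a, of_int b) + u *\<^sub>R (of_int a, of_int b + 1) \<and> 0 \<le> u \<and> u \<le> 1"
    by (intro exI[of _ "y - of_int b"]) (auto simp: algebra_simps)
  then show "(x, y) \<in> seg_points (Ver a b)" by (auto simp: closed_segment_def)
qed

lemma good_two_points:
  assumes "{z \<in> seg_points e. light p q (seg_family e) z} = {z. z = z1 \<and> l1 \<or> z = z2 \<and> l2}"
    and "z1 \<noteq> z2"
    and "seg_family e = FH \<Longrightarrow> z1 \<noteq> seg_center e \<and> z2 \<noteq> seg_center e"
  shows "good p q e \<longleftrightarrow> l1 \<noteq> l2"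
proof -
  define c :: "real \<times> real \<Rightarrow> nat" where "c z = (if seg_family e = FH \<and> z = seg_center e then 2 else 1)" for z
  have c: "c z1 = 1" "c z2 = 1" using assms(3) by (auto simp: c_def)
  have "light_count p q e = sum c {z. z = z1 \<and> l1 \<or> z = z2 \<and> l2}"
    unfolding light_count_def c_def assms(1) ..
  also have "{z. z = z1 \<and> l1 \<or> z = z2 \<and> l2} = (if l1 then {z1} else {}) \<union> (if l2 then {z2} else {})"
    by auto
  also have "sum c \<dots> = of_bool l1 + of_bool l2"
    using c assms(2) by (cases l1; cases l2) auto
  finally show ?thesis by (auto simp: good_def)
qed

text \<open>For \<open>n > 0\<close> neither \<open>P n\<close> nor \<open>Q n\<close> is an
  integer, so exactly one line of each family crosses the segment. The two crossings differ because
  \<open>w\<close> is odd.\<close>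

lemma good_Ver:
  assumes "0 \<le> n" "2 * n < w"
  shows "good p q (Ver n b) \<longleftrightarrow> ver_good p w n b"
proof (cases "n = 0")
  case True
  have "\<not> light p q FV (x, y)" if "(x, y) \<in> seg_points (Ver n b)" for x y
  proof -
    have "x = of_int n" using that unfolding seg_Ver by blast
    then show ?thesis using light_iff[OF F_FV, of n y] not_lit_zero unfolding True by blast
  qed
  then have "{z \<in> seg_points (Ver n b). light p q FV z} = {}" by fast
  then have "light_count p q (Ver n b) = 0"
    unfolding light_count_def seg_family.simps by (simp only: sum.empty)
  moreover have "\<not> ver_good p w n b"
    using True by (simp add: ver_good_def pair_sum_alt)
  ultimately show ?thesis by (simp add: good_def)
next
  case False
  then have n: "0 < n" "n < w" using assms by auto
  define f where "f = flr p w n"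
  have f: "2 * p * n = w * f + rem n" by (simp add: f_def rem_def)
  have r: "0 < rem n" "rem n < w" using rem_pos[OF n] rem_bounds by auto
  define y1 y2 :: real where "y1 = of_int (b + f + 1) - 2 * of_int p * of_int n / of_int w"
    and "y2 = of_int (b + 2 * n - f) - 2 * of_int q * of_int n / of_int w"
  have w: "(0::real) < of_int w" using w_pos by simp
  have y1_eq: "of_int w * y1 = of_int (w * (b + f + 1) - 2 * p * n)"
    using w by (simp add: y1_def field_simps)
  have y2_eq: "of_int w * y2 = of_int (w * (b + 2 * n - f) - 2 * q * n)"
    using w by (simp add: y2_def field_simps)
  have y1_eq': "of_int w * y1 = of_int (w * b + w - rem n)"
    unfolding y1_eq using f by (simp add: algebra_simps)
  have y2_eq': "of_int w * y2 = of_int (w * b + rem n)"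
    unfolding y2_eq q_eq using f by (simp add: algebra_simps flip: of_int_mult)
  have ne: "y1 \<noteq> y2"
  proof
    assume "y1 = y2"
    then have "real_of_int (w * b + w - rem n) = real_of_int (w * b + rem n)"
      using y1_eq' y2_eq' by metis
    then have "w = 2 * rem n" by (simp only: of_int_eq_iff)
    then show False using w_odd by (metis dvd_triv_left)
  qed
  have bnd: "of_int b \<le> y \<and> y \<le> of_int b + 1 \<longleftrightarrow> of_int (w * b) \<le> of_int w * y \<and> of_int w * y \<le> of_int (w * b + w)" for y :: real
    using mult_le_cancel_left_pos[OF w, of "of_int b" y] mult_le_cancel_left_pos[OF w, of y "of_int b + 1"]
    by (simp add: algebra_simps)
  have A: "(\<exists>m. of_int b \<le> y \<and> y \<le> of_int b + 1 \<and> (real_of_int n, y) \<in> line p q FP m \<and> lit p w n m)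
      \<longleftrightarrow> y = y1 \<and> lit p w n (b + f + 1)" for y
  proof
    assume "\<exists>m. of_int b \<le> y \<and> y \<le> of_int b + 1 \<and> (real_of_int n, y) \<in> line p q FP m \<and> lit p w n m"
    then obtain m where m: "of_int (w * b) \<le> of_int w * y" "of_int w * y \<le> of_int (w * b + w)" "lit p w n m"
      "of_int w * y = of_int (w * m - 2 * p * n)"
      unfolding FP_iff using bnd by (auto simp: algebra_simps)
    then have "w * b \<le> w * m - 2 * p * n" "w * m - 2 * p * n \<le> w * b + w" by linarith+
    then have "w * (b + f) < w * m" "w * m < w * (b + f + 2)" using f r by (simp_all add: algebra_simps)
    then have "b + f < m" "m < b + f + 2" using w_pos by (simp_all only: mult_less_cancel_left_pos)
    then have "m = b + f + 1" by simp
    moreover from this have "of_int w * y = of_int w * y1" using m(4) y1_eq by simp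
    then have "y = y1" using w by simp
    ultimately show "y = y1 \<and> lit p w n (b + f + 1)" using m(3) by simp
  next
    assume y: "y = y1 \<and> lit p w n (b + f + 1)"
    have "of_int (w * b) \<le> of_int w * y1" "of_int w * y1 \<le> of_int (w * b + w)"
      using y1_eq' r by simp_all
    moreover have "(real_of_int n, y1) \<in> line p q FP (b + f + 1)"
      unfolding FP_iff using y1_eq by (simp add: algebra_simps)
    ultimately show "\<exists>m. of_int b \<le> y \<and> y \<le> of_int b + 1 \<and> (real_of_int n, y) \<in> line p q FP m \<and> lit p w n m"
      using y bnd by blast
  qed
  have B: "(\<exists>m. of_int b \<le> y \<and> y \<le> of_int b + 1 \<and> (real_of_int n, y) \<in> line p q FQ m \<and> lit p w n m)
      \<longleftrightarrow> y = y2 \<and> lit p w n (b + 2 * n - f)" for y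
  proof
    assume "\<exists>m. of_int b \<le> y \<and> y \<le> of_int b + 1 \<and> (real_of_int n, y) \<in> line p q FQ m \<and> lit p w n m"
    then obtain m where m: "of_int (w * b) \<le> of_int w * y" "of_int w * y \<le> of_int (w * b + w)" "lit p w n m"
      "of_int w * y = of_int (w * m - 2 * q * n)"
      unfolding FQ_iff using bnd by (auto simp: algebra_simps)
    then have "w * b \<le> w * m - 2 * q * n" "w * m - 2 * q * n \<le> w * b + w" by linarith+
    then have "w * (b + 2 * n - f - 1) < w * m" "w * m < w * (b + 2 * n - f + 1)" using f r by (simp_all add: q_eq algebra_simps)
    then have "b + 2 * n - f - 1 < m" "m < b + 2 * n - f + 1" using w_pos by (simp_all only: mult_less_cancel_left_pos)
    then have "m = b + 2 * n - f" by simp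
    moreover from this have "of_int w * y = of_int w * y2" using m(4) y2_eq by simp
    then have "y = y2" using w by simp
    ultimately show "y = y2 \<and> lit p w n (b + 2 * n - f)" using m(3) by simp
  next
    assume y: "y = y2 \<and> lit p w n (b + 2 * n - f)"
    have "of_int (w * b) \<le> of_int w * y2" "of_int w * y2 \<le> of_int (w * b + w)"
      using y2_eq' r by simp_all
    moreover have "(real_of_int n, y2) \<in> line p q FQ (b + 2 * n - f)"
      unfolding FQ_iff using y2_eq by (simp add: algebra_simps)
    ultimately show "\<exists>m. of_int b \<le> y \<and> y \<le> of_int b + 1 \<and> (real_of_int n, y) \<in> line p q FQ m \<and> lit p w n m"
      using y bnd by blast
  qed
  have "(x, y) \<in> seg_points (Ver n b) \<and> light p q FV (x, y) \<longleftrightarrow>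
      x = of_int n \<and> (y = y1 \<and> lit p w n (b + f + 1) \<or> y = y2 \<and> lit p w n (b + 2 * n - f))" for x y
    using light_iff[OF F_FV, of n y] A[of y] B[of y] unfolding seg_Ver by blast
  then have "{z \<in> seg_points (Ver n b). light p q (seg_family (Ver n b)) z} =
      {z. z = (of_int n, y1) \<and> lit p w n (b + f + 1) \<or> z = (of_int n, y2) \<and> lit p w n (b + 2 * n - f)}"
    by auto
  then have "good p q (Ver n b) \<longleftrightarrow> lit p w n (b + f + 1) \<noteq> lit p w n (b + 2 * n - f)"
    by (rule good_two_points) (use ne in auto)
  then show ?thesis unfolding lit_pair_sum ver_good_def f_def .
qed

text \<open>With \<open>P + Q = 2\<close> the segment carries exactly two crossing points, a corner
  on both families counting once. The rest is to identify their indices and to see that neither is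
  the midpoint, which has weight 2.\<close>

lemma good_Hor:
  assumes "0 \<le> a" "2 * (a + 1) < w"
  shows "good p q (Hor a n) \<longleftrightarrow> hor_good p w a n"
proof -
  define f f1 where "f = flr p w a" and "f1 = flr p w (a + 1)"
  have w: "(0::real) < of_int w" using w_pos by simp
  have f: "2 * p * a = w * f + rem a" and f1: "2 * p * (a + 1) = w * f1 + rem (a + 1)"
    by (simp_all add: f_def f1_def rem_def)
  have fq: "2 * q * a = w * (2 * a) - w * f - rem a" and f1q: "2 * q * (a + 1) = w * (2 * a + 2) - w * f1 - rem (a + 1)"
    using f f1 by (simp_all add: q_eq algebra_simps)
  have r1: "0 < rem (a + 1)" "rem (a + 1) < w" using rem_pos[of "a + 1"] rem_bounds assms by auto
  have r: "0 \<le> rem a" "rem a < w" by (rule rem_bounds)+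
  have r0: "a = 0" if "rem a = 0" using rem_pos[of a] that assms by fastforce
  have ff: "f1 = f \<or> f1 = f + 1" using flr_Suc[of a] by (auto simp: f_def f1_def)
  have pq: "(0::real) < 2 * of_int p" "(0::real) < 2 * of_int q" using p_pos q_pos by auto
  \<comment> \<open>This is where the left half matters: a slanted line through the midpoint needs
    \<open>w\<close> to divide \<open>2 * a + 1\<close>, which first happens at
    \<open>2 * a + 1 = w\<close>.\<close>
  have half: False if "2 * of_int s * (real_of_int a + 1/2) = of_int w * of_int j" "s = p \<or> s = q" for s j
  proof -
    have "of_int s * (2 * real_of_int a + 1) = of_int w * of_int j" using that(1) by (simp add: algebra_simps)
    then have "real_of_int (s * (2 * a + 1)) = real_of_int (w * j)" by simp
    then have "s * (2 * a + 1) = w * j" by (simp only: of_int_eq_iff)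
    then have "w dvd s * (2 * a + 1)" by (rule dvdI)
    moreover have "coprime w q"
      using even_param by (simp add: w_def omega_def even_param_def coprime_iff_gcd_eq_1)
    then have "coprime w s" using that(2) cop by (auto simp: coprime_commute)
    ultimately have "w dvd 2 * a + 1" using coprime_dvd_mult_right_iff by blast
    then show False using assms zdvd_not_zless[of "2 * a + 1" w] by auto
  qed
  have bnd: "of_int a \<le> x \<and> x \<le> of_int a + 1 \<longleftrightarrow>
      2 * of_int s * of_int a \<le> 2 * of_int s * x \<and> 2 * of_int s * x \<le> 2 * of_int s * (of_int a + 1)"
    if "s = p \<or> s = q" for s and x :: real
    using that mult_le_cancel_left_pos[of "2 * real_of_int s"] pq by auto
  define X :: "int \<Rightarrow> int \<Rightarrow> real" where "X s j = of_int (w * j) / (2 * of_int s)" for s j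
  have X: "2 * of_int s * x = of_int w * of_int j \<longleftrightarrow> x = X s j" if "s = p \<or> s = q" for s j x
    using that pq by (auto simp: X_def field_simps)
  have inX: "of_int a \<le> X s j \<and> X s j \<le> of_int a + 1 \<longleftrightarrow> 2 * s * a \<le> w * j \<and> w * j \<le> 2 * s * (a + 1)"
    if "s = p \<or> s = q" for s j
  proof -
    have "2 * of_int s * X s j = of_int w * of_int j" using X[OF that] by blast
    then have "of_int a \<le> X s j \<and> X s j \<le> of_int a + 1 \<longleftrightarrow>
        real_of_int (2 * s * a) \<le> real_of_int (w * j) \<and> real_of_int (w * j) \<le> real_of_int (2 * s * (a + 1))"
      unfolding bnd[OF that] by simp
    then show ?thesis by (simp only: of_int_le_iff)
  qed
  \<comment> \<open>The left endpoint can lie on a P line only if \<open>P a\<close> is an integer,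
    that is for \<open>a = 0\<close>; hence the extra disjunct.\<close>
  have inP: "2 * p * a \<le> w * j \<and> w * j \<le> 2 * p * (a + 1) \<longleftrightarrow> f < j \<and> j \<le> f1 \<or> a = 0 \<and> j = 0" for j
  proof
    assume h: "2 * p * a \<le> w * j \<and> w * j \<le> 2 * p * (a + 1)"
    then have "w * f \<le> w * j" "w * j < w * (f1 + 1)"
      using f f1 r r1 unfolding distrib_left mult_1_right by linarith+
    then have j: "f \<le> j" "j < f1 + 1" using w_pos by (simp_all only: mult_le_cancel_left_pos mult_less_cancel_left_pos)
    show "f < j \<and> j \<le> f1 \<or> a = 0 \<and> j = 0"
    proof (cases "f = j")
      case True
      then have "rem a = 0" using h f r by simp
      then have "a = 0" by (rule r0)
      then show ?thesis using True flr_0 by (simp add: f_def)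
    next
      case False
      then show ?thesis using j by simp
    qed
  next
    assume h: "f < j \<and> j \<le> f1 \<or> a = 0 \<and> j = 0"
    show "2 * p * a \<le> w * j \<and> w * j \<le> 2 * p * (a + 1)"
    proof (cases "a = 0 \<and> j = 0")
      case True
      then show ?thesis using p_pos by simp
    next
      case False
      then have "w * (f + 1) \<le> w * j" "w * j \<le> w * f1"
        using h w_pos by (auto simp only: mult_le_cancel_left_pos)
      then show ?thesis using f f1 r r1 unfolding distrib_left[of w] mult_1_right by linarith
    qed
  qed
  have inQ: "2 * q * a \<le> w * j \<and> w * j \<le> 2 * q * (a + 1) \<longleftrightarrow> 2 * a - f \<le> j \<and> j \<le> 2 * a + 1 - f1" for j
  proof
    assume h: "2 * q * a \<le> w * j \<and> w * j \<le> 2 * q * (a + 1)"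
    then have "w * (2 * a - f - 1) < w * j" "w * j < w * (2 * a + 2 - f1)"
      unfolding fq f1q using r r1 unfolding right_diff_distrib distrib_left mult_1_right by linarith+
    then have "2 * a - f - 1 < j" "j < 2 * a + 2 - f1" using w_pos by (simp_all only: mult_less_cancel_left_pos)
    then show "2 * a - f \<le> j \<and> j \<le> 2 * a + 1 - f1" by simp
  next
    assume h: "2 * a - f \<le> j \<and> j \<le> 2 * a + 1 - f1"
    then have "w * (2 * a - f) \<le> w * j" "w * j \<le> w * (2 * a + 1 - f1)"
      using w_pos by (auto simp only: mult_le_cancel_left_pos)
    then show "2 * q * a \<le> w * j \<and> w * j \<le> 2 * q * (a + 1)"
      unfolding fq f1q using r r1 unfolding right_diff_distrib distrib_left[of w] mult_1_right by linarith
  qed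
  have PQ: "(x, real_of_int n) \<in> line p q FP m \<longleftrightarrow> x = X p (m - n)"
    "(x, real_of_int n) \<in> line p q FQ m \<longleftrightarrow> x = X q (m - n)" for x m
    unfolding FP_iff FQ_iff using X[of p x "m - n"] X[of q x "m - n"] by simp_all
  have L: "(x, y) \<in> seg_points (Hor a n) \<and> light p q FH (x, y) \<longleftrightarrow> y = of_int n \<and>
      ((\<exists>j. x = X p j \<and> (f < j \<and> j \<le> f1 \<or> a = 0 \<and> j = 0) \<and> lit p w n (n + j)) \<or>
       (\<exists>j. x = X q j \<and> (2 * a - f \<le> j \<and> j \<le> 2 * a + 1 - f1) \<and> lit p w n (n + j)))" for x y
  proof -
    have "(x, y) \<in> seg_points (Hor a n) \<and> light p q FH (x, y) \<longleftrightarrow> y = of_int n \<and>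
      of_int a \<le> x \<and> x \<le> of_int a + 1 \<and> (\<exists>m. (x = X p (m - n) \<or> x = X q (m - n)) \<and> lit p w n m)"
      unfolding seg_Hor using light_iff[OF F_FH, of x n] unfolding PQ by blast
    also have "(\<exists>m. (x = X p (m - n) \<or> x = X q (m - n)) \<and> lit p w n m) \<longleftrightarrow>
        (\<exists>j. (x = X p j \<or> x = X q j) \<and> lit p w n (n + j))"
      by (metis add.commute diff_add_cancel add_diff_cancel_left')
    finally show ?thesis using inX[of p] inX[of q] inP inQ by metis
  qed
  have centre: "X s j \<noteq> of_int a + 1/2" if "s = p \<or> s = q" for s j
    using half[OF _ that, of j] X[OF that, of "of_int a + 1/2" j] by metis
  show ?thesis
  proof (cases "f1 = f")
    case True
    \<comment> \<open>For \<open>a = 0\<close> the left endpoint lies on the lines of index \<open>n\<close> of both families, and counts once.\<close>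
    have X0: "X p 0 = X q 0" by (simp add: X_def)
    have z: "a = 0 \<Longrightarrow> f = 0" using flr_0 by (simp add: f_def)
    have "(x, y) \<in> seg_points (Hor a n) \<and> light p q FH (x, y) \<longleftrightarrow> y = of_int n \<and>
      (x = X q (2 * a - f) \<and> lit p w n (n + (2 * a - f)) \<or> x = X q (2 * a - f + 1) \<and> lit p w n (n + (2 * a - f + 1)))" for x y
    proof -
      have 0: "f < j \<and> j \<le> f1 \<or> a = 0 \<and> j = 0 \<longleftrightarrow> a = 0 \<and> j = 0" for j
        using True by auto
      have 1: "(\<exists>j. x = X p j \<and> (f < j \<and> j \<le> f1 \<or> a = 0 \<and> j = 0) \<and> lit p w n (n + j)) \<longleftrightarrow>
          a = 0 \<and> x = X q (2 * a - f) \<and> lit p w n (n + (2 * a - f))"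
        unfolding 0 using X0 z by auto
      have 2: "2 * a - f \<le> j \<and> j \<le> 2 * a + 1 - f1 \<longleftrightarrow> j = 2 * a - f \<or> j = 2 * a - f + 1" for j
        using True by auto
      show ?thesis unfolding L 1 2 by fast
    qed
    then have "{z \<in> seg_points (Hor a n). light p q (seg_family (Hor a n)) z} =
      {z. z = (X q (2 * a - f), of_int n) \<and> lit p w n (n + (2 * a - f)) \<or>
          z = (X q (2 * a - f + 1), of_int n) \<and> lit p w n (n + (2 * a - f + 1))}"
      unfolding seg_family.simps by auto
    then have "good p q (Hor a n) \<longleftrightarrow> lit p w n (n + (2 * a - f)) \<noteq> lit p w n (n + (2 * a - f + 1))"
    proof (rule good_two_points)
      have "X q (2 * a - f) < X q (2 * a - f + 1)" using w pq by (simp add: X_def divide_strict_right_mono)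
      then show "(X q (2 * a - f), real_of_int n) \<noteq> (X q (2 * a - f + 1), real_of_int n)" by simp
    qed (use centre in simp)
    moreover have "n + (2 * a - f) = n + 2 * a - f" "n + (2 * a - f + 1) = n + 2 * a - f + 1" by simp_all
    ultimately show ?thesis using True unfolding lit_pair_sum hor_good_def f_def f1_def by simp
  next
    case False
    then have t: "f1 = f + 1" using ff by simp
    then have "a \<noteq> 0" using flr_Suc[of 0] flr_0 p_less rem_bounds[of 1]
      by (auto simp: f_def f1_def rem_def)
    have "(x, y) \<in> seg_points (Hor a n) \<and> light p q FH (x, y) \<longleftrightarrow> y = of_int n \<and>
      (x = X p (f + 1) \<and> lit p w n (n + (f + 1)) \<or> x = X q (2 * a - f) \<and> lit p w n (n + (2 * a - f)))" for x y
    proof -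
      have 1: "f < j \<and> j \<le> f1 \<or> a = 0 \<and> j = 0 \<longleftrightarrow> j = f + 1" for j
        using t \<open>a \<noteq> 0\<close> by auto
      have 2: "2 * a - f \<le> j \<and> j \<le> 2 * a + 1 - f1 \<longleftrightarrow> j = 2 * a - f" for j
        using t by auto
      show ?thesis unfolding L 1 2 by fast
    qed
    then have "{z \<in> seg_points (Hor a n). light p q (seg_family (Hor a n)) z} =
      {z. z = (X p (f + 1), of_int n) \<and> lit p w n (n + (f + 1)) \<or>
          z = (X q (2 * a - f), of_int n) \<and> lit p w n (n + (2 * a - f))}"
      unfolding seg_family.simps by auto
    then have "good p q (Hor a n) \<longleftrightarrow> lit p w n (n + (f + 1)) \<noteq> lit p w n (n + (2 * a - f))"
    proof (rule good_two_points)
      have "X p (f + 1) \<noteq> X q (2 * a - f)"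
      \<comment> \<open>Adding the equations of the two lines and using \<open>p + q = w\<close>
        places a common point at the midpoint, already excluded.\<close>
      proof
        assume e: "X p (f + 1) = X q (2 * a - f)"
        define x where "x = X p (f + 1)"
        have "2 * of_int p * x = of_int w * of_int (f + 1)" "2 * of_int q * x = of_int w * of_int (2 * a - f)"
          using X[of p x "f + 1"] X[of q x "2 * a - f"] e by (auto simp: x_def)
        then have "2 * (of_int p + of_int q) * x = of_int w * (2 * of_int a + 1)"
          by (simp add: algebra_simps)
        moreover have "(of_int p + of_int q :: real) = of_int w" by (simp add: q_eq)
        ultimately have "of_int w * (2 * x) = of_int w * (2 * of_int a + 1)" by (simp add: ac_simps)
        then have "2 * x = 2 * of_int a + 1" using w by (simp only: mult_cancel_left) simp
        then have "x = of_int a + 1/2" by simp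
        then show False using centre[of p "f + 1"] by (simp add: x_def)
      qed
      then show "(X p (f + 1), real_of_int n) \<noteq> (X q (2 * a - f), real_of_int n)" by simp
    qed (use centre in simp)
    moreover have "n + (2 * a - f) = n + 2 * a - f" "n + (f + 1) = n + f + 1" by simp_all
    ultimately show ?thesis using False unfolding lit_pair_sum hor_good_def f_def f1_def by simp
  qed
qed

end

section \<open>Lines of capacity 2\<close>

text \<open>\<open>t\<close> is the tune, given by its congruence. The sign in the congruence stays
  open, and with it which of the two lines of capacity 2 has positive sign.\<close>

locale plaid_tune = plaid_param +
  fixes t :: int
  assumes t_pos: "0 < t" and t_less: "2 * t < w" and t_tune: "w dvd 2 * p * t - 1 \<or> w dvd 2 * p * t + 1"
begin

text \<open>The line \<open>n\<close> has capacity 2, and \<sigma> is the only odd residue strictly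
  between 0 and \<open>2 * \<sigma>\<close>. So the pair sum separates a single class of indices
  modulo \<open>w\<close> from all others, namely the class of \<open>n\<close>.\<close>

lemma unit_line:
  assumes "2 * p * n = w * j + \<sigma>" "\<sigma> = 1 \<or> \<sigma> = - 1"
  shows "pair_sum p w n m = pair_sum p w n m' \<longleftrightarrow> (w dvd m - n \<longleftrightarrow> w dvd m' - n)"
proof -
  have "even (w * j + \<sigma>)" using assms(1) by (metis dvd_triv_left mult.assoc)
  \<comment> \<open>An odd \<open>j\<close> makes \<open>2 * p * n + w\<close> congruent to \<sigma>
    modulo \<open>2 * w\<close>, so the special residue is attained at \<open>m = n\<close>.\<close>
  then have "odd j" using assms(2) w_odd by auto
  then obtain i where i: "j = 2 * i + 1" by (elim oddE)
  have dvd: "w dvd m - n \<longleftrightarrow> 2 * w dvd 2 * p * m + w - \<sigma>" for m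
  proof
    assume "w dvd m - n"
    then obtain l where "m - n = w * l" by (elim dvdE)
    then have "m = n + w * l" by simp
    then have "2 * p * m + w - \<sigma> = 2 * w * (i + p * l + 1)"
      using assms(1) unfolding i by (simp add: algebra_simps)
    then show "2 * w dvd 2 * p * m + w - \<sigma>" by simp
  next
    assume "2 * w dvd 2 * p * m + w - \<sigma>"
    then have "w dvd 2 * p * m + w - \<sigma>" by (metis dvd_mult_right)
    moreover have "2 * p * m + w - \<sigma> = 2 * p * (m - n) + w * (j + 1)"
      using assms(1) by (simp add: algebra_simps)
    ultimately have "w dvd 2 * p * (m - n)" using dvd_add_left_iff[of w "w * (j + 1)"] by simp
    then show "w dvd m - n" by (rule dvd_2p)
  qed
  have special: "w dvd m - n \<longleftrightarrow> 2 * w dvd res m - \<sigma>" for m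
  proof -
    have h: "2 * p * m + w - \<sigma> = (res m - \<sigma>) + 2 * w * rnd p w m" by (simp add: res_def)
    show ?thesis unfolding dvd h by (rule dvd_add_left_iff) simp
  qed
  have eq: "res m + res (2 * n - m) = 2 * \<sigma> + 2 * w * (j + 1 - pair_sum p w n m)" for m
  proof -
    have "4 * p * n = 2 * (w * j + \<sigma>)" using assms(1) by simp
    then show ?thesis using pair_sum_res[of m n] by (simp add: algebra_simps)
  qed
  have val: "pair_sum p w n m = j + \<sigma> * of_bool (w dvd m - n)" for m
    using assms(2)
  proof
    assume \<sigma>: "\<sigma> = 1"
    have "2 * w * (- 1) < 2 * w * (j + 1 - pair_sum p w n m)" "2 * w * (j + 1 - pair_sum p w n m) < 2 * w * 2"
      using eq[of m] \<sigma> res_bounds[of m] res_bounds[of "2 * n - m"] by linarith+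
    moreover have "0 < 2 * w" using w_pos by simp
    ultimately have "- 1 < j + 1 - pair_sum p w n m" "j + 1 - pair_sum p w n m < 2"
      by (simp_all only: mult_less_cancel_left_pos)
    then consider "pair_sum p w n m = j + 1" | "pair_sum p w n m = j" by linarith
    then show ?thesis
    proof cases
      case 1
      then have "res m = 1" using eq[of m] \<sigma> res_bounds[of m] res_bounds[of "2 * n - m"] by simp
      then show ?thesis using 1 \<sigma> special[of m] by simp
    next
      case 2
      then have "res m \<noteq> 1" using eq[of m] \<sigma> res_bounds[of m] res_bounds[of "2 * n - m"] by auto
      then have "\<not> 2 * w dvd res m - 1"
        using res_bounds[of m] zdvd_not_zless[of "res m - 1" "2 * w"] by auto
      then show ?thesis using 2 \<sigma> special[of m] by simp
    qed
  next
    assume \<sigma>: "\<sigma> = - 1"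
    have "2 * w * 0 < 2 * w * (j + 1 - pair_sum p w n m)" "2 * w * (j + 1 - pair_sum p w n m) < 2 * w * 3"
      using eq[of m] \<sigma> res_bounds[of m] res_bounds[of "2 * n - m"] w_pos by linarith+
    moreover have "0 < 2 * w" using w_pos by simp
    ultimately have "0 < j + 1 - pair_sum p w n m" "j + 1 - pair_sum p w n m < 3"
      by (simp_all only: mult_less_cancel_left_pos)
    then consider "pair_sum p w n m = j - 1" | "pair_sum p w n m = j" by linarith
    then show ?thesis
    proof cases
      case 1
      then have "res m = 2 * w - 1" using eq[of m] \<sigma> res_bounds[of m] res_bounds[of "2 * n - m"] by simp
      then show ?thesis using 1 \<sigma> special[of m] by simp
    next
      case 2
      then have "res m \<noteq> 2 * w - 1" using eq[of m] \<sigma> res_bounds[of m] res_bounds[of "2 * n - m"] by auto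
      then have "\<not> 2 * w dvd res m + 1"
        using res_bounds[of m] zdvd_not_zless[of "res m + 1" "2 * w"] by auto
      then show ?thesis using 2 \<sigma> special[of m] by simp
    qed
  qed
  show ?thesis unfolding val using assms(2) by auto
qed

lemma t_line: obtains j \<sigma> where "2 * p * t = w * j + \<sigma>" "\<sigma> = 1 \<or> \<sigma> = - 1"
  using t_tune
proof
  assume "w dvd 2 * p * t - 1"
  then obtain j where "2 * p * t - 1 = w * j" by (elim dvdE)
  then show ?thesis by (intro that[of j 1]) auto
next
  assume "w dvd 2 * p * t + 1"
  then obtain j where "2 * p * t + 1 = w * j" by (elim dvdE)
  then show ?thesis by (intro that[of j "- 1"]) auto
qed

lemma unit_line_t:
  "pair_sum p w t m = pair_sum p w t m' \<longleftrightarrow> (w dvd m - t \<longleftrightarrow> w dvd m' - t)"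
  by (rule t_line) (rule unit_line)

lemma unit_line_wt:
  "pair_sum p w (w - t) m = pair_sum p w (w - t) m' \<longleftrightarrow> (w dvd m - (w - t) \<longleftrightarrow> w dvd m' - (w - t))"
proof -
  obtain j \<sigma> where j: "2 * p * t = w * j + \<sigma>" "\<sigma> = 1 \<or> \<sigma> = - 1" by (rule t_line)
  have "2 * p * (w - t) = w * (2 * p - j) + (- \<sigma>)" using j(1) by (simp add: algebra_simps)
  then show ?thesis by (rule unit_line) (use j(2) in auto)
qed

lemma flr_bounds: "0 \<le> flr p w a" "a = 0 \<Longrightarrow> flr p w a = 0" "0 < a \<Longrightarrow> flr p w a < a" if "0 \<le> a"
  using flr_less[of a] flr_0 that by (cases "a = 0"; auto)+

lemma dvd_small: "\<lbrakk>w dvd x; - w < x; x < w\<rbrakk> \<Longrightarrow> x = 0"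
  by (metis abs_less_iff dvd_imp_le_int linorder_not_less minus_less_iff w_pos zabs_def abs_of_pos)

text \<open>The special lines on \<open>y = n\<close> pass through \<open>(0, n)\<close>; all other
  lines met before \<open>x = t\<close> have an index offset strictly between 0 and
  \<open>w\<close>.\<close>

lemma hor_good_unit:
  assumes "n = t \<or> n = w - t" "0 \<le> a" "a < t"
  shows "hor_good p w a n \<longleftrightarrow> a = 0"
proof -
  have u: "pair_sum p w n m = pair_sum p w n m' \<longleftrightarrow> (w dvd m - n \<longleftrightarrow> w dvd m' - n)" for m m'
    using assms(1) unit_line_t unit_line_wt by blast
  have off: "w dvd (n + x) - n \<longleftrightarrow> x = 0" if "0 \<le> x" "x < w" for x
    using dvd_small[of x] that by auto
  note fb = flr_bounds[OF assms(2)]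
  have f1: "flr p w (a + 1) = flr p w a \<or> flr p w (a + 1) = flr p w a + 1" using flr_Suc[of a] by blast
  have x1: "w dvd (n + (2 * a - flr p w a)) - n \<longleftrightarrow> a = 0"
  proof -
    have "2 * a - flr p w a = 0 \<longleftrightarrow> a = 0" using fb assms(2) by fastforce
    moreover have "0 \<le> 2 * a - flr p w a" "2 * a - flr p w a < w" using fb assms t_less by fastforce+
    ultimately show ?thesis using off by blast
  qed
  have x2: "\<not> w dvd (n + (2 * a - flr p w a) + 1) - n"
  proof -
    have "0 < 2 * a - flr p w a + 1" "2 * a - flr p w a + 1 < w" using fb assms t_less by fastforce+
    moreover have "(n + (2 * a - flr p w a) + 1) - n = (n + (2 * a - flr p w a + 1)) - n" by simp
    ultimately show ?thesis using off by fastforce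
  qed
  have x3: "\<not> w dvd (n + flr p w a + 1) - n"
  proof -
    have "0 < flr p w a + 1" "flr p w a + 1 < w" using fb assms t_less by fastforce+
    moreover have "(n + flr p w a + 1) - n = (n + (flr p w a + 1)) - n" by simp
    ultimately show ?thesis using off by fastforce
  qed
  have e: "n + 2 * a - flr p w a = n + (2 * a - flr p w a)" by simp
  have a0: "flr p w (a + 1) = flr p w a" if "a = 0"
    using that flr_0 p_pos p_less by (auto intro: flrI)
  show ?thesis
  proof (cases "flr p w (a + 1) = flr p w a")
    case True
    show ?thesis unfolding hor_good_def if_P[OF True] e u x1 using x2 by blast
  next
    case False
    show ?thesis unfolding hor_good_def if_not_P[OF False] e u x1 using x3 a0 by blast
  qed
qed

text \<open>The bottom and top of the block have capacity 0: the pair sum is constant in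
  \<open>m\<close>.\<close>

lemma hor_good_boundary: "\<not> hor_good p w a 0" "\<not> hor_good p w a w"
proof -
  have "pair_sum p w 0 m = 0" for m by (simp add: pair_sum_alt)
  then show "\<not> hor_good p w a 0" by (simp add: hor_good_def)
  have "pair_sum p w w m = 2 * p" for m
    using rnd_period[of "m - 2 * w" 2] by (simp add: pair_sum_alt algebra_simps)
  then show "\<not> hor_good p w a w" by (simp add: hor_good_def)
qed

lemma ver_good_0: "\<not> ver_good p w 0 b"
  by (simp add: ver_good_def pair_sum_alt)

text \<open>The edges of \<open>x = t\<close> crossed by the P line of index \<open>t\<close> and by
  the Q line of index \<open>t + w\<close>, the only special crossings inside the block.\<close>

definition exit_low :: int where "exit_low = t - 1 - flr p w t"
definition exit_high :: int where "exit_high = w - t + flr p w t"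

lemma exit_bounds: "0 \<le> exit_low" "exit_low < t" "w - t \<le> exit_high" "exit_high < w"
  using flr_less[OF t_pos] by (auto simp: exit_low_def exit_high_def)

lemma ver_good_t:
  assumes "0 \<le> b" "b < w" "ver_good p w t b"
  shows "b = exit_low \<or> b = exit_high"
proof -
  note fl = flr_less[OF t_pos]
  have "w dvd (b + flr p w t + 1) - t \<or> w dvd (b + 2 * t - flr p w t) - t"
    using assms(3) unfolding ver_good_def unit_line_t by blast
  then show ?thesis
  proof
    assume "w dvd (b + flr p w t + 1) - t"
    moreover have "- w < (b + flr p w t + 1) - t" "(b + flr p w t + 1) - t < w" using fl assms t_less t_pos by linarith+
    ultimately show ?thesis using dvd_small unfolding exit_low_def by fastforce
  next
    assume d: "w dvd (b + 2 * t - flr p w t) - t"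
    have "w dvd b + 2 * t - flr p w t - t - w" using d by simp
    moreover have "- w < (b + 2 * t - flr p w t) - t - w" "(b + 2 * t - flr p w t) - t - w < w" using fl assms t_less t_pos by linarith+
    ultimately show ?thesis using dvd_small unfolding exit_high_def by fastforce
  qed
qed

end

section \<open>Components of the plaid set\<close>

lemma seg_center_inj: "seg_center e = seg_center e' \<Longrightarrow> e = e'"
proof -
  have h: "real_of_int x + 1/2 \<noteq> of_int y" for x y
  proof
    assume "real_of_int x + 1/2 = of_int y"
    then have "real_of_int (2 * x + 1) = of_int (2 * y)" by simp
    then have "2 * x + 1 = 2 * y" by (simp only: of_int_eq_iff)
    then show False by (metis dvd_triv_left even_plus_one_iff)
  qed
  show "seg_center e = seg_center e' \<Longrightarrow> e = e'"
    using h h[symmetric] by (cases e; cases e') auto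
qed

abbreviation square_center :: "int \<times> int \<Rightarrow> real \<times> real" where
  "square_center s \<equiv> (of_int (fst s) + 1/2, of_int (snd s) + 1/2)"

definition good_sides :: "int \<Rightarrow> int \<Rightarrow> int \<times> int \<Rightarrow> unit_segment set" where
  "good_sides p q s = good_edges p q (fst s) (snd s)"

definition arcs :: "int \<Rightarrow> int \<Rightarrow> int \<times> int \<Rightarrow> (real \<times> real) set" where
  "arcs p q s = square_arcs p q (fst s) (snd s)"

lemma good_sides_iff: "e \<in> good_sides p q s \<longleftrightarrow> good p q e \<and> e \<in> square_edges (fst s) (snd s)"
  by (auto simp: good_sides_def good_edges_def)

lemma finite_good_sides: "finite (good_sides p q s)"
  by (simp add: good_sides_def good_edges_def square_edges_def)

lemma arcs_eq:
  "arcs p q s = (if card (good_sides p q s) = 2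
     then \<Union>e \<in> good_sides p q s. closed_segment (square_center s) (seg_center e) else {})"
  by (simp add: arcs_def square_arcs_def good_sides_def)

lemma plaid_set_eq: "plaid_set p q = (\<Union>s. arcs p q s)"
proof (intro equalityI subsetI)
  fix z assume "z \<in> plaid_set p q"
  then obtain a b where "z \<in> square_arcs p q a b" unfolding plaid_set_def by blast
  then have "z \<in> arcs p q (a, b)" by (simp add: arcs_def)
  then show "z \<in> (\<Union>s. arcs p q s)" by blast
qed (auto simp: plaid_set_def arcs_def)

lemma compact_arcs: "compact (arcs p q s)"
proof (cases "card (good_sides p q s) = 2")
  case True
  show ?thesis unfolding arcs_eq if_P[OF True] by (rule compact_UN[OF finite_good_sides]) (rule compact_segment)
qed (simp add: arcs_eq)

text \<open>An arc is made of segments from the centre of the square to midpoints of edges, so it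
  touches the border of its square only at the end parameter 1. Different squares therefore share
  arc points only at midpoints of common good edges.\<close>

lemma arcs_cases:
  assumes "z \<in> arcs p q s"
  obtains (edge) e where "e \<in> good_sides p q s" "z = seg_center e"
  | (interior) "of_int (fst s) < fst z" "fst z < of_int (fst s) + 1" "of_int (snd s) < snd z" "snd z < of_int (snd s) + 1"
proof -
  from assms obtain e where e: "e \<in> good_sides p q s" "z \<in> closed_segment (square_center s) (seg_center e)"
    by (auto simp: arcs_eq split: if_splits)
  then obtain u where u: "0 \<le> u" "u \<le> 1" "z = (1 - u) *\<^sub>R square_center s + u *\<^sub>R seg_center e"
    by (auto simp: closed_segment_def)
  show ?thesis
  proof (cases "u = 1")
    case True
    then have "z = seg_center e" using u(3) by (simp add: prod_eq_iff)
    then show ?thesis using e(1) by (intro edge)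
  next
    case False
    then have "u < 1" using u by simp
    have mid: "(1 - u) * (x + 1/2) + u * (x + 1/2) = x + 1/2" "(1 - u) * (x + 1/2) + u * x = x + 1/2 - u/2"
      "(1 - u) * (x + 1/2) + u * (x + 1) = x + 1/2 + u/2" for x by (simp_all add: field_simps)
    have z: "fst z = (1 - u) * (of_int (fst s) + 1/2) + u * fst (seg_center e)"
      "snd z = (1 - u) * (of_int (snd s) + 1/2) + u * snd (seg_center e)" using u(3) by simp_all
    have "e \<in> square_edges (fst s) (snd s)" using e(1) by (simp add: good_sides_iff)
    then consider "e = Hor (fst s) (snd s)" | "e = Hor (fst s) (snd s + 1)"
      | "e = Ver (fst s) (snd s)" | "e = Ver (fst s + 1) (snd s)" by (auto simp: square_edges_def)
    then have "fst z = of_int (fst s) + 1/2 \<and> snd z = of_int (snd s) + 1/2 - u/2 \<or>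
       fst z = of_int (fst s) + 1/2 \<and> snd z = of_int (snd s) + 1/2 + u/2 \<or>
       fst z = of_int (fst s) + 1/2 - u/2 \<and> snd z = of_int (snd s) + 1/2 \<or>
       fst z = of_int (fst s) + 1/2 + u/2 \<and> snd z = of_int (snd s) + 1/2"
      unfolding z by cases (simp_all add: mid)
    then have "of_int (fst s) < fst z \<and> fst z < of_int (fst s) + 1 \<and> of_int (snd s) < snd z \<and> snd z < of_int (snd s) + 1"
      using u(1) \<open>u < 1\<close> by linarith
    then show ?thesis by (intro interior) simp_all
  qed
qed

lemma square_edges_center:
  assumes "e \<in> square_edges a b"
  shows "of_int a \<le> fst (seg_center e)" "fst (seg_center e) \<le> of_int a + 1"
    "of_int b \<le> snd (seg_center e)" "snd (seg_center e) \<le> of_int b + 1"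
  using assms by (auto simp: square_edges_def)

lemma arcs_bounds:
  assumes "z \<in> arcs p q s"
  shows "of_int (fst s) \<le> fst z" "fst z \<le> of_int (fst s) + 1" "of_int (snd s) \<le> snd z" "snd z \<le> of_int (snd s) + 1"
proof -
  have "of_int (fst s) \<le> fst z \<and> fst z \<le> of_int (fst s) + 1 \<and> of_int (snd s) \<le> snd z \<and> snd z \<le> of_int (snd s) + 1"
    using assms
  proof (cases rule: arcs_cases)
    case (edge e)
    then show ?thesis using square_edges_center[of e "fst s" "snd s"] by (simp add: good_sides_iff)
  qed auto
  then show "of_int (fst s) \<le> fst z" "fst z \<le> of_int (fst s) + 1" "of_int (snd s) \<le> snd z" "snd z \<le> of_int (snd s) + 1"
    by auto
qed

lemma int_between: "\<lbrakk>real_of_int a < x; x < of_int a + 1; of_int b \<le> x; x \<le> of_int b + 1\<rbrakk> \<Longrightarrow> a = b"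
  by linarith

lemma seg_center_not_interior:
  assumes "of_int a < fst (seg_center e)" "fst (seg_center e) < of_int a + 1"
    "of_int b < snd (seg_center e)" "snd (seg_center e) < of_int b + 1"
  shows False
  using assms by (cases e) auto

lemma arcs_meet:
  assumes "z \<in> arcs p q s" "z \<in> arcs p q s'" "s \<noteq> s'"
  obtains e where "e \<in> good_sides p q s" "e \<in> good_sides p q s'" "z = seg_center e"
  using assms(1)
proof (cases rule: arcs_cases)
  case interior
  have "fst s = fst s'" "snd s = snd s'"
    using int_between[OF interior(1,2) arcs_bounds(1,2)[OF assms(2)]]
      int_between[OF interior(3,4) arcs_bounds(3,4)[OF assms(2)]] by auto
  then show ?thesis using assms(3) by (simp add: prod_eq_iff)
next
  case (edge e)
  from assms(2) show ?thesis
  proof (cases rule: arcs_cases)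
    case interior
    then show ?thesis using seg_center_not_interior[of "fst s'" e "snd s'"] edge(2) by simp
  next
    case (edge e')
    then have "e = e'" using \<open>z = seg_center e\<close> seg_center_inj by metis
    then show ?thesis using that edge \<open>e \<in> good_sides p q s\<close> by blast
  qed
qed

text \<open>Only finitely many squares meet a bounded set, so the arcs outside \<open>K\<close> lie in a closed set
  missing the arcs in \<open>K\<close>.\<close>

lemma isolated_squares:
  assumes K: "finite K"
    and iso: "\<And>s s'. \<lbrakk>s \<in> K; s' \<notin> K\<rbrakk> \<Longrightarrow> good_sides p q s \<inter> good_sides p q s' = {}"
    and C: "connected C" "C \<subseteq> plaid_set p q" "z \<in> C" "z \<in> \<Union> (arcs p q ` K)"
  shows "C \<subseteq> \<Union> (arcs p q ` K)"
proof -
  define A where "A = \<Union> (arcs p q ` K)"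
  have cA: "compact A" unfolding A_def using K compact_arcs by blast
  then obtain r where r: "A \<subseteq> ball 0 r" using bounded_subset_ballD compact_imp_bounded by blast
  define M :: int where "M = \<lceil>\<bar>r\<bar>\<rceil> + 1"
  define N where "N = {- M..M} \<times> {- M..M}"
  define B where "B = \<Union> (arcs p q ` (N - K)) \<union> - ball 0 r"
  have "compact (\<Union> (arcs p q ` (N - K)))" using compact_arcs by (intro compact_UN) (auto simp: N_def)
  then have cB: "closed B" unfolding B_def
    by (intro closed_Un closed_Compl open_ball compact_imp_closed)
  have far: "arcs p q s \<subseteq> - ball 0 r" if "s \<notin> N" for s
  proof
    fix x assume x: "x \<in> arcs p q s"
    have "fst s < - M \<or> M < fst s \<or> snd s < - M \<or> M < snd s"
      using that by (cases s) (auto simp: N_def)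
    moreover have "of_int M \<ge> \<bar>r\<bar> + 1" unfolding M_def by linarith
    ultimately have "\<bar>r\<bar> \<le> \<bar>fst x\<bar> \<or> \<bar>r\<bar> \<le> \<bar>snd x\<bar>"
      using arcs_bounds[OF x] by linarith
    moreover have "\<bar>fst x\<bar> \<le> norm x" "\<bar>snd x\<bar> \<le> norm x"
      using norm_fst_le[of "fst x" "snd x"] norm_snd_le[of "snd x" "fst x"] by simp_all
    ultimately show "x \<in> - ball 0 r" by auto
  qed
  have sub: "C \<subseteq> A \<union> B"
  proof
    fix x assume "x \<in> C"
    then obtain s where s: "x \<in> arcs p q s" using C(2) plaid_set_eq by blast
    consider "s \<in> K" | "s \<in> N - K" | "s \<notin> N" by blast
    then show "x \<in> A \<union> B"
    proof cases
      case 1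
      then show ?thesis using s unfolding A_def by blast
    next
      case 2
      then show ?thesis using s unfolding B_def by blast
    next
      case 3
      then show ?thesis using s far[of s] unfolding B_def by blast
    qed
  qed
  have "x \<notin> B" if xA: "x \<in> A" for x
  proof
    assume "x \<in> B"
    moreover have "x \<in> ball 0 r" using xA r by blast
    ultimately obtain s' where s': "s' \<notin> K" "x \<in> arcs p q s'" unfolding B_def by blast
    obtain s where s: "s \<in> K" "x \<in> arcs p q s" using xA unfolding A_def by blast
    have "s \<noteq> s'" using s s' by auto
    then obtain e where "e \<in> good_sides p q s" "e \<in> good_sides p q s'" using arcs_meet[OF s(2) s'(2)] by blast
    then show False using iso[OF s(1) s'(1)] by blast
  qed
  then have "A \<inter> B \<inter> C = {}" by blast
  then have "A \<inter> C = {} \<or> B \<inter> C = {}"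
    using connected_closedD[OF C(1) _ sub compact_imp_closed[OF cA] cB] by blast
  moreover have "A \<inter> C \<noteq> {}" using C(3,4) unfolding A_def by blast
  ultimately show ?thesis using sub unfolding A_def by blast
qed

section \<open>Good boundary edges of a set of squares\<close>

definition incident :: "(int \<times> int) set \<Rightarrow> unit_segment \<Rightarrow> (int \<times> int) set" where
  "incident K e = {s \<in> K. e \<in> square_edges (fst s) (snd s)}"

definition boundary :: "int \<Rightarrow> int \<Rightarrow> (int \<times> int) set \<Rightarrow> unit_segment set" where
  "boundary p q K = {e. good p q e \<and> card (incident K e) = 1}"

fun sides :: "unit_segment \<Rightarrow> (int \<times> int) set" where
  "sides (Hor a b) = {(a, b), (a, b - 1)}"
| "sides (Ver a b) = {(a, b), (a - 1, b)}"

lemma mem_sides: "e \<in> square_edges (fst s) (snd s) \<longleftrightarrow> s \<in> sides e"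
  by (cases e; cases s) (auto simp: square_edges_def)

lemma incident_eq: "incident K e = K \<inter> sides e"
  by (auto simp: incident_def mem_sides)

lemma sides_two: "finite (sides e)" "card (sides e) = 2"
  by (cases e; simp)+

lemma card_incident_le: "card (incident K e) \<le> 2"
  unfolding incident_eq using sides_two[of e] by (metis Int_lower2 card_mono)

text \<open>Double counting of incidences between squares and good edges: each square contributes 0
  or 2, and the edges with an odd number of incident squares in \<open>K\<close> are exactly the
  boundary edges.\<close>

lemma handshake:
  assumes K: "finite K" and two: "\<And>s. s \<in> K \<Longrightarrow> card (good_sides p q s) \<in> {0, 2}"
  shows "finite (boundary p q K) \<and> even (card (boundary p q K))"
proof -
  define E where "E = (\<Union>s\<in>K. good_sides p q s)"
  have fE: "finite E" unfolding E_def using K finite_good_sides by blast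
  have "boundary p q K = {e \<in> E. odd (card (incident K e))}"
  proof -
    have odd: "card (incident K e) = 1 \<longleftrightarrow> odd (card (incident K e))" for e
    proof -
      have "card (incident K e) = 0 \<or> card (incident K e) = 1 \<or> card (incident K e) = 2"
        using card_incident_le[of K e] by linarith
      then show ?thesis by (elim disjE) simp_all
    qed
    have E: "e \<in> E" if "good p q e" "card (incident K e) = 1" for e
    proof -
      have "incident K e \<noteq> {}" using that(2) by auto
      then obtain s where "s \<in> K" "e \<in> square_edges (fst s) (snd s)" unfolding incident_def by blast
      then show ?thesis using that(1) unfolding E_def by (intro UN_I[of s]) (simp_all add: good_sides_iff)
    qed
    have g: "good p q e" if "e \<in> E" for e using that by (auto simp: E_def good_sides_iff)
    show ?thesis
    proof (intro set_eqI iffI)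
      fix e assume "e \<in> boundary p q K"
      then have "good p q e" "card (incident K e) = 1" by (simp_all add: boundary_def)
      then show "e \<in> {e \<in> E. odd (card (incident K e))}" using E odd by simp
    next
      fix e assume "e \<in> {e \<in> E. odd (card (incident K e))}"
      then have "e \<in> E" "card (incident K e) = 1" using odd[of e] by simp_all
      then show "e \<in> boundary p q K" using g by (simp add: boundary_def)
    qed
  qed
  moreover have "even (card {e \<in> E. odd (card (incident K e))}) \<longleftrightarrow> even (\<Sum>e\<in>E. card (incident K e))"
    by (rule even_sum_iff[OF fE, symmetric])
  moreover have "(\<Sum>e\<in>E. card (incident K e)) = (\<Sum>s\<in>K. card (good_sides p q s))"
  proof -
    have "(\<Sum>e\<in>E. card (incident K e)) = (\<Sum>e\<in>E. \<Sum>s\<in>K. of_bool (e \<in> square_edges (fst s) (snd s)))"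
      using K by (simp add: incident_def of_bool_def sum.If_cases Int_def)
    also have "\<dots> = (\<Sum>s\<in>K. \<Sum>e\<in>E. of_bool (e \<in> square_edges (fst s) (snd s)))"
      by (rule sum.swap)
    also have "\<dots> = (\<Sum>s\<in>K. card (good_sides p q s))"
    proof (rule sum.cong)
      fix s assume "s \<in> K"
      then have "good_sides p q s = {e \<in> E. e \<in> square_edges (fst s) (snd s)}"
        by (auto simp: E_def good_sides_iff)
      then show "(\<Sum>e\<in>E. of_bool (e \<in> square_edges (fst s) (snd s))) = card (good_sides p q s)"
        using fE by (simp add: of_bool_def sum.If_cases Int_def)
    qed simp
    finally show ?thesis .
  qed
  moreover have "even (\<Sum>s\<in>K. card (good_sides p q s))"
    using two by (intro dvd_sum) fastforce
  ultimately show ?thesis using fE by simp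
qed

section \<open>Components of squares joined across good edges\<close>

definition adj :: "int \<Rightarrow> int \<Rightarrow> (int \<times> int) set \<Rightarrow> ((int \<times> int) \<times> (int \<times> int)) set" where
  "adj p q R = {(s, s'). s \<in> R \<and> s' \<in> R \<and> good_sides p q s \<inter> good_sides p q s' \<noteq> {}}"

definition square_comp :: "int \<Rightarrow> int \<Rightarrow> (int \<times> int) set \<Rightarrow> int \<times> int \<Rightarrow> (int \<times> int) set" where
  "square_comp p q R s = (adj p q R)\<^sup>* `` {s}"

lemma comp_self: "s \<in> square_comp p q R s" by (simp add: square_comp_def)

lemma comp_subset: "s \<in> R \<Longrightarrow> square_comp p q R s \<subseteq> R"
  unfolding square_comp_def by (auto elim!: rtranclE simp: adj_def)

lemma comp_step: "\<lbrakk>s' \<in> square_comp p q R s; (s', s'') \<in> adj p q R\<rbrakk> \<Longrightarrow> s'' \<in> square_comp p q R s"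
  unfolding square_comp_def by (auto intro: rtrancl_into_rtrancl)

lemma comp_sym:
  assumes "s' \<in> square_comp p q R s"
  shows "square_comp p q R s' = square_comp p q R s"
proof -
  have "sym (adj p q R)" by (auto simp: adj_def sym_def)
  then have "sym ((adj p q R)\<^sup>*)" by (rule sym_rtrancl)
  then show ?thesis using assms unfolding square_comp_def
    by (auto dest: symD intro: rtrancl_trans)
qed

text \<open>A good edge with two squares in \<open>R\<close> makes them adjacent, so it is never on
  the boundary of a component.\<close>

lemma boundary_comp:
  assumes "s \<in> R"
  shows "boundary p q (square_comp p q R s) \<subseteq> boundary p q R"
proof
  fix e assume "e \<in> boundary p q (square_comp p q R s)"
  then have e: "good p q e" "card (incident (square_comp p q R s) e) = 1" by (auto simp: boundary_def)
  then obtain x where x: "incident (square_comp p q R s) e = {x}" by (metis card_1_singletonE)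
  have xc: "x \<in> square_comp p q R s" "e \<in> good_sides p q x" using x e(1) by (auto simp: incident_def good_sides_iff)
  have "y \<in> square_comp p q R s" if y: "y \<in> incident R e" for y
  proof -
    have "y \<in> R" "e \<in> good_sides p q y" using y e(1) by (simp_all add: incident_def good_sides_iff)
    then have "(x, y) \<in> adj p q R" using xc comp_subset[OF assms, of p q] unfolding adj_def by blast
    then show ?thesis using comp_step xc(1) by blast
  qed
  then have "incident R e = incident (square_comp p q R s) e"
    using comp_subset[OF assms, of p q] unfolding incident_eq by blast
  then show "e \<in> boundary p q R" using e by (simp add: boundary_def)
qed

lemma comp_boundary_mem:
  assumes "s' \<in> square_comp p q R s" "s \<in> R" "e \<in> good_sides p q s'" "e \<in> boundary p q R"
  shows "e \<in> boundary p q (square_comp p q R s)"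
proof -
  have s': "s' \<in> incident R e" using assms comp_subset[OF assms(2)] by (auto simp: incident_def good_sides_iff)
  moreover have "card (incident R e) = 1" using assms(4) by (simp add: boundary_def)
  ultimately have "incident R e = {s'}" by (metis card_1_singletonE singletonD)
  then have "incident (square_comp p q R s) e = {s'}"
    using assms(1) comp_subset[OF assms(2), of p q] unfolding incident_eq by blast
  then show ?thesis using assms(4) by (simp add: boundary_def)
qed

text \<open>Different components cannot share a boundary edge; two components owning the same exit
  are thereby equal.\<close>

lemma boundary_comp_unique:
  assumes "e \<in> boundary p q (square_comp p q R s)" "e \<in> good_sides p q s'" "s' \<in> R" "s \<in> R"
  shows "s' \<in> square_comp p q R s"
proof -
  have "e \<in> boundary p q R" using boundary_comp assms by blast
  then obtain x where x: "incident R e = {x}" by (auto simp: boundary_def card_1_singleton_iff)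
  have s': "s' \<in> incident R e" using assms by (auto simp: incident_def good_sides_iff)
  obtain y where "y \<in> incident (square_comp p q R s) e"
    using assms(1) by (auto simp: boundary_def card_1_singleton_iff)
  then have y: "y \<in> square_comp p q R s" "y \<in> incident R e"
    using comp_subset[OF assms(4), of p q] unfolding incident_eq by blast+
  have "s' = y" using s' y(2) unfolding x by blast
  then show ?thesis using y(1) by blast
qed

lemma square_center_arcs:
  assumes "card (good_sides p q s) = 2"
  shows "square_center s \<in> arcs p q s"
proof -
  have "good_sides p q s \<noteq> {}" using assms by auto
  then obtain e where "e \<in> good_sides p q s" by blast
  moreover have "square_center s \<in> closed_segment (square_center s) (seg_center e)"
    by (rule ends_in_segment)
  ultimately show ?thesis unfolding arcs_eq if_P[OF assms] by blast
qed

lemma seg_center_arcs: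
  assumes "card (good_sides p q s) = 2" "e \<in> good_sides p q s"
  shows "seg_center e \<in> arcs p q s"
proof -
  have "seg_center e \<in> closed_segment (square_center s) (seg_center e)"
    by (rule ends_in_segment)
  then show ?thesis using assms(2) unfolding arcs_eq if_P[OF assms(1)] by blast
qed

lemma arcs_nonempty: "z \<in> arcs p q s \<Longrightarrow> card (good_sides p q s) = 2"
  unfolding arcs_eq by (cases "card (good_sides p q s) = 2") auto

lemma connected_to_center:
  assumes "z \<in> arcs p q s" "s \<in> R"
  shows "connected_component (\<Union> (arcs p q ` R)) z (square_center s)"
proof -
  from assms(1) obtain e where e: "e \<in> good_sides p q s" "z \<in> closed_segment (square_center s) (seg_center e)"
    and c: "card (good_sides p q s) = 2"
    by (auto simp: arcs_eq split: if_splits)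
  have "closed_segment (square_center s) (seg_center e) \<subseteq> arcs p q s"
    unfolding arcs_eq if_P[OF c] using e(1) by blast
  then have "closed_segment (square_center s) (seg_center e) \<subseteq> \<Union> (arcs p q ` R)"
    using assms(2) by blast
  moreover have "connected (closed_segment (square_center s) (seg_center e))"
    by (rule convex_connected) (rule convex_closed_segment)
  moreover have "square_center s \<in> closed_segment (square_center s) (seg_center e)"
    by (rule ends_in_segment)
  ultimately show ?thesis unfolding connected_component_def using e(2) by blast
qed

lemma connected_comp:
  assumes two: "\<And>s. s \<in> R \<Longrightarrow> card (good_sides p q s) \<in> {0, 2}"
    and "(s, s') \<in> (adj p q R)\<^sup>*" "s \<in> R" "good_sides p q s \<noteq> {}"
  shows "connected_component (\<Union> (arcs p q ` R)) (square_center s) (square_center s')"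
  using assms(2)
proof (induction rule: rtrancl_induct)
  case base
  have "card (good_sides p q s) = 2" using two[OF assms(3)] assms(4) finite_good_sides[of p q s] by simp
  then have "square_center s \<in> \<Union> (arcs p q ` R)" using square_center_arcs assms(3) by blast
  then show ?case by (simp add: connected_component_refl)
next
  case (step x y)
  then obtain e where e: "x \<in> R" "y \<in> R" "e \<in> good_sides p q x" "e \<in> good_sides p q y" by (auto simp: adj_def)
  have c: "card (good_sides p q x) = 2" "card (good_sides p q y) = 2"
    using two[OF e(1)] two[OF e(2)] e(3,4) finite_good_sides[of p q x] finite_good_sides[of p q y] by auto
  have "seg_center e \<in> arcs p q x" "seg_center e \<in> arcs p q y"
    using seg_center_arcs e c by blast+
  then have "connected_component (\<Union> (arcs p q ` R)) (seg_center e) (square_center x)"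
    "connected_component (\<Union> (arcs p q ` R)) (seg_center e) (square_center y)"
    using connected_to_center e(1,2) by blast+
  then have "connected_component (\<Union> (arcs p q ` R)) (square_center x) (square_center y)"
    using connected_component_trans[OF connected_component_sym] by blast
  then show ?case by (rule connected_component_trans[OF step.IH])
qed

lemma connected_comp_points:
  assumes two: "\<And>s. s \<in> R \<Longrightarrow> card (good_sides p q s) \<in> {0, 2}"
    and s: "s \<in> R" "z \<in> arcs p q s" and s': "s' \<in> square_comp p q R s" "z' \<in> arcs p q s'"
  shows "connected_component (\<Union> (arcs p q ` R)) z z'"
proof -
  have "good_sides p q s \<noteq> {}" using arcs_nonempty[OF s(2)] by auto
  then have c: "connected_component (\<Union> (arcs p q ` R)) (square_center s) (square_center s')"
    using s'(1) by (intro connected_comp[OF two] s(1)) (simp_all add: square_comp_def)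
  have "s' \<in> R" using s'(1) comp_subset[OF s(1)] by blast
  then have z': "connected_component (\<Union> (arcs p q ` R)) z' (square_center s')"
    by (rule connected_to_center[OF s'(2)])
  show ?thesis
    by (rule connected_component_trans[OF connected_to_center[OF s(2,1)]
      connected_component_trans[OF c connected_component_sym[OF z']]])
qed

lemma even_subset_doubleton:
  assumes "B \<subseteq> {x, y}" "even (card B)" "B \<noteq> {}"
  shows "x \<in> B \<and> y \<in> B"
proof (rule ccontr)
  assume "\<not> (x \<in> B \<and> y \<in> B)"
  then have "B = {x} \<or> B = {y}" using assms(1,3) by blast
  then have "card B = 1" by auto
  then show False using assms(2) by simp
qed

text \<open>A region with at most two good boundary edges: a component of its squares with no boundary edge
  is isolated, and by parity any other component contains both boundary edges.\<close>

lemma region_connected: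
  assumes fin: "finite R" and two: "\<And>s. s \<in> R \<Longrightarrow> card (good_sides p q s) \<in> {0, 2}"
    and bd: "boundary p q R \<subseteq> {e1, e2}"
    and C: "connected C" "C \<subseteq> plaid_set p q" "z \<in> C" "z' \<in> C"
    and z: "z \<in> arcs p q s" "s \<in> R" and z': "z' \<in> arcs p q s'" "s' \<in> R"
  shows "connected_component (\<Union> (arcs p q ` R)) z z'"
proof -
  have same: ?thesis if "x \<in> square_comp p q R s" "z' \<in> arcs p q x" for x
    by (rule connected_comp_points[OF two z(2,1) that])
  have iso: "C \<subseteq> \<Union> (arcs p q ` square_comp p q R x)"
    if "boundary p q (square_comp p q R x) = {}" "x \<in> R" "y \<in> C" "y \<in> arcs p q x" for x y
  proof (rule isolated_squares)
    show "finite (square_comp p q R x)" using comp_subset[OF that(2)] fin by (rule finite_subset)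
    fix a b assume ab: "a \<in> square_comp p q R x" "b \<notin> square_comp p q R x"
    show "good_sides p q a \<inter> good_sides p q b = {}"
    proof (rule ccontr)
      assume "good_sides p q a \<inter> good_sides p q b \<noteq> {}"
      then obtain e where e: "good p q e" "a \<in> sides e" "b \<in> sides e" by (auto simp: good_sides_iff mem_sides)
      have "a \<noteq> b" using ab by auto
      then have "sides e = {a, b}" using e sides_two[of e]
        card_subset_eq[of "sides e" "{a, b}"] by simp
      then have "incident (square_comp p q R x) e = {a}" using ab unfolding incident_eq by blast
      then have "e \<in> boundary p q (square_comp p q R x)" using e(1) by (simp add: boundary_def)
      then show False using that(1) by simp
    qed
  next
    show "connected C" "C \<subseteq> plaid_set p q" "y \<in> C" by (fact C(1) C(2) that(3))+
    show "y \<in> \<Union> (arcs p q ` square_comp p q R x)" using that(4) comp_self by blast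
  qed
  have full: "boundary p q (square_comp p q R x) = {e1, e2}"
    if "boundary p q (square_comp p q R x) \<noteq> {}" "x \<in> R" for x
  proof -
    have "boundary p q (square_comp p q R x) \<subseteq> {e1, e2}" using boundary_comp[OF that(2)] bd by blast
    moreover have "even (card (boundary p q (square_comp p q R x)))"
      using handshake[of "square_comp p q R x" p q] two comp_subset[OF that(2), of p q]
        finite_subset[OF comp_subset[OF that(2), of p q] fin] by blast
    ultimately have "e1 \<in> boundary p q (square_comp p q R x)" "e2 \<in> boundary p q (square_comp p q R x)"
      using that(1) even_subset_doubleton[of "boundary p q (square_comp p q R x)" e1 e2] by simp_all
    then show ?thesis using boundary_comp[OF that(2)] bd by blast
  qed
  show ?thesis
  proof (cases "boundary p q (square_comp p q R s) = {}")
    case True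
    then have "z' \<in> \<Union> (arcs p q ` square_comp p q R s)" using iso[OF _ z(2) C(3) z(1)] C(4) by blast
    then show ?thesis using same by blast
  next
    case sF: False
    show ?thesis
    proof (cases "boundary p q (square_comp p q R s') = {}")
      case True
      then have "z \<in> \<Union> (arcs p q ` square_comp p q R s')" using iso[OF _ z'(2) C(4) z'(1)] C(3) by blast
      then obtain x where x: "x \<in> square_comp p q R s'" "z \<in> arcs p q x" by blast
      then show ?thesis using connected_component_sym[OF connected_comp_points[OF two z'(2,1)]] by blast
    next
      case False
      have "e1 \<in> boundary p q (square_comp p q R s)" "e1 \<in> boundary p q (square_comp p q R s')"
        using full[OF sF z(2)] full[OF False z'(2)] by auto
      then have "incident (square_comp p q R s') e1 \<noteq> {}" "good p q e1" by (auto simp: boundary_def)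
      then obtain y where y: "y \<in> square_comp p q R s'" "e1 \<in> good_sides p q y"
        unfolding incident_def good_sides_iff by blast
      then have "y \<in> square_comp p q R s"
        using boundary_comp_unique[OF \<open>e1 \<in> boundary p q (square_comp p q R s)\<close>] comp_subset[OF z'(2)] z(2) by blast
      then have "square_comp p q R y = square_comp p q R s" by (rule comp_sym)
      moreover have "square_comp p q R y = square_comp p q R s'" using y(1) by (rule comp_sym)
      ultimately have "s' \<in> square_comp p q R s" using comp_self[of s' p q R] by simp
      then show ?thesis by (rule same[OF _ z'(1)])
    qed
  qed
qed

section \<open>The big polygon in a narrow strip\<close>

lemma card_Int_doubleton:
  assumes "card (R \<inter> {x, y}) = 1" "x \<noteq> y"
  shows "x \<in> R \<longleftrightarrow> y \<notin> R"
  using assms by (cases "x \<in> R"; cases "y \<in> R") simp_all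

context plaid_param
begin

lemma card_good_sides:
  assumes "0 \<le> a" "2 * (a + 1) < w"
  shows "card (good_sides p q (a, b)) \<in> {0, 2}"
proof -
  have g: "good p q (Hor a b) = hor_good p w a b" "good p q (Hor a (b + 1)) = hor_good p w a (b + 1)"
    "good p q (Ver a b) = ver_good p w a b" "good p q (Ver (a + 1) b) = ver_good p w (a + 1) b"
    using assms good_Hor good_Ver by simp_all
  have "good_sides p q (a, b) = {e \<in> square_edges a b. good p q e}"
    by (simp add: good_sides_def good_edges_def)
  then have "card (good_sides p q (a, b)) = (\<Sum>e\<in>square_edges a b. of_bool (good p q e))"
    by (simp add: square_edges_def of_bool_def sum.If_cases Int_def)
  also have "\<dots> = of_bool (hor_good p w a b) + of_bool (hor_good p w a (b + 1))
      + of_bool (ver_good p w a b) + of_bool (ver_good p w (a + 1) b)"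
    unfolding square_edges_def g[symmetric] by simp
  finally show ?thesis using square_even[of a b] by simp
qed

end

context plaid_tune
begin

definition strip :: "(int \<times> int) set" where
  "strip = {0..<t} \<times> {0..<w}"

text \<open>The rows between the two lines of capacity 2. Both exits of the strip lie outside these
  rows, so the right side of this region is closed.\<close>

definition middle :: "(int \<times> int) set" where
  "middle = {0..<t} \<times> {t..<w - t}"

lemma strip_iff: "(a, b) \<in> strip \<longleftrightarrow> 0 \<le> a \<and> a < t \<and> 0 \<le> b \<and> b < w"
  by (auto simp: strip_def)

lemma middle_iff: "(a, b) \<in> middle \<longleftrightarrow> 0 \<le> a \<and> a < t \<and> t \<le> b \<and> b < w - t"
  by (auto simp: middle_def)

lemma strip_two: "s \<in> strip \<Longrightarrow> card (good_sides p q s) \<in> {0, 2}"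
  using card_good_sides[of "fst s" "snd s"] t_less strip_iff[of "fst s" "snd s"] by simp

lemma middle_subset: "middle \<subseteq> strip"
  using t_pos by (auto simp: middle_def strip_def)

lemma finite_strip: "finite strip" "finite middle"
  by (simp_all add: strip_def middle_def)

lemma good_Hor_strip: "\<lbrakk>0 \<le> a; a < t\<rbrakk> \<Longrightarrow> good p q (Hor a b) \<longleftrightarrow> hor_good p w a b"
  using good_Hor t_less by simp

lemma good_Ver_strip: "\<lbrakk>0 \<le> a; a \<le> t\<rbrakk> \<Longrightarrow> good p q (Ver a b) \<longleftrightarrow> ver_good p w a b"
  using good_Ver t_less by simp

text \<open>The left, bottom and top sides have capacity 0, so a polygon can leave only through
  \<open>x = t\<close>, where capacity 2 permits at most two good edges in the block.\<close>

lemma boundary_strip: "boundary p q strip \<subseteq> {Ver t exit_low, Ver t exit_high}"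
proof
  fix e assume e: "e \<in> boundary p q strip"
  then have g: "good p q e" and c: "card (strip \<inter> sides e) = 1" by (simp_all add: boundary_def incident_eq)
  show "e \<in> {Ver t exit_low, Ver t exit_high}"
  proof (cases e)
    case (Hor a b)
    have "(a, b) \<in> strip \<longleftrightarrow> (a, b - 1) \<notin> strip"
    proof (rule card_Int_doubleton)
      show "card (strip \<inter> {(a, b), (a, b - 1)}) = 1" using c unfolding Hor sides.simps .
    qed simp
    then have ab: "0 \<le> a \<and> a < t \<and> (b = 0 \<or> b = w)" unfolding strip_iff by (cases "0 \<le> a \<and> a < t") auto
    then have "hor_good p w a b" using g Hor good_Hor_strip[of a b] by simp
    then show ?thesis using ab hor_good_boundary by blast
  next
    case (Ver a b)
    have "(a, b) \<in> strip \<longleftrightarrow> (a - 1, b) \<notin> strip"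
    proof (rule card_Int_doubleton)
      show "card (strip \<inter> {(a, b), (a - 1, b)}) = 1" using c unfolding Ver sides.simps .
    qed simp
    then have ab: "0 \<le> b \<and> b < w \<and> (a = 0 \<or> a = t)" unfolding strip_iff
      by (cases "0 \<le> b \<and> b < w") auto
    then have v: "ver_good p w a b" using g Ver good_Ver_strip[of a b] t_pos by fastforce
    then have "a = t" using ab ver_good_0 by blast
    then show ?thesis using ver_good_t[of b] ab v Ver by blast
  qed
qed

lemma boundary_middle: "boundary p q middle \<subseteq> {Hor 0 t, Hor 0 (w - t)}"
proof
  fix e assume e: "e \<in> boundary p q middle"
  then have g: "good p q e" and c: "card (middle \<inter> sides e) = 1" by (simp_all add: boundary_def incident_eq)
  show "e \<in> {Hor 0 t, Hor 0 (w - t)}"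
  proof (cases e)
    case (Hor a b)
    have "(a, b) \<in> middle \<longleftrightarrow> (a, b - 1) \<notin> middle"
    proof (rule card_Int_doubleton)
      show "card (middle \<inter> {(a, b), (a, b - 1)}) = 1" using c unfolding Hor sides.simps .
    qed simp
    then have ab: "0 \<le> a \<and> a < t \<and> (b = t \<or> b = w - t)" unfolding middle_iff by (cases "0 \<le> a \<and> a < t") auto
    then have "hor_good p w a b" using g Hor good_Hor_strip[of a b] by simp
    then show ?thesis using ab hor_good_unit[of b a] Hor by blast
  next
    case (Ver a b)
    have "(a, b) \<in> middle \<longleftrightarrow> (a - 1, b) \<notin> middle"
    proof (rule card_Int_doubleton)
      show "card (middle \<inter> {(a, b), (a - 1, b)}) = 1" using c unfolding Ver sides.simps .
    qed simp
    then have ab: "t \<le> b \<and> b < w - t \<and> (a = 0 \<or> a = t)" unfolding middle_iff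
      by (cases "t \<le> b \<and> b < w - t") auto
    then have v: "ver_good p w a b" using g Ver good_Ver_strip[of a b] t_pos by fastforce
    then have "a = t" using ab ver_good_0 by blast
    then have "b = exit_low \<or> b = exit_high" using ver_good_t[of b] ab v t_pos by simp
    then show ?thesis using exit_bounds ab by linarith
  qed
qed

lemma good_anchor: "n = t \<or> n = w - t \<Longrightarrow> good p q (Hor 0 n)"
  using good_Hor_strip[of 0 n] hor_good_unit[of n 0] t_pos by simp

abbreviation "strip_arcs \<equiv> \<Union> (arcs p q ` strip)"

lemma anchor_arcs:
  assumes "n = t \<or> n = w - t"
  shows "(1/2, of_int n) \<in> strip_arcs"
proof -
  have s: "(0, n) \<in> strip" using assms t_pos t_less by (auto simp: strip_def)
  have e: "Hor 0 n \<in> good_sides p q (0, n)" using good_anchor[OF assms] by (simp add: good_sides_iff square_edges_def)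
  then have "good_sides p q (0, n) \<noteq> {}" by auto
  then have "card (good_sides p q (0, n)) = 2" using strip_two[OF s] finite_good_sides[of p q "(0, n)"] by simp
  then have "seg_center (Hor 0 n) \<in> arcs p q (0, n)" using e by (rule seg_center_arcs)
  then show ?thesis using s by force
qed

text \<open>Inside \<open>middle\<close> the only possible boundary edges are the two anchors. The
  component of the first anchor has it on its boundary, and parity then forces the second.
  Afterwards it is irrelevant which of the two lines has positive sign.\<close>

lemma anchors_connected:
  "connected_component strip_arcs (1/2, of_int t) (1/2, of_int (w - t))"
proof -
  have two: "card (good_sides p q s) \<in> {0, 2}" if "s \<in> middle" for s
    using strip_two middle_subset that by blast
  have s0: "(0, t) \<in> middle" using t_pos t_less by (simp add: middle_def)
  have e: "Hor 0 t \<in> good_sides p q (0, t)" using good_anchor by (simp add: good_sides_iff square_edges_def)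
  have "incident middle (Hor 0 t) = {(0, t)}" using s0 by (auto simp: incident_eq middle_def)
  then have "Hor 0 t \<in> boundary p q middle" using good_anchor by (simp add: boundary_def)
  then have b: "Hor 0 t \<in> boundary p q (square_comp p q middle (0, t))"
    by (rule comp_boundary_mem[OF comp_self s0 e])
  have sub: "boundary p q (square_comp p q middle (0, t)) \<subseteq> {Hor 0 t, Hor 0 (w - t)}"
    using boundary_comp[OF s0] boundary_middle by blast
  have ev: "even (card (boundary p q (square_comp p q middle (0, t))))"
    using handshake[of "square_comp p q middle (0, t)" p q] two comp_subset[OF s0, of p q]
      finite_subset[OF comp_subset[OF s0, of p q] finite_strip(2)] by blast
  have "boundary p q (square_comp p q middle (0, t)) \<noteq> {}" using b by blast
  from even_subset_doubleton[OF sub ev this]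
  have "Hor 0 (w - t) \<in> boundary p q (square_comp p q middle (0, t))" by (rule conjunct2)
  then have "incident (square_comp p q middle (0, t)) (Hor 0 (w - t)) \<noteq> {}" "good p q (Hor 0 (w - t))"
    by (auto simp: boundary_def)
  then obtain s where s: "s \<in> square_comp p q middle (0, t)" "Hor 0 (w - t) \<in> good_sides p q s"
    unfolding incident_def good_sides_iff by blast
  have two': "card (good_sides p q x) = 2" if "x \<in> middle" "y \<in> good_sides p q x" for x y
    using two[OF that(1)] that(2) finite_good_sides[of p q x] by auto
  have "s \<in> middle" using s(1) comp_subset[OF s0] by blast
  then have z: "seg_center (Hor 0 (w - t)) \<in> arcs p q s" using two' s(2) seg_center_arcs by blast
  have z0: "seg_center (Hor 0 t) \<in> arcs p q (0, t)" using two'[OF s0 e] e by (rule seg_center_arcs)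
  have "connected_component (\<Union> (arcs p q ` middle)) (seg_center (Hor 0 t)) (seg_center (Hor 0 (w - t)))"
    by (rule connected_comp_points[OF two s0 z0 s(1) z])
  then have "connected_component strip_arcs (seg_center (Hor 0 t)) (seg_center (Hor 0 (w - t)))"
    by (rule connected_component_of_subset) (use middle_subset in blast)
  then show ?thesis by simp
qed

lemma strip_arcs_rect: "strip_arcs \<subseteq> {0..of_int t} \<times> {0..of_int w}"
proof
  fix z assume "z \<in> strip_arcs"
  then obtain s where s: "s \<in> strip" "z \<in> arcs p q s" by blast
  have "0 \<le> fst s" "fst s + 1 \<le> t" "0 \<le> snd s" "snd s + 1 \<le> w" using s(1) by (auto simp: strip_def)
  then have "(0::real) \<le> of_int (fst s)" "of_int (fst s) + 1 \<le> real_of_int t"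
    "(0::real) \<le> of_int (snd s)" "of_int (snd s) + 1 \<le> real_of_int w" by linarith+
  then show "z \<in> {0..of_int t} \<times> {0..of_int w}"
    using arcs_bounds[OF s(2)] by (simp add: mem_Times_iff)
qed

text \<open>A point on the rim of the rectangle may come from a square outside. It is then the
  midpoint of a good edge, and the square on the inner side, having a good edge, contains it in its
  arcs too.\<close>

lemma plaid_in_strip:
  assumes "z \<in> plaid_set p q" "z \<in> {0..of_int t} \<times> {0..of_int w}"
  obtains s where "s \<in> strip" "z \<in> arcs p q s"
proof -
  have zb: "0 \<le> fst z" "fst z \<le> of_int t" "0 \<le> snd z" "snd z \<le> of_int w" using assms(2) by auto
  obtain s where s: "z \<in> arcs p q s" using assms(1) plaid_set_eq by blast
  have from_edge: thesis if "s' \<in> strip" "e \<in> good_sides p q s'" "z = seg_center e" for s' e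
  proof -
    have "good_sides p q s' \<noteq> {}" using that(2) by auto
    then have "card (good_sides p q s') = 2" using strip_two[OF that(1)] finite_good_sides[of p q s'] by simp
    then show thesis using seg_center_arcs that \<open>\<And>s. \<lbrakk>s \<in> strip; z \<in> arcs p q s\<rbrakk> \<Longrightarrow> thesis\<close> by blast
  qed
  from s show thesis
  proof (cases rule: arcs_cases)
    case interior
    then have "0 \<le> fst s" "fst s < t" "0 \<le> snd s" "snd s < w" using zb by linarith+
    then have "s \<in> strip" by (simp add: strip_def mem_Times_iff)
    then show thesis using that s by blast
  next
    case (edge e)
    have g: "good p q e" using edge(1) by (simp add: good_sides_iff)
    show thesis
    proof (cases e)
      case (Hor i j)
      have ij: "0 \<le> i" "i < t" "0 \<le> j" "j \<le> w" using zb edge(2) Hor by simp_all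
      show thesis
      proof (cases "j = w")
        case True
        show thesis
          by (rule from_edge[of "(i, w - 1)" e])
            (use ij True g Hor edge(2) w_pos in \<open>simp_all add: strip_def good_sides_iff square_edges_def\<close>)
      next
        case False
        show thesis
          by (rule from_edge[of "(i, j)" e])
            (use ij False g Hor edge(2) in \<open>simp_all add: strip_def good_sides_iff square_edges_def\<close>)
      qed
    next
      case (Ver i j)
      have ij: "0 \<le> i" "i \<le> t" "0 \<le> j" "j < w" using zb edge(2) Ver by simp_all
      show thesis
      proof (cases "i = t")
        case True
        show thesis
          by (rule from_edge[of "(t - 1, j)" e])
            (use ij True g Ver edge(2) t_pos in \<open>simp_all add: strip_def good_sides_iff square_edges_def\<close>)
      next
        case False
        show thesis
          by (rule from_edge[of "(i, j)" e])
            (use ij False g Ver edge(2) in \<open>simp_all add: strip_def good_sides_iff square_edges_def\<close>)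
      qed
    qed
  qed
qed

lemma strip_connected:
  assumes "connected C" "C \<subseteq> plaid_set p q" "z \<in> C" "z' \<in> C"
    "z \<in> {0..of_int t} \<times> {0..of_int w}" "z' \<in> {0..of_int t} \<times> {0..of_int w}"
  shows "connected_component strip_arcs z z'"
proof -
  obtain s where s: "s \<in> strip" "z \<in> arcs p q s" using plaid_in_strip assms by blast
  obtain s' where s': "s' \<in> strip" "z' \<in> arcs p q s'" using plaid_in_strip assms by blast
  show ?thesis
    by (rule region_connected[OF finite_strip(1) strip_two boundary_strip assms(1-4) s(2,1) s'(2,1)])
qed

section \<open>Capacities, and identification of the rectangle and the big polygon\<close>

lemma F_lines:
  "line_value p q FH n = of_int (crep w (4 * p * n)) / of_int w"
  "line_value p q FV n = of_int (crep w (4 * p * n)) / of_int w"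
proof -
  have "F p q FH z = of_int (crep w (4 * p * n)) / of_int w" if "z \<in> line p q FH n" for z
    using that F_FH by (cases z) (auto simp del: F.simps)
  moreover have "(0, of_int n) \<in> line p q FH n" by simp
  ultimately show "line_value p q FH n = of_int (crep w (4 * p * n)) / of_int w"
    unfolding line_value_def by (intro the_equality) (blast, metis)
  have "F p q FV z = of_int (crep w (4 * p * n)) / of_int w" if "z \<in> line p q FV n" for z
    using that F_FV by (cases z) (auto simp del: F.simps)
  moreover have "(of_int n, 0) \<in> line p q FV n" by simp
  ultimately show "line_value p q FV n = of_int (crep w (4 * p * n)) / of_int w"
    unfolding line_value_def by (intro the_equality) (blast, metis)
qed

lemma capacity_eq: "capacity p q FH n = of_int \<bar>crep w (4 * p * n)\<bar>" "capacity p q FV n = of_int \<bar>crep w (4 * p * n)\<bar>"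
  unfolding capacity_def F_lines w_def[symmetric] using w_pos by simp_all

lemma meets_iff: "meets_block p q FH n \<longleftrightarrow> 0 \<le> n \<and> n \<le> w" "meets_block p q FV n \<longleftrightarrow> 0 \<le> n \<and> n \<le> w"
proof -
  have "meets_block p q FH n" if "0 \<le> n" "n \<le> w"
  proof -
    have "(0, of_int n) \<in> line p q FH n \<inter> first_block p q"
      using that w_pos by (simp add: first_block_def w_def[symmetric])
    then show ?thesis unfolding meets_block_def by blast
  qed
  moreover have "0 \<le> n \<and> n \<le> w" if "meets_block p q FH n"
    using that by (auto simp: meets_block_def first_block_def w_def[symmetric])
  ultimately show "meets_block p q FH n \<longleftrightarrow> 0 \<le> n \<and> n \<le> w" by blast
  have "meets_block p q FV n" if "0 \<le> n" "n \<le> w"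
  proof -
    have "(of_int n, 0) \<in> line p q FV n \<inter> first_block p q"
      using that w_pos by (simp add: first_block_def w_def[symmetric])
    then show ?thesis unfolding meets_block_def by blast
  qed
  moreover have "0 \<le> n \<and> n \<le> w" if "meets_block p q FV n"
    using that by (auto simp: meets_block_def first_block_def w_def[symmetric])
  ultimately show "meets_block p q FV n \<longleftrightarrow> 0 \<le> n \<and> n \<le> w" by blast
qed

text \<open>All capacities of horizontal and vertical lines are even, so a positive capacity at most
  4 is 2 or 4; half the signed value is congruent to \<open>2 * p * n\<close> modulo
  \<open>w\<close>.\<close>

lemma crep_even: obtains c where "crep w (4 * p * n) = 2 * c" "w dvd 2 * p * n - c"
proof -
  have h: "crep w (4 * p * n) = 2 * (2 * p * n - w * ((4 * p * n + w) div (2 * w)))"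
    by (simp add: crep_def)
  show thesis by (rule that[OF h]) simp
qed

lemma crep_two:
  assumes "0 \<le> n" "n \<le> w" "\<bar>crep w (4 * p * n)\<bar> = 2"
  shows "n = t \<or> n = w - t"
proof -
  obtain c where c: "crep w (4 * p * n) = 2 * c" "w dvd 2 * p * n - c" by (rule crep_even)
  then have c1: "c = 1 \<or> c = - 1" using assms(3) by linarith
  have "w dvd 2 * p * (n - t) \<or> w dvd 2 * p * (n + t)"
    using c1 t_tune c(2) dvd_diff[of w "2 * p * n - c" "2 * p * t - 1"] dvd_diff[of w "2 * p * n - c" "2 * p * t + 1"]
      dvd_add[of w "2 * p * n - c" "2 * p * t - 1"] dvd_add[of w "2 * p * n - c" "2 * p * t + 1"]
    by (elim disjE) (simp_all add: algebra_simps)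
  then have "w dvd n - t \<or> w dvd n + t" using dvd_2p by blast
  then show ?thesis
  proof
    assume "w dvd n - t"
    then show ?thesis using dvd_small[of "n - t"] assms(1,2) t_pos t_less by simp
  next
    assume "w dvd n + t"
    then have "w dvd n + t - w" by simp
    then show ?thesis using dvd_small[of "n + t - w"] assms(1,2) t_pos t_less by simp
  qed
qed

text \<open>Capacity 4 forces \<open>n\<close> to be congruent to \<open>2 * t\<close> or
  \<open>- 2 * t\<close> modulo \<open>w\<close>, so in the block \<open>n\<close> is
  \<open>2 * t\<close> or \<open>w - 2 * t\<close>. The second is at least \<open>t\<close> exactly
  if \<open>3 * t <= w\<close>, which is the origin of this hypothesis.\<close>

lemma crep_four:
  assumes "0 \<le> n" "n \<le> w" "\<bar>crep w (4 * p * n)\<bar> = 4" "3 * t \<le> w"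
  shows "t \<le> n"
proof (rule ccontr)
  assume n: "\<not> t \<le> n"
  obtain c where c: "crep w (4 * p * n) = 2 * c" "w dvd 2 * p * n - c" by (rule crep_even)
  then have c1: "c = 2 \<or> c = - 2" using assms(3) by linarith
  have tt: "w dvd 2 * (2 * p * t - 1) \<or> w dvd 2 * (2 * p * t + 1)" using t_tune by (meson dvd_mult)
  have "w dvd 2 * p * (n - 2 * t) \<or> w dvd 2 * p * (n + 2 * t)"
    using c1 tt c(2) dvd_diff[of w "2 * p * n - c" "2 * (2 * p * t - 1)"] dvd_diff[of w "2 * p * n - c" "2 * (2 * p * t + 1)"]
      dvd_add[of w "2 * p * n - c" "2 * (2 * p * t - 1)"] dvd_add[of w "2 * p * n - c" "2 * (2 * p * t + 1)"]
    by (elim disjE) (simp_all add: algebra_simps)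
  then have "w dvd n - 2 * t \<or> w dvd n + 2 * t" using dvd_2p by blast
  then show False
  proof
    assume "w dvd n - 2 * t"
    then show False using dvd_small[of "n - 2 * t"] assms n t_pos by simp
  next
    assume "w dvd n + 2 * t"
    then have "w dvd n + 2 * t - w" by simp
    then show False using dvd_small[of "n + 2 * t - w"] assms n t_pos t_less by simp
  qed
qed

lemma crep_t: obtains \<sigma> where "\<sigma> = 1 \<or> \<sigma> = - 1" "crep w (4 * p * t) = 2 * \<sigma>" "crep w (4 * p * (w - t)) = - 2 * \<sigma>"
proof -
  obtain j \<sigma> where j: "2 * p * t = w * j + \<sigma>" "\<sigma> = 1 \<or> \<sigma> = - 1" by (rule t_line)
  have w3: "3 \<le> w" using t_pos t_less by linarith
  have "4 * p * t = 2 * \<sigma> + 2 * w * j" using j(1) by simp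
  then have 1: "crep w (4 * p * t) = 2 * \<sigma>" using j(2) w3 by (intro crepI) auto
  have "4 * p * (w - t) = - 2 * \<sigma> + 2 * w * (2 * p - j)" using j(1) by (simp add: algebra_simps)
  then have "crep w (4 * p * (w - t)) = - 2 * \<sigma>" using j(2) w3 by (intro crepI) auto
  then show thesis using that j(2) 1 by blast
qed

lemma capacity_iff: "capacity p q FH n = 2 \<longleftrightarrow> \<bar>crep w (4 * p * n)\<bar> = 2"
  "0 < capacity p q FV n \<longleftrightarrow> 0 < \<bar>crep w (4 * p * n)\<bar>"
  "capacity p q FV n \<le> 4 \<longleftrightarrow> \<bar>crep w (4 * p * n)\<bar> \<le> 4"
  unfolding capacity_eq by (simp_all only: of_int_eq_numeral_iff of_int_0_less_iff of_int_le_numeral_iff)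

lemma unit_lines: "{n. meets_block p q FH n \<and> capacity p q FH n = 2} = {t, w - t}"
proof (intro equalityI subsetI)
  fix n assume "n \<in> {n. meets_block p q FH n \<and> capacity p q FH n = 2}"
  then have "0 \<le> n" "n \<le> w" "\<bar>crep w (4 * p * n)\<bar> = 2" by (simp_all add: meets_iff capacity_iff)
  then show "n \<in> {t, w - t}" using crep_two by blast
next
  obtain \<sigma> where \<sigma>: "\<sigma> = 1 \<or> \<sigma> = - 1" "crep w (4 * p * t) = 2 * \<sigma>" "crep w (4 * p * (w - t)) = - 2 * \<sigma>"
    by (rule crep_t)
  fix n assume "n \<in> {t, w - t}"
  then show "n \<in> {n. meets_block p q FH n \<and> capacity p q FH n = 2}"
    using \<sigma> t_pos t_less by (auto simp: meets_iff capacity_iff)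
qed

lemma top_line_eq: "top_line p q = line p q FH (w - t)"
proof -
  have "Max {t, w - t} = w - t" using t_less by simp
  then show ?thesis unfolding top_line_def unit_lines by simp
qed

lemma bottom_line_eq: "bottom_line p q = line p q FH t"
proof -
  have "Min {t, w - t} = t" using t_less by simp
  then show ?thesis unfolding bottom_line_def unit_lines by simp
qed

lemma big_height_cases: "big_height p q = t \<or> big_height p q = w - t"
proof -
  obtain \<sigma> where \<sigma>: "\<sigma> = 1 \<or> \<sigma> = - 1" "crep w (4 * p * t) = 2 * \<sigma>" "crep w (4 * p * (w - t)) = - 2 * \<sigma>"
    by (rule crep_t)
  define n where "n = (if \<sigma> = 1 then t else w - t)"
  have iff: "meets_block p q FH m \<and> capacity p q FH m = 2 \<and> line_value p q FH m > 0 \<longleftrightarrow> m = n" for m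
  proof -
    have "meets_block p q FH m \<and> capacity p q FH m = 2 \<longleftrightarrow> m \<in> {t, w - t}"
      using unit_lines by blast
    moreover have "line_value p q FH m > 0 \<longleftrightarrow> 0 < crep w (4 * p * m)"
      unfolding F_lines using w_pos by (simp add: zero_less_divide_iff)
    ultimately show ?thesis using \<sigma> t_less unfolding n_def by auto
  qed
  have "big_height p q = n" unfolding big_height_def iff by simp
  then show ?thesis by (simp add: n_def)
qed

lemma rect_width_eq:
  assumes "3 * t \<le> w"
  shows "rect_width p q = t"
  unfolding rect_width_def
proof (rule Min_eqI)
  have "{n. meets_block p q FV n \<and> 0 < capacity p q FV n \<and> capacity p q FV n \<le> 4} \<subseteq> {0..w}"
    by (auto simp: meets_iff)
  then show "finite {n. meets_block p q FV n \<and> 0 < capacity p q FV n \<and> capacity p q FV n \<le> 4}"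
    by (rule finite_subset) simp
  show "t \<in> {n. meets_block p q FV n \<and> 0 < capacity p q FV n \<and> capacity p q FV n \<le> 4}"
  proof -
    obtain \<sigma> where \<sigma>: "\<sigma> = 1 \<or> \<sigma> = - 1" "crep w (4 * p * t) = 2 * \<sigma>" by (rule crep_t)
    then have "\<bar>crep w (4 * p * t)\<bar> = 2" by auto
    then show ?thesis using t_pos t_less by (simp add: meets_iff capacity_iff)
  qed
  fix n assume "n \<in> {n. meets_block p q FV n \<and> 0 < capacity p q FV n \<and> capacity p q FV n \<le> 4}"
  then have n: "0 \<le> n" "n \<le> w" and b: "0 < \<bar>crep w (4 * p * n)\<bar>" "\<bar>crep w (4 * p * n)\<bar> \<le> 4"
    unfolding mem_Collect_eq capacity_iff meets_iff by blast+
  obtain c where "crep w (4 * p * n) = 2 * c" by (rule crep_even)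
  then have e: "\<bar>crep w (4 * p * n)\<bar> = 2 * \<bar>c\<bar>" by (simp add: abs_mult)
  then have "\<bar>c\<bar> = 1 \<or> \<bar>c\<bar> = 2" using b by linarith
  then have "\<bar>crep w (4 * p * n)\<bar> = 2 \<or> \<bar>crep w (4 * p * n)\<bar> = 4" using e by linarith
  then show "t \<le> n"
  proof
    assume "\<bar>crep w (4 * p * n)\<bar> = 2"
    then show ?thesis using crep_two n(1,2) t_less by fastforce
  qed (use crep_four n(1,2) assms in blast)
qed

lemma rect_eq:
  assumes "3 * t \<le> w"
  shows "rect p q = {0..of_int t} \<times> {0..of_int w}"
  by (simp add: rect_def rect_width_eq[OF assms] w_def[symmetric])

lemma strip_arcs_plaid: "strip_arcs \<subseteq> plaid_set p q"
  unfolding plaid_set_eq by blast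

lemma big_height_connected:
  assumes "n = t \<or> n = w - t"
  shows "connected_component strip_arcs (1/2, of_int (big_height p q)) (1/2, of_int n)"
proof -
  have refl: "connected_component strip_arcs (1/2, of_int m) (1/2, of_int m)" if "m = t \<or> m = w - t" for m
    using anchor_arcs[OF that] by (simp add: connected_component_refl)
  show ?thesis
    using assms big_height_cases refl[of t] refl[of "w - t"] anchors_connected
      connected_component_sym[OF anchors_connected] by metis
qed

lemma big_polygonI:
  assumes "connected_component (plaid_set p q) (1/2, of_int t) z"
  shows "z \<in> big_polygon p q"
proof -
  have "connected_component (plaid_set p q) (1/2, of_int (big_height p q)) (1/2, of_int t)"
    by (rule connected_component_of_subset[OF big_height_connected strip_arcs_plaid]) simp
  then have "connected_component (plaid_set p q) (1/2, of_int (big_height p q)) z"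
    using assms by (rule connected_component_trans)
  then show ?thesis by (simp add: big_polygon_def plaid_polygon_def)
qed

text \<open>A priori the big polygon could meet the rectangle in several pieces. As the strip has at
  most two exits, any two points of one plaid polygon in it are already joined inside it.\<close>

lemma gamma_arc_connected:
  assumes "z \<in> gamma_arc p q" "3 * t \<le> w" "n = t \<or> n = w - t"
  shows "connected_component strip_arcs z (1/2, of_int n)"
proof -
  let ?h = "(1/2, of_int (big_height p q)) :: real \<times> real"
  have h: "?h \<in> strip_arcs" using anchor_arcs[OF big_height_cases] .
  have "connected_component strip_arcs z ?h"
  proof (rule strip_connected)
    show "connected (big_polygon p q)" unfolding big_polygon_def plaid_polygon_def
      by (rule connected_connected_component)
    show "big_polygon p q \<subseteq> plaid_set p q" unfolding big_polygon_def plaid_polygon_def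
      by (rule connected_component_subset)
    show "z \<in> big_polygon p q" "z \<in> {0..of_int t} \<times> {0..of_int w}"
      using assms(1) unfolding gamma_arc_def rect_eq[OF assms(2)] by blast+
    show "?h \<in> big_polygon p q" unfolding big_polygon_def plaid_polygon_def
      using h strip_arcs_plaid by (simp add: connected_component_refl subsetD)
    show "?h \<in> {0..of_int t} \<times> {0..of_int w}" using h strip_arcs_rect by blast
  qed
  then show ?thesis by (rule connected_component_trans[OF _ big_height_connected[OF assms(3)]])
qed

end

section \<open>Copying\<close>

text \<open>The window is the hull of all indices that occur: a horizontal edge at height
  \<open>n\<close> uses \<open>m\<close> and \<open>2 * n - m\<close> with \<open>m\<close> in
  \<open>[n, n + 2 * x)\<close>, a vertical one \<open>m\<close> and \<open>m - 2 * n\<close> with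
  \<open>m\<close> in \<open>(b, b + 2 * n]\<close>. The constant \<open>c\<close> adds
  \<open>2 * c\<close> to every horizontal pair sum and cancels in the vertical ones, which are
  differences.\<close>

lemma copy_edges:
  assumes rnd: "\<And>m. \<lbrakk>- 2 * x < m; m < y + 2 * x\<rbrakk> \<Longrightarrow> rnd p1 w1 (m + s) = rnd p0 w0 m + c"
    and flr: "\<And>a. \<lbrakk>0 \<le> a; a \<le> x\<rbrakk> \<Longrightarrow> flr p1 w1 a = flr p0 w0 a"
    and pl: "plaid p0 w0" "plaid p1 w1"
  shows "\<lbrakk>0 \<le> a; a < x; 0 \<le> n; n \<le> y\<rbrakk> \<Longrightarrow> hor_good p1 w1 a (n + s) = hor_good p0 w0 a n"
    and "\<lbrakk>0 \<le> n; n \<le> x; 0 \<le> b; b < y\<rbrakk> \<Longrightarrow> ver_good p1 w1 n (b + s) = ver_good p0 w0 n b"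
proof -
  interpret A: plaid p0 w0 by (rule pl)
  interpret B: plaid p1 w1 by (rule pl)
  have fb: "0 \<le> flr p0 w0 a \<and> flr p0 w0 a \<le> a \<and> (0 < a \<longrightarrow> flr p0 w0 a < a)" if "0 \<le> a" for a
    using A.flr_0 A.flr_less[of a] that by (cases "a = 0") auto
  {
    assume a: "0 \<le> a" "a < x" "0 \<le> n" "n \<le> y"
    have S: "pair_sum p1 w1 (n + s) (m + s) = pair_sum p0 w0 n m + 2 * c" if "n \<le> m" "m < n + 2 * x" for m
    proof -
      have "rnd p1 w1 (m + s) = rnd p0 w0 m + c" using rnd[of m] that a by simp
      moreover have "rnd p1 w1 (2 * n - m + s) = rnd p0 w0 (2 * n - m) + c" using rnd[of "2 * n - m"] that a by simp
      moreover have e: "2 * (n + s) - (m + s) = 2 * n - m + s" by simp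
      ultimately show ?thesis unfolding pair_sum_def e by linarith
    qed
    note f = flr[of a] flr[of "a + 1"]
    have e: "n + s + 2 * a - flr p0 w0 a = (n + 2 * a - flr p0 w0 a) + s"
      "(n + 2 * a - flr p0 w0 a) + s + 1 = (n + 2 * a - flr p0 w0 a + 1) + s"
      "n + s + flr p0 w0 a + 1 = (n + flr p0 w0 a + 1) + s" by simp_all
    have f0: "flr p1 w1 a = flr p0 w0 a" "flr p1 w1 (a + 1) = flr p0 w0 (a + 1)" using f a by simp_all
    have fa: "0 \<le> flr p0 w0 a" "flr p0 w0 a \<le> a" using fb[OF a(1)] by simp_all
    have S1: "pair_sum p1 w1 (n + s) ((n + 2 * a - flr p0 w0 a) + s) = pair_sum p0 w0 n (n + 2 * a - flr p0 w0 a) + 2 * c"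
      "pair_sum p1 w1 (n + s) ((n + 2 * a - flr p0 w0 a + 1) + s) = pair_sum p0 w0 n (n + 2 * a - flr p0 w0 a + 1) + 2 * c"
      "pair_sum p1 w1 (n + s) ((n + flr p0 w0 a + 1) + s) = pair_sum p0 w0 n (n + flr p0 w0 a + 1) + 2 * c"
      using fa a by (intro S; linarith)+
    show "hor_good p1 w1 a (n + s) = hor_good p0 w0 a n"
      unfolding hor_good_def f0 e S1 by simp
  }
  {
    assume n: "0 \<le> n" "n \<le> x" "0 \<le> b" "b < y"
    show "ver_good p1 w1 n (b + s) = ver_good p0 w0 n b"
    proof (cases "n = 0")
      case True
      then show ?thesis by (simp add: ver_good_def A.pair_sum_alt B.pair_sum_alt)
    next
      case False
      have S: "pair_sum p1 w1 n (m + s) = pair_sum p0 w0 n m" if "b < m" "m \<le> b + 2 * n" for m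
      proof -
        have "rnd p1 w1 (m + s) = rnd p0 w0 m + c" using rnd[of m] that n by simp
        moreover have "rnd p1 w1 (m - 2 * n + s) = rnd p0 w0 (m - 2 * n) + c" using rnd[of "m - 2 * n"] that n by simp
        moreover have e: "m + s - 2 * n = m - 2 * n + s" by simp
        ultimately show ?thesis unfolding A.pair_sum_alt B.pair_sum_alt e by linarith
      qed
      have f0: "flr p1 w1 n = flr p0 w0 n" using flr n by simp
      have fa: "0 \<le> flr p0 w0 n" "flr p0 w0 n < n" using fb[OF n(1)] False n(1) by simp_all
      have e: "b + s + flr p0 w0 n + 1 = (b + flr p0 w0 n + 1) + s"
        "b + s + 2 * n - flr p0 w0 n = (b + 2 * n - flr p0 w0 n) + s" by simp_all
      have S1: "pair_sum p1 w1 n ((b + flr p0 w0 n + 1) + s) = pair_sum p0 w0 n (b + flr p0 w0 n + 1)"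
        "pair_sum p1 w1 n ((b + 2 * n - flr p0 w0 n) + s) = pair_sum p0 w0 n (b + 2 * n - flr p0 w0 n)"
        using fa n by (intro S; linarith)+
      show ?thesis unfolding ver_good_def f0 e S1 ..
    qed
  }
qed

fun shift_edge :: "int \<Rightarrow> unit_segment \<Rightarrow> unit_segment" where
  "shift_edge s (Hor a b) = Hor a (b + s)"
| "shift_edge s (Ver a b) = Ver a (b + s)"

lemma shift_edge_inj: "inj (shift_edge s)"
proof (rule injI)
  fix e e' assume "shift_edge s e = shift_edge s e'"
  then show "e = e'" by (cases e; cases e') simp_all
qed

lemma seg_center_shift: "seg_center (shift_edge s e) = (0, of_int s) + seg_center e"
  by (cases e) simp_all

lemma square_edges_shift: "square_edges a (b + s) = shift_edge s ` square_edges a b"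
  by (simp add: square_edges_def add.commute add.left_commute)

lemma arcs_shift:
  assumes "\<And>e. e \<in> square_edges a b \<Longrightarrow> good p1 q1 (shift_edge s e) = good p0 q0 e"
  shows "arcs p1 q1 (a, b + s) = (\<lambda>z. (0, of_int s) + z) ` arcs p0 q0 (a, b)"
proof -
  have g: "good_sides p1 q1 (a, b + s) = shift_edge s ` good_sides p0 q0 (a, b)"
    using assms by (auto simp: good_sides_iff square_edges_shift)
  have c: "card (good_sides p1 q1 (a, b + s)) = card (good_sides p0 q0 (a, b))"
    unfolding g by (rule card_image) (rule inj_on_subset[OF shift_edge_inj subset_UNIV])
  have center: "square_center (a, b + s) = (0, of_int s) + square_center (a, b)" by simp
  show ?thesis
  proof (cases "card (good_sides p0 q0 (a, b)) = 2")
    case True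
    have "closed_segment (square_center (a, b + s)) (seg_center (shift_edge s e)) =
        (\<lambda>z. (0, of_int s) + z) ` closed_segment (square_center (a, b)) (seg_center e)" for e
      unfolding center seg_center_shift by (rule closed_segment_translation)
    then have "(\<Union>e\<in>good_sides p1 q1 (a, b + s). closed_segment (square_center (a, b + s)) (seg_center e)) =
        (\<lambda>z. (0, of_int s) + z) ` (\<Union>e\<in>good_sides p0 q0 (a, b). closed_segment (square_center (a, b)) (seg_center e))"
      unfolding g by (simp add: image_UN)
    then show ?thesis unfolding arcs_eq using True c by simp
  next
    case False
    then show ?thesis unfolding arcs_eq using c by simp
  qed
qed

lemma vtrans_eq: "vtrans (of_int s) = (\<lambda>z. (0, of_int s) + z)"
  by (auto simp: vtrans_def fun_eq_iff)

text \<open>The anchor hypothesis sends one of the two lines of capacity 2 to the lower line of the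
  larger parameter, and so decides between the two alternatives of the conclusion. The bound on
  \<open>s + w0\<close> keeps the translate below the midline.\<close>

lemma copy_strip:
  assumes T0: "plaid_tune p0 q0 w0 t0" and T1: "plaid_tune p1 q1 w1 t1"
    and narrow: "3 * t0 \<le> w0" "3 * t1 \<le> w1" and le: "t0 \<le> t1"
    and s: "0 \<le> s" "2 * (s + w0) < w1"
    and anchor: "n0 + s = t1" "n0 = t0 \<or> n0 = w0 - t0"
    and rnd: "\<And>m. \<lbrakk>- 2 * t0 < m; m < w0 + 2 * t0\<rbrakk> \<Longrightarrow> rnd p1 w1 (m + s) = rnd p0 w0 m + c"
    and flr: "\<And>a. \<lbrakk>0 \<le> a; a \<le> t0\<rbrakk> \<Longrightarrow> flr p1 w1 a = flr p0 w0 a"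
  shows "\<exists>t::real.
           vtrans t ` rect p0 q0 \<subseteq> rect_lower p1 q1 \<and>
           vtrans t ` gamma_arc p0 q0 \<subseteq> gamma_arc p1 q1 \<and>
           (vtrans t ` bottom_line p0 q0 = bottom_line p1 q1 \<or>
            vtrans t ` top_line p0 q0 = bottom_line p1 q1)"
proof -
  interpret A: plaid_tune p0 q0 w0 t0 by (rule T0)
  interpret B: plaid_tune p1 q1 w1 t1 by (rule T1)
  let ?T = "\<lambda>z :: real \<times> real. (0, real_of_int s) + z"
  have good: "good p1 q1 (shift_edge s e) = good p0 q0 e"
    if "e \<in> square_edges a b" "(a, b) \<in> A.strip" for a b e
  proof -
    have ab: "0 \<le> a" "a < t0" "0 \<le> b" "b < w0" using that(2) by (simp_all add: A.strip_iff)
    have copyH: "hor_good p1 w1 a (n + s) = hor_good p0 w0 a n" if "0 \<le> a" "a < t0" "0 \<le> n" "n \<le> w0" for a n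
      by (rule copy_edges(1)[where x = t0 and y = w0 and c = c])
        (fact rnd flr A.plaid_axioms B.plaid_axioms that)+
    have copyV: "ver_good p1 w1 n (b + s) = ver_good p0 w0 n b" if "0 \<le> n" "n \<le> t0" "0 \<le> b" "b < w0" for n b
      by (rule copy_edges(2)[where x = t0 and y = w0 and c = c])
        (fact rnd flr A.plaid_axioms B.plaid_axioms that)+
    from that(1) consider n where "e = Hor a n" "0 \<le> n" "n \<le> w0" | i where "e = Ver i b" "0 \<le> i" "i \<le> t0"
      using ab by (auto simp: square_edges_def)
    then show ?thesis
    proof cases
      case 1
      then show ?thesis
        using copyH[OF ab(1,2) 1(2,3)] A.good_Hor_strip[OF ab(1,2)] B.good_Hor_strip[OF ab(1)] ab(2) le by simp
    next
      case 2
      then show ?thesis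
        using copyV[OF 2(2,3) ab(3,4)] A.good_Ver_strip[OF 2(2,3)] B.good_Ver_strip[OF 2(2)] 2(3) le by simp
    qed
  qed
  have sub: "?T ` A.strip_arcs \<subseteq> plaid_set p1 q1"
  proof
    fix z assume "z \<in> ?T ` A.strip_arcs"
    then obtain a b where ab: "(a, b) \<in> A.strip" "z \<in> ?T ` arcs p0 q0 (a, b)" by auto
    then have "z \<in> arcs p1 q1 (a, b + s)" using arcs_shift[OF good[OF _ ab(1)]] by blast
    then show "z \<in> plaid_set p1 q1" unfolding plaid_set_eq by blast
  qed
  have r: "?T ` rect p0 q0 \<subseteq> rect_lower p1 q1"
  proof
    fix z assume "z \<in> ?T ` rect p0 q0"
    then have "0 \<le> fst z" "fst z \<le> of_int t0" "of_int s \<le> snd z" "snd z \<le> of_int (s + w0)"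
      unfolding A.rect_eq[OF narrow(1)] by auto
    moreover have "real_of_int t0 \<le> of_int t1" using le by simp
    moreover have "real_of_int (2 * (s + w0)) < of_int w1" using s(2) by (simp only: of_int_less_iff)
    moreover have "0 \<le> real_of_int s" using s(1) by simp
    ultimately show "z \<in> rect_lower p1 q1"
      unfolding rect_lower_def B.rect_eq[OF narrow(2)] B.w_def[symmetric] by (simp add: mem_Times_iff)
  qed
  have g: "?T ` gamma_arc p0 q0 \<subseteq> gamma_arc p1 q1"
  proof
    fix z assume "z \<in> ?T ` gamma_arc p0 q0"
    then obtain y where y: "y \<in> gamma_arc p0 q0" "z = ?T y" by blast
    \<comment> \<open>Only connectedness is transported: the translated set stays in the larger
      plaid set and contains an anchor of the larger big polygon, so its component is identified
      without looking outside the strip.\<close>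
    have "connected_component A.strip_arcs y (1/2, of_int n0)"
      by (rule A.gamma_arc_connected[OF y(1) narrow(1) anchor(2)])
    then obtain C where C: "connected C" "C \<subseteq> A.strip_arcs" "y \<in> C" "(1/2, of_int n0) \<in> C"
      unfolding connected_component_def by blast
    have "connected (?T ` C)" by (rule connected_continuous_image[OF _ C(1)]) (intro continuous_intros)
    moreover have "?T ` C \<subseteq> plaid_set p1 q1" using C(2) sub by blast
    moreover have "z \<in> ?T ` C" using C(3) y(2) by blast
    moreover have "(1/2, of_int t1) \<in> ?T ` C"
    proof -
      have "(1/2, of_int t1) = ?T (1/2, of_int n0)" unfolding anchor(1)[symmetric] by simp
      then show ?thesis using C(4) by blast
    qed
    ultimately have "connected_component (plaid_set p1 q1) (1/2, of_int t1) z"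
      unfolding connected_component_def by blast
    then have "z \<in> big_polygon p1 q1" by (rule B.big_polygonI)
    moreover have "z \<in> rect p1 q1"
      using r y unfolding gamma_arc_def rect_lower_def by blast
    ultimately show "z \<in> gamma_arc p1 q1" by (simp add: gamma_arc_def)
  qed
  have l: "?T ` line p0 q0 FH n0 = line p1 q1 FH t1"
  proof (intro equalityI subsetI)
    fix z assume "z \<in> line p1 q1 FH t1"
    then have "z = ?T (fst z, of_int n0)" unfolding anchor(1)[symmetric] by (auto simp: prod_eq_iff)
    moreover have "(fst z, of_int n0) \<in> line p0 q0 FH n0" by simp
    ultimately show "z \<in> ?T ` line p0 q0 FH n0" by blast
  qed (use anchor(1) in auto)
  have "?T ` bottom_line p0 q0 = bottom_line p1 q1 \<or> ?T ` top_line p0 q0 = bottom_line p1 q1"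
    using l anchor(2) unfolding A.bottom_line_eq A.top_line_eq B.bottom_line_eq by blast
  then show ?thesis using r g by (intro exI[of _ "of_int s"]) (simp add: vtrans_eq)
qed

section \<open>Predecessors\<close>

text \<open>Passing to the neighbour perturbs \<open>w0 * D\<close> by
  \<open>2 * m * \<epsilon>\<close>. At either end there is room \<open>w1\<close>, because a
  residue is neither 0 nor \<open>2 * w0\<close>, and further room \<open>w0\<close> from the parity
  slack in \<open>rndI\<close>; hence the bound \<open>w0 + w1\<close>.\<close>

lemma rnd_neighbour:
  assumes "plaid p0 w0" "plaid p1 w1" "p1 * w0 - p0 * w1 = \<epsilon>" "\<epsilon> = 1 \<or> \<epsilon> = - 1" "2 * \<bar>m\<bar> < w0 + w1"
  shows "rnd p1 w1 m = rnd p0 w0 m"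
proof -
  interpret A: plaid p0 w0 by fact
  interpret B: plaid p1 w1 by fact
  define D where "D = 2 * p1 * m + w1 - 2 * w1 * rnd p0 w0 m"
  have "w0 * D = w1 * A.res m + 2 * m * (p1 * w0 - p0 * w1)"
    by (simp add: D_def A.res_def algebra_simps)
  then have D: "w0 * D = w1 * A.res m + 2 * m * \<epsilon>" using assms(3) by simp
  have m: "- (w0 + w1) < 2 * m * \<epsilon>" "2 * m * \<epsilon> < w0 + w1" using assms(4,5) by auto
  have "w1 * 1 \<le> w1 * A.res m" "w1 * A.res m \<le> w1 * (2 * w0 - 1)"
    using A.res_bounds[of m] B.w_pos by (simp_all only: mult_le_cancel_left_pos)
  then have "w0 * (- 1) < w0 * D" "w0 * D < w0 * (2 * w1 + 1)"
    using D m by (simp_all add: algebra_simps)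
  then have "- 1 < D" "D < 2 * w1 + 1" using A.w_pos by (simp_all only: mult_less_cancel_left_pos)
  then show ?thesis unfolding D_def by (rule B.rndI)
qed

text \<open>Remainders carry no parity, so at the upper end the only room is the \<open>w1\<close>
  gained from \<open>rem a <= w0 - 1\<close>. This is the reason for
  \<open>2 * a < w1\<close>.\<close>

lemma flr_neighbour:
  assumes "plaid p0 w0" "plaid p1 w1" "p1 * w0 - p0 * w1 = \<epsilon>" "\<epsilon> = 1 \<or> \<epsilon> = - 1"
    and a: "0 \<le> a" "a < w0" "2 * a < w1"
  shows "flr p1 w1 a = flr p0 w0 a"
proof (cases "a = 0")
  case True
  then show ?thesis by (simp add: flr_def)
next
  case False
  interpret A: plaid p0 w0 by fact
  interpret B: plaid p1 w1 by fact
  define D where "D = 2 * p1 * a - w1 * flr p0 w0 a"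
  have "w0 * D = w1 * A.rem a + 2 * a * (p1 * w0 - p0 * w1)"
    by (simp add: D_def A.rem_def algebra_simps)
  then have D: "w0 * D = w1 * A.rem a + 2 * a * \<epsilon>" using assms(3) by simp
  have m: "- (2 * a) \<le> 2 * a * \<epsilon>" "2 * a * \<epsilon> \<le> 2 * a" using assms(4) a by auto
  have r: "1 \<le> A.rem a" "A.rem a \<le> w0 - 1" using A.rem_pos[of a] A.rem_bounds(2)[of a] False a by simp_all
  have "w1 * 1 \<le> w1 * A.rem a" "w1 * A.rem a \<le> w1 * (w0 - 1)"
    using r B.w_pos by (simp_all only: mult_le_cancel_left_pos)
  moreover have "w1 * (w0 - 1) = w0 * w1 - w1" by (simp add: algebra_simps)
  ultimately have "w0 * (- 1) < w0 * D" "w0 * D < w0 * w1"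
    using D m a A.w_pos B.w_pos by linarith+
  then have "- 1 < D" "D < w1" using A.w_pos by (simp_all only: mult_less_cancel_left_pos)
  then show ?thesis using D_def by (intro B.flrI) simp_all
qed

text \<open>Half of \<open>w1 - w0\<close> is \<open>\<kappa> * w'\<close>, so the shift centres the
  smaller block in the larger one. It contributes \<open>2 * \<kappa> * \<delta>\<close> to the
  residue, which turns the perturbation into a multiple of \<open>w0 - 2 * m\<close>, symmetric
  about the middle of the window.\<close>

lemma rnd_core:
  assumes "plaid p0 w0" "plaid p1 w1" "p1 = p0 + 2 * \<kappa> * p'" "w1 = w0 + 2 * \<kappa> * w'" "0 \<le> \<kappa>"
    and det: "p0 * w' - p' * w0 = \<delta>" "\<delta> = 1 \<or> \<delta> = - 1"
    and w': "odd w'" "w0 = w' + 2 * \<rho>" "0 < \<rho>" "\<rho> < w'"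
    and m: "- 2 * \<rho> < m" "m < w0 + 2 * \<rho>"
  shows "rnd p1 w1 (m + \<kappa> * w') = rnd p0 w0 m + \<kappa> * p'"
proof -
  interpret A: plaid p0 w0 by fact
  interpret B: plaid p1 w1 by fact
  define r where "r = A.res m"
  define b where "b = 2 * p' * m + w' - 2 * w' * rnd p0 w0 m"
  have r: "1 \<le> r" "r \<le> 2 * w0 - 1" unfolding r_def by (rule A.res_bounds)+
  have "w0 * b = w' * r - 2 * m * (p0 * w' - p' * w0)"
    by (simp add: b_def r_def A.res_def algebra_simps)
  then have b: "w0 * (b + \<delta>) = w' * r + \<delta> * (w0 - 2 * m)" unfolding det(1) by (simp add: algebra_simps)
  have w'_pos: "0 < w'" using w' by simp
  have rr: "w' * 1 \<le> w' * r" "w' * r \<le> w' * (2 * w0 - 1)"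
    using r w'_pos by (simp_all only: mult_le_cancel_left_pos)
  \<comment> \<open>On the window \<open>\<bar>w0 - 2 * m\<bar>\<close> is less than
    \<open>w0 + 4 * \<rho>\<close>, and this is at most \<open>2 * w0 + w'\<close> because
    \<open>2 * \<rho> = w0 - w'\<close> and \<open>\<rho> < w'\<close>.\<close>
  have d: "- (2 * w0 + w') < \<delta> * (w0 - 2 * m)" "\<delta> * (w0 - 2 * m) < 2 * w0 + w'"
    using det(2) m w' by auto
  have "w' * (2 * w0 - 1) = 2 * (w0 * w') - w'" "w0 * (2 * w' + 2) = 2 * (w0 * w') + 2 * w0"
    by (simp_all add: algebra_simps)
  then have "w0 * (- 2) < w0 * (b + \<delta>)" "w0 * (b + \<delta>) < w0 * (2 * w' + 2)"
    using b rr d w'_pos by linarith+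
  then have "- 2 < b + \<delta>" "b + \<delta> < 2 * w' + 2" using A.w_pos by (simp_all only: mult_less_cancel_left_pos)
  \<comment> \<open>Parity removes the values -1 and \<open>2 * w' + 1\<close>. The half
    \<open>z\<close> then lies in \<open>[0, w']\<close>, so the new residue
    \<open>r + 4 * (\<kappa> * z)\<close> stays between 1 and \<open>2 * w1 - 1\<close>.\<close>
  moreover have "even (b + \<delta>)" using w'(1) det(2) by (auto simp: b_def)
  then obtain z where z: "b + \<delta> = 2 * z" by (elim evenE)
  ultimately have z': "0 \<le> z" "z \<le> w'" by linarith+
  have "2 * p1 * (m + \<kappa> * w') + w1 - 2 * w1 * (rnd p0 w0 m + \<kappa> * p') = r + 2 * \<kappa> * (b + (p0 * w' - p' * w0))"
    unfolding assms(3,4) by (simp add: r_def b_def A.res_def algebra_simps)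
  then have D: "2 * p1 * (m + \<kappa> * w') + w1 - 2 * w1 * (rnd p0 w0 m + \<kappa> * p') = r + 4 * (\<kappa> * z)"
    unfolding det(1) z by simp
  have "0 \<le> \<kappa> * z" "\<kappa> * z \<le> \<kappa> * w'" using z' assms(5) by (simp_all add: mult_left_mono)
  then show ?thesis using r assms(4) by (intro B.rndI; unfold D) simp_all
qed

text \<open>The translation is vertical, so floors of \<open>P a\<close> are compared at the same
  \<open>a\<close>; the bound \<open>a <= \<rho>\<close> keeps the perturbation \<open>2 * a\<close>
  below \<open>w0\<close>.\<close>

lemma flr_core:
  assumes "plaid p0 w0" "plaid p1 w1" "p1 = p0 + 2 * \<kappa> * p'" "w1 = w0 + 2 * \<kappa> * w'" "0 \<le> \<kappa>"
    and det: "p0 * w' - p' * w0 = \<delta>" "\<delta> = 1 \<or> \<delta> = - 1"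
    and w': "w0 = w' + 2 * \<rho>" "0 < \<rho>" "\<rho> < w'"
    and a: "0 \<le> a" "a \<le> \<rho>"
  shows "flr p1 w1 a = flr p0 w0 a"
proof (cases "a = 0")
  case True
  then show ?thesis by (simp add: flr_def)
next
  case False
  interpret A: plaid p0 w0 by fact
  interpret B: plaid p1 w1 by fact
  define r where "r = A.rem a"
  define b where "b = 2 * p' * a - w' * flr p0 w0 a"
  have r: "1 \<le> r" "r \<le> w0 - 1" unfolding r_def
    using A.rem_pos[of a] A.rem_bounds(2)[of a] False a w' by simp_all
  have "w0 * b = w' * r - 2 * a * (p0 * w' - p' * w0)"
    by (simp add: b_def r_def A.rem_def algebra_simps)
  then have b: "w0 * b = w' * r - 2 * a * \<delta>" unfolding det(1) .
  have w'_pos: "0 < w'" using w' by simp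
  have rr: "w' * 1 \<le> w' * r" "w' * r \<le> w' * (w0 - 1)"
    using r w'_pos by (simp_all only: mult_le_cancel_left_pos)
  have d: "- (2 * a) \<le> 2 * a * \<delta>" "2 * a * \<delta> \<le> 2 * a" using det(2) a by auto
  define e u v where "e = 2 * a * \<delta>" and "u = w' * r" and "v = w0 * w'"
  have "w' \<le> u" "u \<le> v - w'" using rr by (simp_all add: u_def v_def algebra_simps)
  moreover have "- (2 * a) \<le> e" "e \<le> 2 * a" using d by (simp_all add: e_def)
  moreover have "2 * a < w0" using a w' by simp
  ultimately have "- w0 < u - e" "u - e < v + w0" using w'_pos by linarith+
  then have "w0 * (- 1) < w0 * b" "w0 * b < w0 * (w' + 1)"
    unfolding b e_def u_def v_def by (simp_all add: algebra_simps)
  then have "- 1 < b" "b < w' + 1" using A.w_pos by (simp_all only: mult_less_cancel_left_pos)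
  then have b': "0 \<le> b" "b \<le> w'" by simp_all
  have D: "2 * p1 * a - w1 * flr p0 w0 a = r + 2 * (\<kappa> * b)"
    unfolding assms(3,4) by (simp add: r_def b_def A.rem_def algebra_simps)
  have "0 \<le> \<kappa> * b" "\<kappa> * b \<le> \<kappa> * w'" using b' assms(5) by (simp_all add: mult_left_mono)
  then show ?thesis using r assms(4) by (intro B.flrI; unfold D) simp_all
qed

section \<open>Tune, kappa and the even predecessor\<close>

lemma tune_unique:
  assumes "plaid p w" and x: "0 < x" "2 * x < w" "w dvd 2 * p * x - 1 \<or> w dvd 2 * p * x + 1"
    and y: "0 < y" "2 * y < w" "w dvd 2 * p * y - 1 \<or> w dvd 2 * p * y + 1"
  shows "x = y"
proof -
  interpret plaid p w by fact
  have "w dvd 2 * p * (x - y) \<or> w dvd 2 * p * (x + y)"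
    using x(3) y(3) dvd_diff[of w "2 * p * x - 1" "2 * p * y - 1"] dvd_diff[of w "2 * p * x + 1" "2 * p * y + 1"]
      dvd_add[of w "2 * p * x - 1" "2 * p * y + 1"] dvd_add[of w "2 * p * x + 1" "2 * p * y - 1"]
    by (elim disjE) (simp_all add: algebra_simps)
  then have "w dvd x - y \<or> w dvd x + y" using dvd_2p by blast
  then show ?thesis
  proof
    assume "w dvd x - y"
    moreover have "\<bar>x - y\<bar> < w" using x y by linarith
    ultimately show ?thesis by (metis dvd_imp_le_int eq_iff_diff_eq_0 linorder_not_less abs_of_pos w_pos)
  next
    assume "w dvd x + y"
    then show ?thesis using x y zdvd_imp_le[of w "x + y"] by simp
  qed
qed

lemma tune_exists:
  assumes "plaid p w"
  obtains t where "0 < t" "2 * t < w" "w dvd 2 * p * t - 1 \<or> w dvd 2 * p * t + 1"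
proof -
  interpret plaid p w by fact
  have "coprime (2 * p) w" unfolding coprime_mult_left_iff using cop w_odd by simp
  then obtain x where "[2 * p * x = 1] (mod w)" using cong_solve_coprime_int by blast
  then have x: "w dvd 2 * p * x - 1" by (simp add: cong_iff_dvd_diff)
  define y where "y = x mod w"
  have "x = y + w * (x div w)" by (simp add: y_def)
  then have "2 * p * x - 1 = (2 * p * y - 1) + w * (2 * p * (x div w))" by (metis add_diff_eq distrib_left mult.assoc mult.left_commute add.commute)
  then have y: "w dvd 2 * p * y - 1" using x by (metis dvd_add_left_iff dvd_triv_left)
  have b: "0 \<le> y" "y < w" using w_pos by (simp_all add: y_def)
  have w3: "2 < w" using p_pos p_less by simp
  have "y \<noteq> 0"
  proof
    assume "y = 0"
    then have "w dvd 1" using y by simp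
    then show False using w3 by simp
  qed
  have "2 * y \<noteq> w" using w_odd by auto
  show thesis
  proof (cases "2 * y < w")
    case True
    then show thesis using that[of y] y b \<open>y \<noteq> 0\<close> by simp
  next
    case False
    have eq: "2 * p * (w - y) + 1 = w * (2 * p) - (2 * p * y - 1)" by (simp add: algebra_simps)
    have "w dvd 2 * p * (w - y) + 1" unfolding eq by (rule dvd_diff[OF dvd_triv_left y])
    then show thesis using that[of "w - y"] False b \<open>2 * y \<noteq> w\<close> by simp
  qed
qed

lemma tune_eqI:
  assumes "even_param p q" "0 < t" "2 * t < omega p q" "omega p q dvd 2 * p * t - 1 \<or> omega p q dvd 2 * p * t + 1"
  shows "tune p q = t"
  unfolding tune_def
proof (rule the_equality)
  show "0 < t \<and> 2 * t < omega p q \<and> ([2 * p * t = 1] (mod omega p q) \<or> [2 * p * t = -1] (mod omega p q))"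
    using assms by (simp add: cong_iff_dvd_diff)
next
  fix x assume "0 < x \<and> 2 * x < omega p q \<and> ([2 * p * x = 1] (mod omega p q) \<or> [2 * p * x = -1] (mod omega p q))"
  then have x: "0 < x" "2 * x < omega p q" "omega p q dvd 2 * p * x - 1 \<or> omega p q dvd 2 * p * x + 1"
    by (simp_all add: cong_iff_dvd_diff)
  show "x = t" by (rule tune_unique[OF even_param_plaid[OF assms(1)] x assms(2-4)])
qed

lemma plaid_tune_tune:
  assumes "even_param p q"
  shows "plaid_tune p q (omega p q) (tune p q)"
proof -
  obtain t where t: "0 < t" "2 * t < omega p q" "omega p q dvd 2 * p * t - 1 \<or> omega p q dvd 2 * p * t + 1"
    by (rule tune_exists[OF even_param_plaid[OF assms]])
  then have "tune p q = t" by (rule tune_eqI[OF assms])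
  then show ?thesis using t assms by unfold_locales simp_all
qed

text \<open>Clearing denominators, the defining inequalities say that kappa is the quotient of
  \<open>t\<close> by \<open>w - 2 * t\<close>.\<close>

lemma kappa_bounds:
  assumes "even_param p q"
  shows "int (kappa p q) * (omega p q - 2 * tune p q) \<le> tune p q"
    "tune p q < (int (kappa p q) + 1) * (omega p q - 2 * tune p q)"
proof -
  interpret plaid_tune p q "omega p q" "tune p q" by (rule plaid_tune_tune[OF assms])
  define w t v where "w = omega p q" and "t = tune p q" and "v = w - 2 * t"
  have v: "0 < v" "0 < w" "0 < t" "w = v + 2 * t"
    using t_less t_pos w_pos by (simp_all add: v_def w_def t_def)
  have le: "real k / (2 * real k + 1) \<le> of_int t / of_int w \<longleftrightarrow> int k * v \<le> t" for k
  proof -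
    have "real k / (2 * real k + 1) \<le> of_int t / of_int w \<longleftrightarrow> real k * of_int w \<le> of_int t * (2 * real k + 1)"
      using v by (simp add: divide_le_eq pos_le_divide_eq mult.commute add_pos_nonneg field_simps)
    also have "\<dots> \<longleftrightarrow> real_of_int (int k * v) \<le> real_of_int t"
      unfolding v(4) by (simp add: algebra_simps)
    also have "\<dots> \<longleftrightarrow> int k * v \<le> t" by (simp only: of_int_le_iff)
    finally show ?thesis .
  qed
  have less: "of_int t / of_int w < (real k + 1) / (2 * (real k + 1) + 1) \<longleftrightarrow> t < (int k + 1) * v" for k
    using le[of "Suc k"] by (simp add: not_le[symmetric] add.commute)
  define k where "k = nat (t div v)"
  have k: "int k = t div v" using v by (simp add: k_def pos_imp_zdiv_nonneg_iff)
  have iff: "int j * v \<le> t \<and> t < (int j + 1) * v \<longleftrightarrow> j = k" for j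
  proof
    assume h: "int j * v \<le> t \<and> t < (int j + 1) * v"
    have "t = v * int j + (t - int j * v)" by simp
    then have "t div v = int j" by (rule int_div_pos_eq) (use h in \<open>simp_all add: algebra_simps\<close>)
    then show "j = k" using k by simp
  next
    assume j: "j = k"
    have "t = int k * v + t mod v" by (simp add: k)
    moreover have "0 \<le> t mod v" "t mod v < v" using v by simp_all
    ultimately show "int j * v \<le> t \<and> t < (int j + 1) * v" unfolding j by (simp add: algebra_simps)
  qed
  have "kappa p q = k"
    unfolding kappa_def w_def[symmetric] t_def[symmetric] le less iff by simp
  then show "int (kappa p q) * (omega p q - 2 * tune p q) \<le> tune p q"
    "tune p q < (int (kappa p q) + 1) * (omega p q - 2 * tune p q)"
    using iff[of k] unfolding w_def[symmetric] t_def[symmetric] v_def[symmetric] by simp_all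
qed

text \<open>The relation \<open>2 * p * t = w * j + \<sigma>\<close> rewrites as
  \<open>p * (w - 2 * t) - (p - j) * w = - \<sigma>\<close>: the tune produces the predecessor, with
  numerator \<open>p - j\<close> and size \<open>w - 2 * t\<close>.\<close>

lemma even_predecessor_props:
  assumes ep: "even_param p q" and p: "2 \<le> p"
  obtains p' q' where "even_predecessor p q = (p', q')" "even_param p' q'"
    "p' + q' = omega p q - 2 * tune p q"
    "p * (p' + q') - p' * omega p q = 1 \<or> p * (p' + q') - p' * omega p q = - 1"
proof -
  define w t v where "w = omega p q" and "t = tune p q" and "v = w - 2 * t"
  interpret plaid_tune p q w t unfolding w_def t_def by (rule plaid_tune_tune[OF ep])
  obtain j \<sigma> where j: "2 * p * t = w * j + \<sigma>" "\<sigma> = 1 \<or> \<sigma> = - 1" by (rule t_line)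
  define p' where "p' = p - j"
  have det: "p * v - p' * w = - \<sigma>" using j(1) by (simp add: v_def p'_def algebra_simps)
  have v: "0 < v" "odd v" using t_less w_odd by (simp_all add: v_def)
  \<comment> \<open>Size 1 belongs to the rational 0/1; \<open>2 <= p\<close> keeps
    \<open>p + \<sigma>\<close> strictly between 0 and \<open>w\<close>, so \<open>w\<close> cannot
    divide it.\<close>
  have "v \<noteq> 1"
  proof
    assume "v = 1"
    then have "w dvd p + \<sigma>" using det by (metis add_diff_cancel_left' diff_minus_eq_add dvd_triv_right mult.right_neutral diff_eq_eq add.commute)
    moreover have "0 < p + \<sigma>" "p + \<sigma> < w" using j(2) p p_less by auto
    ultimately show False using zdvd_not_zless by blast
  qed
  then have v3: "3 \<le> v" using v by presburger
  have p'_pos: "0 < p'"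
  proof (rule ccontr)
    assume "\<not> 0 < p'"
    then have "p' * w \<le> 0" using w_pos by (simp add: mult_le_0_iff)
    moreover have "2 * 3 \<le> p * v" using p v3 by (intro mult_mono) simp_all
    ultimately show False using det j(2) by auto
  qed
  have p'_less: "2 * p' < v"
  proof -
    have "w * (2 * p') = 2 * p * v + 2 * \<sigma>" using det by (simp add: algebra_simps)
    also have "\<dots> \<le> (w - 1) * v + 2 * \<sigma>" using p_less v by (simp add: mult_right_mono)
    also have "\<dots> < w * v" using j(2) v3 by (auto simp: algebra_simps)
    finally show ?thesis using w_pos by (simp only: mult_less_cancel_left_pos)
  qed
  define q' where "q' = v - p'"
  have cp: "coprime p' q'"
  proof (rule coprimeI)
    fix c assume c: "c dvd p'" "c dvd q'"
    then have "c dvd v" using dvd_add[OF c] by (simp add: q'_def)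
    then have "c dvd p * v - p' * w" using c by simp
    then show "is_unit c" unfolding det using j(2) by auto
  qed
  have ev: "even (p' * q')" using v(2) by (auto simp: q'_def)
  have ep': "even_param p' q'" using p'_pos p'_less cp ev by (simp add: even_param_def q'_def)
  have sum: "p' + q' = v" by (simp add: q'_def)
  have det_pq: "p * y - x * q = p * (x + y) - x * w" for x y
    by (simp add: w_def omega_def algebra_simps)
  \<comment> \<open>A candidate of size \<open>u\<close> makes half of \<open>w - u\<close> satisfy
    the congruence of the tune, so uniqueness of the tune fixes the size. The numerators can then
    differ only by a multiple of \<open>w\<close> that is at most 2 in absolute value.\<close>
  have unique: "x = p' \<and> y = q'" if h: "even_rational x y" "\<bar>p * y - x * q\<bar> = 1" "x + y < p + q" for x y
  proof -
    define u where "u = x + y"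
    have u: "0 < u" "u < w" "odd u"
      using h(1,3) by (auto simp: even_rational_def even_param_def u_def w_def omega_def)
    have du: "p * u - x * w = 1 \<or> p * u - x * w = - 1" using h(2) unfolding det_pq u_def by linarith
    obtain s where s: "w - u = 2 * s" using u(3) w_odd by (metis evenE odd_even_add even_diff odd_add)
    have "2 * (2 * p * s) = 2 * p * (w - u)" by (simp add: s)
    then have "2 * p * s = p * w - p * u" by (simp add: algebra_simps)
    then have "2 * p * s - 1 = w * (p - x) \<or> 2 * p * s + 1 = w * (p - x)" using du by (auto simp: algebra_simps)
    then have "w dvd 2 * p * s - 1 \<or> w dvd 2 * p * s + 1" by (metis dvd_triv_left)
    moreover have "0 < s" "2 * s < w" using s u by linarith+
    ultimately have "s = t" using tune_unique[OF plaid_axioms _ _ _ t_pos t_less t_tune] by blast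
    then have uv: "u = v" using s by (simp add: v_def)
    then have "(p' - x) * w \<in> {- 2, 0, 2}" using du det j(2) by (auto simp: algebra_simps)
    then have "\<bar>(p' - x) * w\<bar> \<le> 2" by auto
    then have "\<bar>p' - x\<bar> * w \<le> 2" using w_pos by (simp add: abs_mult)
    then have "p' = x"
    proof -
      have False if "1 \<le> \<bar>p' - x\<bar>"
      proof -
        have "w \<le> \<bar>p' - x\<bar> * w" using mult_right_mono[OF that, of w] w_pos by simp
        then show False using t_pos t_less \<open>\<bar>p' - x\<bar> * w \<le> 2\<close> by linarith
      qed
      then show ?thesis by force
    qed
    then show ?thesis using uv unfolding u_def q'_def by simp
  qed
  have "p' + q' < p + q" using t_pos by (simp add: sum v_def w_def omega_def)
  moreover have "\<bar>p * q' - p' * q\<bar> = 1" unfolding det_pq sum det using j(2) by auto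
  ultimately have exists: "even_rational p' q' \<and> \<bar>p * q' - p' * q\<bar> = 1 \<and> p' + q' < p + q"
    using ep' by (simp add: even_rational_def)
  have "even_predecessor p q = (p', q')"
    unfolding even_predecessor_def
  proof (rule the_equality)
    show "case (p', q') of (x, y) \<Rightarrow> even_rational x y \<and> \<bar>p * y - x * q\<bar> = 1 \<and> x + y < p + q"
      using exists by simp
    fix z assume "case z of (x, y) \<Rightarrow> even_rational x y \<and> \<bar>p * y - x * q\<bar> = 1 \<and> x + y < p + q"
    then show "z = (p', q')" using unique by (cases z) auto
  qed
  then show thesis using that ep' sum det j(2) unfolding v_def w_def t_def by (auto simp: sum)
qed

text \<open>With kappa zero, \<open>t1\<close> satisfies the congruence of the tune for
  \<open>w0\<close> too, and \<open>2 * t1 < w0\<close>, that is \<open>4 * t1 < w1\<close>, decides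
  whether the tune is \<open>t1\<close> or its reflection \<open>w0 - t1\<close>. With kappa
  positive, \<open>t0\<close> is the remainder of \<open>t1\<close> on division by
  \<open>w'\<close>.\<close>

lemma predecessor_cases:
  assumes ep1: "even_param p1 q1" and ep0: "even_param p0 q0" and pr: "(p0, q0) = predecessor p1 q1"
  defines "w1 \<equiv> omega p1 q1" and "t1 \<equiv> tune p1 q1" and "w0 \<equiv> omega p0 q0" and "t0 \<equiv> tune p0 q0"
  obtains (noncore) \<epsilon> where "3 * t1 < w1" "w0 = w1 - 2 * t1" "\<epsilon> = 1 \<or> \<epsilon> = - 1" "p1 * w0 - p0 * w1 = \<epsilon>"
      "4 * t1 < w1 \<Longrightarrow> t0 = t1" "w1 < 4 * t1 \<Longrightarrow> t0 = w0 - t1"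
  | (core) \<kappa> p' w' \<delta> where "w1 < 3 * t1" "1 \<le> \<kappa>" "p1 = p0 + 2 * \<kappa> * p'" "w1 = w0 + 2 * \<kappa> * w'"
      "p0 * w' - p' * w0 = \<delta>" "\<delta> = 1 \<or> \<delta> = - 1" "odd w'" "w0 = w' + 2 * t0" "t0 < w'" "t1 = \<kappa> * w' + t0"
proof -
  have "p1 \<noteq> 1" using pr ep0 by (auto simp: predecessor_def even_param_def)
  then have p1: "2 \<le> p1" using ep1 by (auto simp: even_param_def)
  obtain p' q' where e: "even_predecessor p1 q1 = (p', q')" "even_param p' q'" "p' + q' = w1 - 2 * t1"
    "p1 * (p' + q') - p' * w1 = 1 \<or> p1 * (p' + q') - p' * w1 = - 1"
    unfolding w1_def t1_def by (rule even_predecessor_props[OF ep1 p1])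
  define w' where "w' = p' + q'"
  interpret T1: plaid_tune p1 q1 w1 t1 unfolding w1_def t1_def by (rule plaid_tune_tune[OF ep1])
  interpret E': plaid p' w' using even_param_plaid[OF e(2)] by (simp add: w'_def omega_def)
  obtain \<epsilon> where \<epsilon>: "\<epsilon> = 1 \<or> \<epsilon> = - 1" "p1 * w' - p' * w1 = \<epsilon>" using e(4) w'_def by blast
  have w': "w' = w1 - 2 * t1" using e(3) w'_def by simp
  define k where "k = int (kappa p1 q1)"
  have k: "k * w' \<le> t1" "t1 < (k + 1) * w'" "0 \<le> k"
    using kappa_bounds[OF ep1] by (simp_all add: k_def w' w1_def t1_def)
  show thesis
  proof (cases "kappa p1 q1 = 0")
    case True
    then have "predecessor p1 q1 = (p', q')" using p1 e(1) by (simp add: predecessor_def)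
    then have pq: "p0 = p'" "q0 = q'" using pr by simp_all
    have w0: "w0 = w'" by (simp add: w0_def omega_def pq w'_def)
    have less: "3 * t1 < w1" using k(2) True w' by (simp add: k_def)
    have d0: "w0 dvd 2 * p0 * t1 - 1 \<or> w0 dvd 2 * p0 * t1 + 1"
    proof -
      have "p0 * w1 = p1 * w0 - \<epsilon>" using \<epsilon>(2) by (simp add: w0 pq)
      moreover have "w1 = w0 + 2 * t1" by (simp add: w0 w')
      ultimately have "2 * p0 * t1 + \<epsilon> = w0 * (p1 - p0)" by (simp add: algebra_simps)
      then have "w0 dvd 2 * p0 * t1 + \<epsilon>" by simp
      then show ?thesis using \<epsilon>(1) by auto
    qed
    show thesis
    proof (rule noncore[of \<epsilon>])
      show "3 * t1 < w1" "w0 = w1 - 2 * t1" "\<epsilon> = 1 \<or> \<epsilon> = - 1" using less w0 w' \<epsilon> by simp_all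
      show "p1 * w0 - p0 * w1 = \<epsilon>" using \<epsilon>(2) by (simp add: w0 pq)
      show "t0 = t1" if "4 * t1 < w1"
        unfolding t0_def by (rule tune_eqI[OF ep0]) (use that d0 w0 w' T1.t_pos in \<open>simp_all add: w0_def[symmetric]\<close>)
      show "t0 = w0 - t1" if "w1 < 4 * t1"
        unfolding t0_def
      proof (rule tune_eqI[OF ep0], unfold w0_def[symmetric])
        show "0 < w0 - t1" "2 * (w0 - t1) < w0" using that less w0 w' by simp_all
        have eq: "2 * p0 * (w0 - t1) - 1 = w0 * (2 * p0) - (2 * p0 * t1 + 1)"
          "2 * p0 * (w0 - t1) + 1 = w0 * (2 * p0) - (2 * p0 * t1 - 1)" by (simp_all add: algebra_simps)
        show "w0 dvd 2 * p0 * (w0 - t1) - 1 \<or> w0 dvd 2 * p0 * (w0 - t1) + 1"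
          unfolding eq using d0 dvd_diff[OF dvd_triv_left] by blast
      qed
    qed
  next
    case False
    then have "predecessor p1 q1 = (p1 - 2 * k * p', q1 - 2 * k * q')"
      using p1 e(1) by (simp add: predecessor_def core_predecessor_def k_def)
    then have pq: "p1 = p0 + 2 * k * p'" "q1 = q0 + 2 * k * q'" using pr by simp_all
    have w10: "w1 = w0 + 2 * k * w'" unfolding w1_def w0_def omega_def pq w'_def by (simp add: algebra_simps)
    have k1: "1 \<le> k" using False by (simp add: k_def)
    define \<rho> where "\<rho> = t1 - k * w'"
    have \<rho>: "0 \<le> \<rho>" "\<rho> < w'" using k by (simp_all add: \<rho>_def algebra_simps)
    have w0: "w0 = w' + 2 * \<rho>" 
    proof -
      have "2 * k * w' = 2 * (k * w')" "2 * (t1 - k * w') = 2 * t1 - 2 * (k * w')" by simp_all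
      then show ?thesis unfolding \<rho>_def using w10 w' by linarith
    qed
    have det: "p0 * w' - p' * w0 = \<epsilon>" using \<epsilon>(2) unfolding pq w10 by (simp add: algebra_simps)
    \<comment> \<open>A zero remainder would make \<open>w'\<close> a divisor of 1, whereas an even
      parameter has size at least 3.\<close>
    have "\<rho> \<noteq> 0"
    proof
      assume "\<rho> = 0"
      then have "w' * (p0 - p') = \<epsilon>" using det w0 by (simp add: algebra_simps)
      then have "w' dvd \<epsilon>" by (metis dvd_triv_left)
      then have "w' dvd 1" using \<epsilon>(1) by auto
      then have "w' = 1" using E'.w_pos by simp
      then show False using E'.p_pos E'.p_less by simp
    qed
    then have \<rho>_pos: "0 < \<rho>" using \<rho> by simp
    have t0: "t0 = \<rho>"
      unfolding t0_def
    proof (rule tune_eqI[OF ep0 \<rho>_pos], unfold w0_def[symmetric])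
      show "2 * \<rho> < w0" using w0 E'.w_pos by simp
      have "2 * p0 * \<rho> = p0 * w0 - p0 * w'" unfolding w0 by (simp add: algebra_simps)
      then have "2 * p0 * \<rho> + \<epsilon> = w0 * (p0 - p')" using det by (simp add: algebra_simps)
      then have "w0 dvd 2 * p0 * \<rho> + \<epsilon>" by simp
      then show "w0 dvd 2 * p0 * \<rho> - 1 \<or> w0 dvd 2 * p0 * \<rho> + 1" using \<epsilon>(1) by auto
    qed
    show thesis
    proof (rule core[of k p' w' \<epsilon>])
      have t1: "t1 = k * w' + \<rho>" by (simp add: \<rho>_def)
      then show "t1 = k * w' + t0" by (simp add: t0)
      have "1 * w' \<le> k * w'" using k1 E'.w_pos by (intro mult_right_mono) simp_all
      then show "w1 < 3 * t1" unfolding t1 w10 w0 using \<rho>_pos by simp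
    qed (use k1 pq w10 det \<epsilon>(1) E'.w_odd w0 \<rho> in \<open>simp_all add: t0\<close>)
  qed
qed


text \<open>The neighbour steps are copies with shift zero; the bound on \<open>s + y + 2 * x\<close> is the one under
  which no nearest integer changes.\<close>

lemma copy_neighbour_chain:
  fixes p q :: "nat \<Rightarrow> int" and x y s c :: int
  defines "w \<equiv> \<lambda>j. omega (p j) (q j)" and "t \<equiv> \<lambda>j. tune (p j) (q j)"
  assumes ep: "\<And>j. i \<le> j \<Longrightarrow> even_param (p j) (q j)"
    and nb: "\<And>j. \<lbrakk>i \<le> j; j < m\<rbrakk> \<Longrightarrow>
      w j < w (Suc j) \<and> (p (Suc j) * w j - p j * w (Suc j) = 1 \<or> p (Suc j) * w j - p j * w (Suc j) = - 1)"
    and "i < m" and s: "0 \<le> s" "0 < x" "2 * x < y" "y \<le> w i" and bound: "2 * (s + y + 2 * x - 1) < w i + w (Suc i)"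
    and start: "\<And>n. \<lbrakk>- 2 * x < n; n < y + 2 * x\<rbrakk> \<Longrightarrow> rnd (p i) (w i) (n + s) = rnd p0 w0 n + c"
      "\<And>a. \<lbrakk>0 \<le> a; a \<le> x\<rbrakk> \<Longrightarrow> flr (p i) (w i) a = flr p0 w0 a"
  shows "\<And>n. \<lbrakk>- 2 * x < n; n < y + 2 * x\<rbrakk> \<Longrightarrow> rnd (p m) (w m) (n + s) = rnd p0 w0 n + c"
    and "\<And>a. \<lbrakk>0 \<le> a; a \<le> x\<rbrakk> \<Longrightarrow> flr (p m) (w m) a = flr p0 w0 a"
proof -
  have pl: "plaid (p j) (w j)" if "i \<le> j" for j
    unfolding w_def by (rule even_param_plaid[OF ep[OF that]])
  have mono: "w i \<le> w j" if "i \<le> j" "j \<le> m" for j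
    using that(1,2)
  proof (induction j rule: dec_induct)
    case (step j)
    then show ?case using nb[of j] by simp
  qed simp
  have mono': "w (Suc i) \<le> w j" if "Suc i \<le> j" "j \<le> m" for j
    using that(1,2)
  proof (induction j rule: dec_induct)
    case (step j)
    then show ?case using nb[of j] by simp
  qed simp
  have main: "(\<forall>n. - 2 * x < n \<and> n < y + 2 * x \<longrightarrow> rnd (p j) (w j) (n + s) = rnd p0 w0 n + c) \<and>
      (\<forall>a. 0 \<le> a \<and> a \<le> x \<longrightarrow> flr (p j) (w j) a = flr p0 w0 a)" if "i \<le> j" "j \<le> m" for j
    using that(1,2)
  proof (induction j rule: dec_induct)
    case base
    then show ?case using start by blast
  next
    case (step j)
    obtain \<epsilon> where \<epsilon>: "p (Suc j) * w j - p j * w (Suc j) = \<epsilon>" "\<epsilon> = 1 \<or> \<epsilon> = - 1"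
      using nb[of j] step by auto
    have wj: "w i \<le> w j" "w (Suc i) \<le> w (Suc j)" "w j < w (Suc j)"
      using mono[of j] mono'[of "Suc j"] nb[of j] step by simp_all
    have "rnd (p (Suc j)) (w (Suc j)) (n + s) = rnd (p j) (w j) (n + s)" if "- 2 * x < n" "n < y + 2 * x" for n
    proof (rule rnd_neighbour[OF pl pl \<epsilon>])
      show "2 * \<bar>n + s\<bar> < w j + w (Suc j)" using that s bound wj by (simp add: abs_if)
    qed (use step in simp_all)
    moreover have "flr (p (Suc j)) (w (Suc j)) a = flr (p j) (w j) a" if "0 \<le> a" "a \<le> x" for a
      by (rule flr_neighbour[OF pl pl \<epsilon>]) (use that s wj step in simp_all)
    ultimately show ?case using step by simp
  qed
  show "\<And>n. \<lbrakk>- 2 * x < n; n < y + 2 * x\<rbrakk> \<Longrightarrow> rnd (p m) (w m) (n + s) = rnd p0 w0 n + c"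
    "\<And>a. \<lbrakk>0 \<le> a; a \<le> x\<rbrakk> \<Longrightarrow> flr (p m) (w m) a = flr p0 w0 a"
    using main[of m] \<open>i < m\<close> by auto
qed

theorem theorem4p4:
  fixes A :: real and p q :: "nat \<Rightarrow> int" and k m :: nat and p0 q0 p1 q1 :: int
  assumes "A \<in> {0<..<1}" and "A \<notin> \<rat>"
    and "predecessor_sequence A p q"
    and "successive_approx p q k m"
    and "p0 = p k" "q0 = q k" "p1 = p m" "q1 = q m"
    and "real_of_int p0 / real_of_int q0 \<in> {0<..<1}"
    and "real_of_int p1 / real_of_int q1 \<in> {0<..<1}"
  shows "\<exists>t::real.
           vtrans t ` rect p0 q0 \<subseteq> rect_lower p1 q1 \<and>
           vtrans t ` gamma_arc p0 q0 \<subseteq> gamma_arc p1 q1 \<and>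
           (vtrans t ` bottom_line p0 q0 = bottom_line p1 q1 \<or>
            vtrans t ` top_line p0 q0 = bottom_line p1 q1)"
proof -
  define w where "w j = omega (p j) (q j)" for j
  define t where "t j = tune (p j) (q j)" for j
  have "p 0 = 0" using assms(3) by (simp add: predecessor_sequence_def)
  then have k0: "k \<noteq> 0" using assms(5,9) by (intro notI) simp
  have ep: "even_param (p j) (q j)" if "1 \<le> j" for j
    using assms(3) that by (cases j) (auto simp: predecessor_sequence_def)
  have pr: "(p j, q j) = predecessor (p (Suc j)) (q (Suc j))" for j
    using assms(3) by (auto simp: predecessor_sequence_def)
  have T: "plaid_tune (p j) (q j) (w j) (t j)" if "1 \<le> j" for j
    unfolding w_def t_def by (rule plaid_tune_tune[OF ep[OF that]])
  have pl: "plaid (p j) (w j)" if "1 \<le> j" for j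
    unfolding w_def by (rule even_param_plaid[OF ep[OF that]])
  have tpos: "0 < t j \<and> 2 * t j < w j" if "1 \<le> j" for j
    using plaid_tune.t_pos[OF T[OF that]] plaid_tune.t_less[OF T[OF that]] by simp
  have wodd: "odd (w j)" if "1 \<le> j" for j using plaid.w_odd[OF pl[OF that]] .
  note steps = predecessor_cases[OF ep ep pr, folded w_def t_def]
  have core_iff: "core_term p q j \<longleftrightarrow> w (Suc j) < 3 * t (Suc j)" for j
  proof -
    have "core_term p q j \<longleftrightarrow> real_of_int (w (Suc j)) < real_of_int (3 * t (Suc j))"
      by (auto simp: core_term_def w_def t_def)
    then show ?thesis by (simp only: of_int_less_iff)
  qed
  have strong_iff: "strong_term p q j \<longleftrightarrow> w (Suc j) < 4 * t (Suc j) \<and> 3 * t (Suc j) < w (Suc j)" for j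
  proof -
    have "strong_term p q j \<longleftrightarrow> real_of_int (w (Suc j)) < real_of_int (4 * t (Suc j)) \<and>
        real_of_int (3 * t (Suc j)) < real_of_int (w (Suc j))"
      by (auto simp: strong_term_def w_def t_def)
    then show ?thesis by (simp only: of_int_less_iff)
  qed
  have km: "k < m" and ak: "approx_index p q k" and am: "approx_index p q m"
    and between: "\<And>j. \<lbrakk>k < j; j < m\<rbrakk> \<Longrightarrow> \<not> approx_index p q j"
    using assms(4) by (auto simp: successive_approx_def)
  \<comment> \<open>The lower term of a core step satisfies
    \<open>w (Suc j) = w' + 2 * t (Suc j)\<close> with \<open>t (Suc j) < w'\<close>, which
    contradicts the core step leading into it.\<close>
  have core_next: "\<not> core_term p q (Suc j)" if "core_term p q j" "1 \<le> j" for j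
  proof
    assume c: "core_term p q (Suc j)"
    have j: "1 \<le> Suc (Suc j)" "1 \<le> Suc j" by simp_all
    show False
    proof (cases rule: steps[OF j, case_names noncore core])
      case (noncore \<epsilon>)
      then show False using c core_iff by simp
    next
      case (core \<kappa> p' w' \<delta>)
      then show False using that(1) unfolding core_iff by linarith
    qed
  qed
  \<comment> \<open>A core step imposes this on its lower term. A retained strong term has it
    because the step into it is not core. It makes the rectangle equal to the strip.\<close>
  have narrow: "3 * t j \<le> w j" if "approx_index p q j" "1 \<le> j" for j
  proof (cases "core_term p q j")
    case True
    have j: "1 \<le> Suc j" by simp
    show ?thesis
    proof (cases rule: steps[OF j that(2), case_names noncore core])
      case (noncore \<epsilon>)
      then show ?thesis using True core_iff by simp
    next
      case (core \<kappa> p' w' \<delta>)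
      then show ?thesis by linarith
    qed
  next
    case False
    then have "\<not> core_term p q (j - 1)" using that by (auto simp: approx_index_def)
    then show ?thesis using core_iff[of "j - 1"] that(2) by simp
  qed
  have next_step: "w j < w (Suc j) \<and> 3 * t (Suc j) < w (Suc j) \<and> w j = w (Suc j) - 2 * t (Suc j) \<and>
      (p (Suc j) * w j - p j * w (Suc j) = 1 \<or> p (Suc j) * w j - p j * w (Suc j) = - 1) \<and>
      (4 * t (Suc j) < w (Suc j) \<longrightarrow> t (Suc j) = t j) \<and> (w (Suc j) < 4 * t (Suc j) \<longrightarrow> t (Suc j) = w j - t j)"
    if "\<not> core_term p q j" "1 \<le> j" for j
  proof -
    have j: "1 \<le> Suc j" by simp
    show ?thesis
    proof (cases rule: steps[OF j that(2), case_names noncore core])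
      case (noncore \<epsilon>)
      then show ?thesis using tpos[of "Suc j"] by auto
    next
      case (core \<kappa> p' w' \<delta>)
      then show ?thesis using that(1) core_iff by simp
    qed
  qed
  have four: "w j \<noteq> 4 * t j" if "1 \<le> j" for j using wodd[OF that] by auto
  \<comment> \<open>A weak step preserves the tune, hence the height of the lower line of capacity
    2, so a tail of weak steps leaves the anchor in place.\<close>
  have weak_const: "w i \<le> w j \<and> t j = t i"
    if "i \<le> j" "1 \<le> i" "\<And>l. \<lbrakk>i \<le> l; l < j\<rbrakk> \<Longrightarrow> \<not> core_term p q l \<and> \<not> strong_term p q l" for i j
    using that(1,3)
  proof (induction j rule: dec_induct)
    case (step j)
    have j: "\<not> core_term p q j" "\<not> strong_term p q j" "1 \<le> j" using step.prems[of j] step.hyps that(2) by auto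
    have "4 * t (Suc j) < w (Suc j)"
      using j(2) four[of "Suc j"] next_step[OF j(1,3)] unfolding strong_iff by auto
    moreover have "w i \<le> w j \<and> t j = t i" using step.prems by (intro step.IH) simp
    ultimately show ?case using next_step[OF j(1,3)] by simp
  qed simp
  have k1: "1 \<le> k" using k0 by simp
  have nk: "3 * t k \<le> w k" by (rule narrow[OF ak k1])
  have nm: "3 * t m \<le> w m" using narrow[OF am] km by simp
  have not_core: "\<not> core_term p q j" if "k < j" "j < m" for j
    using between[OF that] by (auto simp: approx_index_def)
  \<comment> \<open>From the second intermediate term on, the term before is intermediate too and so
    not core; a strong term there would be retained.\<close>
  have weak: "\<not> core_term p q j \<and> \<not> strong_term p q j" if "Suc k < j" "j < m" for j
  proof -
    have "\<not> core_term p q (j - 1)" using that by (intro not_core) simp_all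
    then show ?thesis using between[of j] that by (auto simp: approx_index_def)
  qed
  have nb: "w j < w (Suc j) \<and> (p (Suc j) * w j - p j * w (Suc j) = 1 \<or> p (Suc j) * w j - p j * w (Suc j) = - 1)"
    if "\<not> core_term p q j" "1 \<le> j" for j
    using next_step[OF that] by blast
  show ?thesis
  proof (cases "core_term p q k")
    case False
    then have st: "strong_term p q k" using ak by (auto simp: approx_index_def)
    \<comment> \<open>The strong step reflects the tune: the lower line of the next term has the
      height of the upper line of the \<open>k\<close>-th one. The remaining steps are weak, so
      shift 0 carries the top line to the bottom line.\<close>
    have "w k = w (Suc k) - 2 * t (Suc k)" "t (Suc k) = w k - t k"
      using next_step[OF False k1] st unfolding strong_iff by blast+
    then have tS: "t (Suc k) = w k - t k" "w (Suc k) = w k + 2 * t (Suc k)" by linarith+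
    have nc: "\<not> core_term p q j" if "k \<le> j" "j < m" for j
      using False not_core that by (cases "j = k") simp_all
    have wk: "\<not> core_term p q j \<and> \<not> strong_term p q j" if "Suc k \<le> j" "j < m" for j
    proof (cases "j = Suc k")
      case True
      then show ?thesis using between[of j] that False by (auto simp: approx_index_def)
    qed (use weak that in simp)
    have m: "w (Suc k) \<le> w m \<and> t m = t (Suc k)"
      using weak_const[of "Suc k" m] wk km by simp
    have nbk: "w j < w (Suc j) \<and> (p (Suc j) * w j - p j * w (Suc j) = 1 \<or> p (Suc j) * w j - p j * w (Suc j) = - 1)"
      if "k \<le> j" "j < m" for j
      by (rule nb[OF nc[OF that]]) (use that k1 in simp)
    have epk: "even_param (p j) (q j)" if "k \<le> j" for j by (rule ep) (use that k1 in simp)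
    \<comment> \<open>With \<open>w (Suc k) = 3 * w k - 2 * t k\<close> this reduces to
      \<open>3 * t k - 1 < w k\<close>.\<close>
    have bound: "2 * (0 + w k + 2 * t k - 1) < w k + w (Suc k)" 
    proof -
      have "w (Suc k) = 3 * w k - 2 * t k" using tS by simp
      then show ?thesis using nk by simp
    qed
    have start: "rnd (p k) (w k) (n + 0) = rnd (p k) (w k) n + 0" for n by simp
    have tk: "0 < t k" "2 * t k < w k" using tpos[OF k1] by simp_all
    have rf: "rnd (p m) (w m) (n + 0) = rnd (p k) (w k) n + 0" if "- 2 * t k < n" "n < w k + 2 * t k" for n
      by (rule copy_neighbour_chain(1)[where p = p and q = q, folded w_def,
        OF epk nbk km order_refl tk order_refl bound start refl that])
    have ff: "flr (p m) (w m) a = flr (p k) (w k) a" if "0 \<le> a" "a \<le> t k" for a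
      by (rule copy_neighbour_chain(2)[where p = p and q = q, folded w_def,
        OF epk nbk km order_refl tk order_refl bound start refl that])
    show ?thesis unfolding assms(5-8)
    proof (rule copy_strip[OF T T nk nm _ _ _ _ _ rf ff])
      show "w k - t k + 0 = t m" "w k - t k = t k \<or> w k - t k = w k - t k" using m tS by simp_all
      show "t k \<le> t m" "2 * (0 + w k) < w m" using m tS tpos[OF k1] by simp_all
    qed (use k1 km in simp_all)
  next
    case True
    have j: "1 \<le> Suc k" by simp
    show ?thesis
    proof (cases rule: steps[OF j k1, case_names noncore core])
      case (noncore \<epsilon>)
      then show ?thesis using True core_iff by simp
    next
      case (core \<kappa> p' w' \<delta>)
      have nck: "\<not> core_term p q (Suc k)" by (rule core_next[OF True k1])
      \<comment> \<open>The term after a core term is not core, and a strong one there is not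
        retained, so at least one more step follows.\<close>
      have "m \<noteq> Suc k" using am nck True by (auto simp: approx_index_def)
      then have km2: "Suc k < m" using km by simp
      have nc: "\<not> core_term p q j" if "Suc k \<le> j" "j < m" for j
        using not_core that by simp
      \<comment> \<open>This step may be weak or strong, since a strong term directly after a core
        term is skipped. Accordingly the tune is kept or reflected, which produces the two
        alternatives of the conclusion.\<close>
      have S: "w (Suc k) < w (Suc (Suc k))" "w (Suc (Suc k)) = w (Suc k) + 2 * t (Suc (Suc k))"
        "t (Suc (Suc k)) = t (Suc k) \<or> t (Suc (Suc k)) = w (Suc k) - t (Suc k)"
      proof -
        have "4 * t (Suc (Suc k)) < w (Suc (Suc k)) \<or> w (Suc (Suc k)) < 4 * t (Suc (Suc k))"
          using four[of "Suc (Suc k)"] by (simp add: linorder_neq_iff disj_commute)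
        then show "w (Suc k) < w (Suc (Suc k))" "t (Suc (Suc k)) = t (Suc k) \<or> t (Suc (Suc k)) = w (Suc k) - t (Suc k)"
          using next_step[OF nck j] by blast+
        have "w (Suc k) = w (Suc (Suc k)) - 2 * t (Suc (Suc k))" using next_step[OF nck j] by blast
        then show "w (Suc (Suc k)) = w (Suc k) + 2 * t (Suc (Suc k))" by linarith
      qed
      have m: "w (Suc (Suc k)) \<le> w m \<and> t m = t (Suc (Suc k))"
        using weak_const[of "Suc (Suc k)" m] weak km2 by simp
      define u where "u = \<kappa> * w'"
      have w'u: "w' \<le> u" using core mult_right_mono[of 1 \<kappa> w'] tpos[OF k1] by (simp add: u_def)
      have W: "w (Suc k) = w k + 2 * u" "t (Suc k) = u + t k" "w k = w' + 2 * t k" "t k < w'" "0 < t k"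
        using core tpos[OF k1] by (simp_all add: u_def)
      have tS: "u + t k \<le> t (Suc (Suc k))" using S(3) W by auto
      have core_rnd: "rnd (p (Suc k)) (w (Suc k)) (n + u) = rnd (p k) (w k) n + \<kappa> * p'"
        if "- 2 * t k < n" "n < w k + 2 * t k" for n
        unfolding u_def
        by (rule rnd_core[OF pl[OF k1] pl[OF j] core(3,4) _ core(5,6,7,8) W(5) core(9) that]) (use core(2) in simp)
      have core_flr: "flr (p (Suc k)) (w (Suc k)) a = flr (p k) (w k) a" if "0 \<le> a" "a \<le> t k" for a
        by (rule flr_core[OF pl[OF k1] pl[OF j] core(3,4) _ core(5,6,8) W(5) core(9) that]) (use core(2) in simp)
      \<comment> \<open>As \<open>t (Suc (Suc k))\<close> is at least \<open>u + t k\<close>, it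
        suffices that \<open>t k - 1 < 2 * u\<close>, and this follows from \<open>t k < w'\<close>
        and \<open>w' <= u\<close>.\<close>
      have bound: "2 * (u + w k + 2 * t k - 1) < w (Suc k) + w (Suc (Suc k))"
        using S(2) W tS w'u by simp
      have nbk: "w j < w (Suc j) \<and> (p (Suc j) * w j - p j * w (Suc j) = 1 \<or> p (Suc j) * w j - p j * w (Suc j) = - 1)"
        if "Suc k \<le> j" "j < m" for j
        by (rule nb[OF nc[OF that]]) (use that in simp)
      have epk: "even_param (p j) (q j)" if "Suc k \<le> j" for j by (rule ep) (use that in simp)
      have tk: "0 < t k" "2 * t k < w k" and u0: "0 \<le> u" and wk: "w k \<le> w (Suc k)"
        using tpos[OF k1] W w'u by linarith+
      have rf: "rnd (p m) (w m) (n + u) = rnd (p k) (w k) n + \<kappa> * p'" if "- 2 * t k < n" "n < w k + 2 * t k" for n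
        by (rule copy_neighbour_chain(1)[where p = p and q = q, folded w_def,
          OF epk nbk km2 u0 tk wk bound core_rnd core_flr that])
      have ff: "flr (p m) (w m) a = flr (p k) (w k) a" if "0 \<le> a" "a \<le> t k" for a
        by (rule copy_neighbour_chain(2)[where p = p and q = q, folded w_def,
          OF epk nbk km2 u0 tk wk bound core_rnd core_flr that])
      \<comment> \<open>The candidates for \<open>t m\<close> are \<open>t (Suc k) = u + t k\<close>
        and \<open>w (Suc k) - t (Suc k) = u + w k - t k\<close>; undoing the shift gives one of the
        two lines of capacity 2 of the \<open>k\<close>-th term.\<close>
      define n0 where "n0 = t m - u"
      show ?thesis unfolding assms(5-8)
      proof (rule copy_strip[OF T T nk nm _ _ _ _ _ rf ff])
        show "n0 + u = t m" by (simp add: n0_def)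
        show "n0 = t k \<or> n0 = w k - t k" using S(3) m W by (auto simp: n0_def)
        show "t k \<le> t m" "0 \<le> u" "2 * (u + w k) < w m" using m tS S(2) W w'u by simp_all
      qed (use k1 km in simp_all)
    qed
  qed
qed

end
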